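(* Let $K$ be a field of prime characteristic $p$ with $[K:K^p]<\infty$ and let $S=K[\![x_1,\dots,x_n]\!]$. If $f$ is a nonunit nonzero element of $S$ and $y$ is a new variable over $S$, then the F-signatures of $S/fS$ and $S[\![y]\!]/fS[\![y]\!]$ are the same; consequently, the F-signatures of $S/fS$ and $S[\![y_1,\dots,y_m]\!]/fS[\![y_1,\dots,y_m]\!]$ are the same for every positive integer $m$.
   Context: For a ring $A$ of characteristic $p$ and $e\ge1$, $F_*^e(A)$ is the $A$-module equal to $A$ as an abelian group (the element corresponding to $m$ is written $F_*^e(m)$) with $aF_*^e(m)=F_*^e(a^{p^e}m)$. F-signature: let $(A,\mathfrak m,k)$ be a Noetherian local ring of prime characteristic $p$ and dimension $D$ that is F-finite (i.e. $F_*^1(A)$ is a finitely generated $A$-module). Let $a_e(A)$ be the maximal rank of a free direct summand of $F_*^e(A)$, i.e. the unique nonnegative integer with $F_*^e(A)\cong A^{a_e(A)}\oplus M_e$ where $M_e$ has no nonzero free direct summand. With $\alpha(A)=\log_p[k:k^p]$, the F-signature is $\mathbb S(A)=\lim_{e\to\infty}a_e(A)/p^{e(D+\alpha(A))}$. *)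

theory Defs
  imports Complex_Main "HOL-Library.Extended_Nat" "HOL-Library.Multiset" "HOL-Algebra.Algebra"
begin

section \<open>Formal power series in several variables\<close>

text \<open>
  The ring of formal power series over R in variables indexed by the finite set I.  As in
  \<^theory>\<open>HOL-Algebra.Indexed_Polynomials\<close>, a monomial is a multiset of indices and a series is its
  coefficient function; coefficients at monomials that involve an index outside I vanish.
\<close>
definition power_series_ring ::
    "('a, 'r) ring_scheme \<Rightarrow> 'v set \<Rightarrow> ('v multiset \<Rightarrow> 'a) ring" where
  "power_series_ring R I =
    \<lparr> carrier = {f. (\<forall>m. f m \<in> carrier R) \<and> (\<forall>m. \<not> set_mset m \<subseteq> I \<longrightarrow> f m = \<zero>\<^bsub>R\<^esub>)},
      monoid.mult = (\<lambda>f g m. \<Oplus>\<^bsub>R\<^esub>d\<in>{d. d \<subseteq># m}. f d \<otimes>\<^bsub>R\<^esub> g (m - d)),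
      one = (\<lambda>m. if m = {#} then \<one>\<^bsub>R\<^esub> else \<zero>\<^bsub>R\<^esub>),
      ring.zero = (\<lambda>m. \<zero>\<^bsub>R\<^esub>),
      add = (\<lambda>f g m. f m \<oplus>\<^bsub>R\<^esub> g m) \<rparr>"

text \<open>The image of an element of R in the power series ring, as a constant series.\<close>
definition const_series :: "('a, 'r) ring_scheme \<Rightarrow> 'a \<Rightarrow> ('v multiset \<Rightarrow> 'a)" where
  "const_series R a = (\<lambda>m. if m = {#} then a else \<zero>\<^bsub>R\<^esub>)"


section \<open>Rings\<close>

text \<open>The additive order of 1; \<^const>\<open>group.ord\<close> is 0 for elements of infinite order.\<close>
definition ring_characteristic :: "('a, 'r) ring_scheme \<Rightarrow> nat" where
  "ring_characteristic R = group.ord (add_monoid R) \<one>\<^bsub>R\<^esub>"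

definition pth_powers :: "nat \<Rightarrow> ('a, 'r) ring_scheme \<Rightarrow> 'a set" where
  "pth_powers p R = (\<lambda>x. x [^]\<^bsub>R\<^esub> p) ` carrier R"

definition krull_dim :: "('a, 'r) ring_scheme \<Rightarrow> enat" where
  "krull_dim R = Sup {enat n | n.
     \<exists>P. (\<forall>i\<le>n. primeideal (P i) R) \<and> (\<forall>i<n. P i \<subset> P (Suc i))}"

text \<open>For a local ring only.\<close>
definition residue_field :: "('a, 'r) ring_scheme \<Rightarrow> 'a set ring" where
  "residue_field A = A Quot (THE M. maximalideal M A)"


section \<open>Free direct summands of a module\<close>

definition free_of_rank :: "('a, 'r) ring_scheme \<Rightarrow> ('a, 'b, 'm) module_scheme \<Rightarrow> nat \<Rightarrow> bool" where
  "free_of_rank R M r \<longleftrightarrow>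
    (\<exists>b \<in> {..<r} \<rightarrow> carrier M. \<forall>x \<in> carrier M.
       \<exists>!c. c \<in> {..<r} \<rightarrow>\<^sub>E carrier R \<and> x = (\<Oplus>\<^bsub>M\<^esub>i\<in>{..<r}. c i \<odot>\<^bsub>M\<^esub> b i))"

definition direct_summand ::
    "('a, 'r) ring_scheme \<Rightarrow> ('a, 'b, 'm) module_scheme \<Rightarrow> 'b set \<Rightarrow> bool" where
  "direct_summand R M N \<longleftrightarrow> submodule N R M \<and>
    (\<exists>N'. submodule N' R M \<and> N <+>\<^bsub>M\<^esub> N' = carrier M \<and> N \<inter> N' = {\<zero>\<^bsub>M\<^esub>})"

text \<open>
  The maximum exists whenever R is a nonzero commutative ring and M is finitely generated.
\<close>
definition max_free_rank :: "('a, 'r) ring_scheme \<Rightarrow> ('a, 'b, 'm) module_scheme \<Rightarrow> nat" where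
  "max_free_rank R M =
    (GREATEST r. \<exists>N. direct_summand R M N \<and> free_of_rank R (M\<lparr>carrier := N\<rparr>) r)"


section \<open>F-signature\<close>

text \<open>
  The element of the pushforward corresponding to m in A is m itself; only the scalar action
  differs from that of A on itself.
\<close>
definition frobenius_pushforward ::
    "nat \<Rightarrow> nat \<Rightarrow> ('a, 'r) ring_scheme \<Rightarrow> ('a, 'a) module" where
  "frobenius_pushforward p e A =
    \<lparr> carrier = carrier A, monoid.mult = monoid.mult A, one = one A, ring.zero = ring.zero A, add = add A,
      smult = (\<lambda>a m. a [^]\<^bsub>A\<^esub> (p ^ e) \<otimes>\<^bsub>A\<^esub> m) \<rparr>"

definition frobenius_free_rank :: "nat \<Rightarrow> ('a, 'r) ring_scheme \<Rightarrow> nat \<Rightarrow> nat" where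
  "frobenius_free_rank p A e = max_free_rank A (frobenius_pushforward p e A)"

definition residue_log_degree :: "nat \<Rightarrow> ('a, 'r) ring_scheme \<Rightarrow> real" where
  "residue_log_degree p A =
    (let k = residue_field A in log p (real (ring.dim k (pth_powers p k) (carrier k))))"

text \<open>
  The following is meaningful for an F-finite Noetherian local ring A of prime characteristic p.
  For such A the Krull dimension and the degree of the residue field over its p-th powers are
  finite, and the limit exists by a theorem of Tucker.
\<close>
definition F_signature :: "nat \<Rightarrow> ('a, 'r) ring_scheme \<Rightarrow> real" where
  "F_signature p A =
    lim (\<lambda>e. real (frobenius_free_rank p A e) /
             real p powr (real e * (real (the_enat (krull_dim A)) + residue_log_degree p A)))"

end

theory Submission
  imports Defs "HOL-Library.Multiset_Order"
begin

text \<open>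
  Write A for S/f, so that the second ring B is A[[J]] for a finite set J of variables.  The two
  sequences whose limits are the F-signatures agree term by term, hence no limit has to be computed.

  Ranks: a free summand of rank r of the Frobenius pushforward M of A amounts to r elements and r
  functionals that are dual to each other.  With q the e-th power of p, the pushforward of A[[J]] is
  a direct sum of copies of M[[J]], indexed by the monomials with all exponents below q.  A dual
  system of A therefore yields one of A[[J]] that is q^|J| times as long.  Conversely, if the dual
  system of A is maximal, of length a, then modulo the maximal ideal the pairing of any functional
  with any element is determined by that system, and the identity matrix given by a dual system of A[[J]]
  factors over the residue field through dimension q^|J| a; so nothing longer is possible.

  Dimension: a quotient of a power series ring over K in N variables by a nonzero nonunit has
  dimension N - 1.  For the lower bound, set one variable x to 0, lift a chain by induction, and add
  below its smallest member Q a prime that contains f and avoids all products of powers of x with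
  elements outside Q.  For the upper bound, consider the K-dimension of the quotient by a prime and
  all series of order at least k, as a function of k.  By an Artin-Rees estimate its degree of growth
  drops at each step of a chain of primes, and for the zero ideal it is at most N.

  Both residue fields are isomorphic to K.
\<close>

section \<open>Multivariate power series rings\<close>

text \<open>The term-by-term equality is an accounting of exponents: adjoining |J| variables
  multiplies the rank at stage e by p^(e|J|), raises the dimension by |J| and keeps the residue
  field, so the normalising power of p absorbs exactly the new factor. The maximal free rank is a
  \<open>GREATEST\<close>, informative only when the possible ranks are bounded; finiteness of
  [K:K^p] enters here, through finitely many generators of K over its q-th powers. A functional on
  the pushforward is not assumed to respect infinite sums. What replaces continuity is that a series
  differs from its part with exponents below q by a finite combination of q-th powers of variables,
  and a functional sends such a combination to a combination of the variables themselves. B is used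
  in three presentations: as a quotient of S[[J]], as A[[J]] for the ranks, and as a hypersurface
  over K in the disjoint union of both sets of variables for the dimension. The upper bound on the
  dimension sets a binomial coefficient of degree n in j, forced by a chain of n + 1 primes, against
  the at most k^N monomials of size below k in N variables, with k linear in j.\<close>

lemma finite_subset_msets [simp]: "finite {d. d \<subseteq># (m :: 'v multiset)}"
proof (induction m)
  case (add x m)
  have "{d. d \<subseteq># add_mset x m} \<subseteq> {d. d \<subseteq># m} \<union> add_mset x ` {d. d \<subseteq># m}"
  proof
    fix d assume d: "d \<in> {d. d \<subseteq># add_mset x m}"
    show "d \<in> {d. d \<subseteq># m} \<union> add_mset x ` {d. d \<subseteq># m}"
    proof (cases "x \<in># d")
      case True
      then obtain d' where "d = add_mset x d'" by (metis insert_DiffM)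
      with d show ?thesis by auto
    next
      case False
      then have "d \<subseteq># m" using d by (simp add: subseteq_mset_def) (metis count_inI le_SucE le0)
      then show ?thesis by simp
    qed
  qed
  then show ?case by (rule finite_subset) (use add in auto)
qed simp

lemma (in abelian_monoid) finsum_reindex_bij:
  assumes "bij_betw h A B" "g \<in> B \<rightarrow> carrier G" "\<And>a. a \<in> A \<Longrightarrow> f a = g (h a)"
  shows "(\<Oplus>a\<in>A. f a) = (\<Oplus>b\<in>B. g b)"
proof -
  have "(\<Oplus>b\<in>B. g b) = (\<Oplus>a\<in>A. g (h a))"
    using assms finsum_reindex[of g h A] by (auto simp: bij_betw_def)
  also have "\<dots> = (\<Oplus>a\<in>A. f a)"
    using assms by (intro finsum_cong') (auto simp: bij_betw_def)
  finally show ?thesis by simp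
qed

lemma (in abelian_monoid) finsum_Sigma:
  assumes "finite A" "\<And>a. a \<in> A \<Longrightarrow> finite (B a)"
    "\<And>a b. a \<in> A \<Longrightarrow> b \<in> B a \<Longrightarrow> f a b \<in> carrier G"
  shows "(\<Oplus>a\<in>A. \<Oplus>b\<in>B a. f a b) = (\<Oplus>z\<in>Sigma A B. f (fst z) (snd z))"
  using assms
proof (induction A rule: finite_induct)
  case (insert x A)
  have eq: "Sigma (insert x A) B = Pair x ` B x \<union> Sigma A B" by auto
  have "(\<Oplus>z\<in>Sigma (insert x A) B. f (fst z) (snd z))
      = (\<Oplus>z\<in>Pair x ` B x. f (fst z) (snd z)) \<oplus> (\<Oplus>z\<in>Sigma A B. f (fst z) (snd z))"
    unfolding eq by (rule finsum_Un_disjoint) (use insert in auto)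
  also have "(\<Oplus>z\<in>Pair x ` B x. f (fst z) (snd z)) = (\<Oplus>b\<in>B x. f x b)"
    by (subst finsum_reindex) (use insert in \<open>auto simp: inj_on_def\<close>)
  also have "(\<Oplus>z\<in>Sigma A B. f (fst z) (snd z)) = (\<Oplus>a\<in>A. \<Oplus>b\<in>B a. f a b)"
    using insert by simp
  also have "(\<Oplus>b\<in>B x. f x b) \<oplus> (\<Oplus>a\<in>A. \<Oplus>b\<in>B a. f a b) = (\<Oplus>a\<in>insert x A. \<Oplus>b\<in>B a. f a b)"
    using insert by (subst finsum_insert) (auto intro!: finsum_closed)
  finally show ?case by simp
qed simp

lemma (in abelian_monoid) finsum_swap:
  assumes "finite A" "finite B" "\<And>a b. a \<in> A \<Longrightarrow> b \<in> B \<Longrightarrow> f a b \<in> carrier G"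
  shows "(\<Oplus>a\<in>A. \<Oplus>b\<in>B. f a b) = (\<Oplus>b\<in>B. \<Oplus>a\<in>A. f a b)"
  using assms
proof (induction A rule: finite_induct)
  case (insert x A)
  have "(\<Oplus>a\<in>insert x A. \<Oplus>b\<in>B. f a b) = (\<Oplus>b\<in>B. f x b) \<oplus> (\<Oplus>a\<in>A. \<Oplus>b\<in>B. f a b)"
    using insert by (subst finsum_insert) (auto intro!: finsum_closed)
  also have "\<dots> = (\<Oplus>b\<in>B. f x b) \<oplus> (\<Oplus>b\<in>B. \<Oplus>a\<in>A. f a b)"
    using insert by simp
  also have "\<dots> = (\<Oplus>b\<in>B. f x b \<oplus> (\<Oplus>a\<in>A. f a b))"
    using insert by (subst finsum_addf) (auto intro!: finsum_closed)
  also have "\<dots> = (\<Oplus>b\<in>B. \<Oplus>a\<in>insert x A. f a b)"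
  proof (rule finsum_cong')
    show "(\<lambda>b. \<Oplus>a\<in>insert x A. f a b) \<in> B \<rightarrow> carrier G"
      using insert by (auto simp: Pi_def intro!: finsum_closed)
    show "f x b \<oplus> (\<Oplus>a\<in>A. f a b) = (\<Oplus>a\<in>insert x A. f a b)" if "b \<in> B" for b
      using insert that by (subst finsum_insert) (auto simp: Pi_def)
  qed simp
  finally show ?case .
qed simp

lemma (in abelian_monoid) finsum_single:
  assumes "finite A" "i \<in> A" "f i \<in> carrier G" "\<And>j. j \<in> A \<Longrightarrow> j \<noteq> i \<Longrightarrow> f j = \<zero>"
  shows "(\<Oplus>j\<in>A. f j) = f i"
proof -
  have "(\<Oplus>j\<in>A. f j) = (\<Oplus>j\<in>{i}. f j)"
    using assms by (intro add.finprod_mono_neutral_cong_right) (auto, metis zero_closed)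
  then show ?thesis using assms by simp
qed

definition monom_series :: "('a, 'r) ring_scheme \<Rightarrow> 'a \<Rightarrow> 'v multiset \<Rightarrow> ('v multiset \<Rightarrow> 'a)" where
  "monom_series R a d = (\<lambda>m. if m = d then a else \<zero>\<^bsub>R\<^esub>)"

lemma const_series_eq_monom: "const_series R a = monom_series R a {#}"
  by (simp add: const_series_def monom_series_def)

lemma double_diff_mset: "d \<subseteq># m \<Longrightarrow> m - (m - d) = d"
  by (simp add: subset_mset.le_imp_diff_is_add multiset_eq_iff subseteq_mset_def)

locale power_series = cring R for R (structure) + fixes I :: "'v set"
begin

abbreviation PS where "PS \<equiv> power_series_ring R I"

lemma ps_carrierI:
  "\<lbrakk>\<And>m. f m \<in> carrier R; \<And>m. \<not> set_mset m \<subseteq> I \<Longrightarrow> f m = \<zero>\<rbrakk> \<Longrightarrow> f \<in> carrier PS"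
  by (simp add: power_series_ring_def)

lemma ps_coeff_closed [simp, intro]: "f \<in> carrier PS \<Longrightarrow> f m \<in> carrier R"
  by (simp add: power_series_ring_def)

lemma ps_coeff_outside: "f \<in> carrier PS \<Longrightarrow> \<not> set_mset m \<subseteq> I \<Longrightarrow> f m = \<zero>"
  unfolding power_series_ring_def partial_object.simps by blast

lemma ps_support: "\<lbrakk>f \<in> carrier PS; f m \<noteq> \<zero>; x \<in># m\<rbrakk> \<Longrightarrow> x \<in> I"
  using ps_coeff_outside by blast

lemma ps_add: "(f \<oplus>\<^bsub>PS\<^esub> g) m = f m \<oplus> g m"
  by (simp only: power_series_ring_def ring_record_simps)

lemma ps_zero: "\<zero>\<^bsub>PS\<^esub> m = \<zero>"
  by (simp only: power_series_ring_def ring_record_simps)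

lemma ps_one: "\<one>\<^bsub>PS\<^esub> = monom_series R \<one> {#}"
  by (simp only: power_series_ring_def ring_record_simps monom_series_def)

lemma ps_mult: "(f \<otimes>\<^bsub>PS\<^esub> g) m = (\<Oplus>d\<in>{d. d \<subseteq># m}. f d \<otimes> g (m - d))"
  by (simp only: power_series_ring_def ring_record_simps)

lemma finite_splittings: "finite {(a, b). a + b = (m :: 'v multiset)}"
proof -
  have "{(a, b). a + b = m} \<subseteq> {d. d \<subseteq># m} \<times> {d. d \<subseteq># m}" by auto
  then show ?thesis by (rule finite_subset) simp
qed

lemma finite_splittings': "finite {p. fst p + snd p = (m :: 'v multiset)}"
  using finite_splittings[of m] by (simp add: case_prod_unfold)

text \<open>Summing over ordered pairs instead of divisors treats both factors alike, so that
  associativity becomes a bijection between pairs of pairs.\<close>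

lemma ps_mult_splittings:
  assumes "f \<in> carrier PS" "g \<in> carrier PS"
  shows "(f \<otimes>\<^bsub>PS\<^esub> g) m = (\<Oplus>z\<in>{(a, b). a + b = m}. f (fst z) \<otimes> g (snd z))"
  unfolding ps_mult
  by (rule finsum_reindex_bij[where h = "\<lambda>d. (d, m - d)"])
    (use assms in \<open>auto simp: bij_betw_def inj_on_def image_iff\<close>)

lemma ps_mult_closed:
  assumes "f \<in> carrier PS" "g \<in> carrier PS"
  shows "f \<otimes>\<^bsub>PS\<^esub> g \<in> carrier PS"
proof (rule ps_carrierI)
  show "(f \<otimes>\<^bsub>PS\<^esub> g) m \<in> carrier R" for m
    unfolding ps_mult using assms by (auto intro!: finsum_closed)
  fix m assume m: "\<not> set_mset m \<subseteq> I"
  have "f d \<otimes> g (m - d) = \<zero>" if "d \<subseteq># m" for d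
  proof -
    have "set_mset m = set_mset d \<union> set_mset (m - d)"
      using that by (metis set_mset_union subset_mset.add_diff_inverse)
    then consider "\<not> set_mset d \<subseteq> I" | "\<not> set_mset (m - d) \<subseteq> I" using m by auto
    then have "f d = \<zero> \<or> g (m - d) = \<zero>"
      using ps_coeff_outside[OF assms(1)] ps_coeff_outside[OF assms(2)] by cases blast+
    then show ?thesis using ps_coeff_closed[OF assms(1)] ps_coeff_closed[OF assms(2)] by auto
  qed
  then show "(f \<otimes>\<^bsub>PS\<^esub> g) m = \<zero>" unfolding ps_mult
    by (intro add.finprod_one_eqI) auto
qed

lemma ps_mult_comm:
  assumes "f \<in> carrier PS" "g \<in> carrier PS"
  shows "f \<otimes>\<^bsub>PS\<^esub> g = g \<otimes>\<^bsub>PS\<^esub> f"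
proof
  fix m
  show "(f \<otimes>\<^bsub>PS\<^esub> g) m = (g \<otimes>\<^bsub>PS\<^esub> f) m"
    unfolding ps_mult
    by (rule finsum_reindex_bij[where h = "\<lambda>d. m - d"])
      (use assms in \<open>auto simp: m_comm double_diff_mset intro!: bij_betw_byWitness[where f' = "\<lambda>d. m - d"]\<close>)
qed

lemma ps_mult_assoc:
  assumes "f \<in> carrier PS" "g \<in> carrier PS" "h \<in> carrier PS"
  shows "(f \<otimes>\<^bsub>PS\<^esub> g) \<otimes>\<^bsub>PS\<^esub> h = f \<otimes>\<^bsub>PS\<^esub> (g \<otimes>\<^bsub>PS\<^esub> h)"
proof
  fix m
  let ?S = "\<lambda>m::'v multiset. {(a, b). a + b = m}"
  note cl = assms ps_coeff_closed[OF assms(1)] ps_coeff_closed[OF assms(2)] ps_coeff_closed[OF assms(3)]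
  have "((f \<otimes>\<^bsub>PS\<^esub> g) \<otimes>\<^bsub>PS\<^esub> h) m = (\<Oplus>ab\<in>?S m. (\<Oplus>cd\<in>?S (fst ab). (f (fst cd) \<otimes> g (snd cd)) \<otimes> h (snd ab)))"
    unfolding ps_mult_splittings[OF ps_mult_closed[OF assms(1,2)] assms(3)]
    by (rule finsum_cong')
      (use cl in \<open>auto simp: ps_mult_splittings finite_splittings' case_prod_unfold
        intro!: finsum_ldistr finsum_closed\<close>)
  also have "\<dots> = (\<Oplus>z\<in>Sigma (?S m) (\<lambda>ab. ?S (fst ab)). f (fst (snd z)) \<otimes> g (snd (snd z)) \<otimes> h (snd (fst z)))"
    by (rule finsum_Sigma) (use cl in \<open>auto simp: finite_splittings\<close>)
  \<comment> \<open>Both sums run over triples with c + d + b = m; the bijection only moves the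
    bracket from (c + d) + b to c + (d + b).\<close>
  also have "\<dots> = (\<Oplus>z\<in>Sigma (?S m) (\<lambda>ab. ?S (snd ab)). f (fst (fst z)) \<otimes> (g (fst (snd z)) \<otimes> h (snd (snd z))))"
    by (rule finsum_reindex_bij[where h = "\<lambda>((a, b), (c, d)). ((c, d + b), (d, b))"])
      (use cl in \<open>auto simp: m_assoc add.assoc
        intro!: bij_betw_byWitness[where f' = "\<lambda>((a, b), (c, d)). ((a + c, d), (a, c))"]\<close>)
  also have "\<dots> = (\<Oplus>ab\<in>?S m. (\<Oplus>cd\<in>?S (snd ab). f (fst ab) \<otimes> (g (fst cd) \<otimes> h (snd cd))))"
    by (rule finsum_Sigma[symmetric]) (use cl in \<open>auto simp: finite_splittings\<close>)
  also have "\<dots> = (f \<otimes>\<^bsub>PS\<^esub> (g \<otimes>\<^bsub>PS\<^esub> h)) m"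
    unfolding ps_mult_splittings[OF assms(1) ps_mult_closed[OF assms(2,3)]]
    by (rule finsum_cong')
      (use cl in \<open>auto simp: ps_mult_splittings finite_splittings' case_prod_unfold
        intro!: finsum_rdistr[symmetric] finsum_closed\<close>)
  finally show "((f \<otimes>\<^bsub>PS\<^esub> g) \<otimes>\<^bsub>PS\<^esub> h) m = (f \<otimes>\<^bsub>PS\<^esub> (g \<otimes>\<^bsub>PS\<^esub> h)) m" .
qed

lemma monom_closed [simp, intro]:
  "a \<in> carrier R \<Longrightarrow> set_mset d \<subseteq> I \<Longrightarrow> monom_series R a d \<in> carrier PS"
  by (intro ps_carrierI) (auto simp: monom_series_def split: if_splits)

lemma monom_mult_coeff:
  assumes "a \<in> carrier R" "f \<in> carrier PS"
  shows "(monom_series R a d \<otimes>\<^bsub>PS\<^esub> f) m = (if d \<subseteq># m then a \<otimes> f (m - d) else \<zero>)"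
proof (cases "d \<subseteq># m")
  case True
  have "(monom_series R a d \<otimes>\<^bsub>PS\<^esub> f) m = monom_series R a d d \<otimes> f (m - d)"
    unfolding ps_mult by (rule finsum_single) (use True assms in \<open>auto simp: monom_series_def\<close>)
  then show ?thesis using True by (simp add: monom_series_def)
next
  case False
  then show ?thesis unfolding ps_mult
    by (auto intro!: add.finprod_one_eqI simp: monom_series_def assms)
qed

lemma ps_cring: "cring PS"
proof (rule cringI)
  show "abelian_group PS"
  proof (rule abelian_groupI)
    fix x assume x: "x \<in> carrier PS"
    show "\<exists>y\<in>carrier PS. y \<oplus>\<^bsub>PS\<^esub> x = \<zero>\<^bsub>PS\<^esub>"
      by (rule bexI[where x = "\<lambda>m. \<ominus> x m"])
        (use x ps_support[OF x] in \<open>auto intro!: ps_carrierI ext simp: ps_add ps_zero l_neg\<close>)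
  next
    fix x y assume "x \<in> carrier PS" "y \<in> carrier PS"
    then show "x \<oplus>\<^bsub>PS\<^esub> y \<in> carrier PS"
      by (intro ps_carrierI) (simp_all add: ps_add ps_coeff_outside ps_coeff_closed del: subset_iff)
  next
    fix x y z assume c: "x \<in> carrier PS" "y \<in> carrier PS" "z \<in> carrier PS"
    then show "x \<oplus>\<^bsub>PS\<^esub> y \<oplus>\<^bsub>PS\<^esub> z = x \<oplus>\<^bsub>PS\<^esub> (y \<oplus>\<^bsub>PS\<^esub> z)"
      by (intro ext) (simp add: ps_add a_assoc)
  qed (auto intro!: ps_carrierI ext simp: ps_add ps_zero a_comm)
  show "comm_monoid PS"
  proof
    fix x assume x: "x \<in> carrier PS"
    show 1: "\<one>\<^bsub>PS\<^esub> \<otimes>\<^bsub>PS\<^esub> x = x"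
      using x by (auto simp: ps_one monom_mult_coeff)
    show "x \<otimes>\<^bsub>PS\<^esub> \<one>\<^bsub>PS\<^esub> = x"
      using x 1 ps_mult_comm[of x "\<one>\<^bsub>PS\<^esub>"] by (simp add: ps_one)
  qed (use ps_mult_assoc ps_mult_comm ps_mult_closed ps_one in auto)
  fix x y z assume cl: "x \<in> carrier PS" "y \<in> carrier PS" "z \<in> carrier PS"
  note cl' = ps_coeff_closed[OF cl(1)] ps_coeff_closed[OF cl(2)] ps_coeff_closed[OF cl(3)]
  show "(x \<oplus>\<^bsub>PS\<^esub> y) \<otimes>\<^bsub>PS\<^esub> z = x \<otimes>\<^bsub>PS\<^esub> z \<oplus>\<^bsub>PS\<^esub> y \<otimes>\<^bsub>PS\<^esub> z"
    by (rule ext) (use cl' in \<open>auto simp: ps_add ps_mult l_distr finsum_addf\<close>)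
qed

sublocale PS: cring PS by (rule ps_cring)

lemma ps_minus: "f \<in> carrier PS \<Longrightarrow> (\<ominus>\<^bsub>PS\<^esub> f) m = \<ominus> f m"
  using PS.l_neg[of f] ps_add[of "\<ominus>\<^bsub>PS\<^esub> f" f m] ps_zero[of m]
  by (intro minus_equality[symmetric]) auto

lemma ps_diff: "f \<in> carrier PS \<Longrightarrow> g \<in> carrier PS \<Longrightarrow> (f \<ominus>\<^bsub>PS\<^esub> g) m = f m \<ominus> g m"
  by (simp add: a_minus_def ps_add ps_minus)

lemma ps_finsum:
  assumes "F \<in> A \<rightarrow> carrier PS"
  shows "(\<Oplus>\<^bsub>PS\<^esub>i\<in>A. F i) m = (\<Oplus>i\<in>A. F i m)"
  using assms
proof (induction A rule: infinite_finite_induct)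
  case (insert x A)
  then show ?case by (subst PS.finsum_insert; (subst finsum_insert)?) (auto simp: ps_add Pi_def)
qed (simp_all add: ps_zero)

lemma monom_mult:
  assumes "a \<in> carrier R" "b \<in> carrier R" "set_mset e \<subseteq> I"
  shows "monom_series R a d \<otimes>\<^bsub>PS\<^esub> monom_series R b e = monom_series R (a \<otimes> b) (d + e)"
proof
  fix m
  show "(monom_series R a d \<otimes>\<^bsub>PS\<^esub> monom_series R b e) m = monom_series R (a \<otimes> b) (d + e) m"
    using assms monom_closed[OF assms(2,3)]
    by (subst monom_mult_coeff) (auto simp: monom_series_def subset_mset.le_imp_diff_is_add add.commute)
qed

lemma coeff0_hom: "(\<lambda>f. f {#}) \<in> ring_hom PS R"
  by (rule ring_hom_memI) (auto simp: ps_mult ps_add ps_one monom_series_def)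

end

section \<open>Recursion on monomials and units of power series rings\<close>

lemma size_diff_less:
  assumes "d \<subseteq># m" "d \<noteq> {#}"
  shows "size (m - d) < size m"
proof -
  have "size m = size d + size (m - d)"
    using assms(1) by (metis size_union subset_mset.add_diff_inverse)
  moreover have "size d > 0" using assms(2) by (simp add: nonempty_has_size)
  ultimately show ?thesis by simp
qed

text \<open>Source of all coefficient recursions: inverses are built along the size in
  \<open>ps_unitI\<close>, quotients along the monomial order in
  \<open>division_by_standard_basis\<close>.\<close>

lemma wf_fixpoint_exists:
  assumes "wf r" "\<And>c c' m. (\<And>m'. (m', m) \<in> r \<Longrightarrow> c m' = c' m') \<Longrightarrow> F c m = F c' m"
  shows "\<exists>c. \<forall>m. c m = F c m"
proof -
  have "adm_wf r F" unfolding adm_wf_def using assms(2) by blast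
  with assms(1) have "wfrec r F = F (wfrec r F)" by (rule wfrec_fixpoint)
  then have "\<forall>m. wfrec r F m = F (wfrec r F) m" by (rule fun_cong[THEN allI])
  then show ?thesis by (rule exI[of _ "wfrec r F"])
qed

lemma (in comm_monoid) Units_of_comm_mult:
  "x \<in> carrier G \<Longrightarrow> y \<in> carrier G \<Longrightarrow> x \<otimes> y = \<one> \<Longrightarrow> x \<in> Units G"
  using m_comm[of x y] by (auto simp: Units_def)

context power_series
begin

text \<open>In the coefficient of f g = 1 at m the term \<open>f {#} \<otimes> g m\<close> is the
  only one that contains g at m; all others use g at monomials of smaller size. Invertibility of the
  constant term therefore determines g recursively.\<close>

lemma ps_unitI:
  assumes f: "f \<in> carrier PS" and u: "f {#} \<in> Units R"
  shows "f \<in> Units PS"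
proof -
  define F where "F g m = (if set_mset m \<subseteq> I then inv (f {#}) \<otimes> (\<one>\<^bsub>PS\<^esub> m \<ominus> (\<Oplus>d\<in>{d. d \<subseteq># m} - {{#}}. f d \<otimes> g (m - d))) else \<zero>)"
    for g and m :: "'v multiset"
  \<comment> \<open>The guard sends the recursion to zero once an earlier value has left the
    carrier. Congruence of finite sums is available only for summands in the carrier, and membership
    can be proved only after g exists; \<open>gc\<close> then shows that the guard always
    holds.\<close>
  have "\<exists>g. \<forall>m :: 'v multiset. g m = (if \<forall>m'. size m' < size m \<longrightarrow> g m' \<in> carrier R then F g m else \<zero>)"
  proof (rule wf_fixpoint_exists[OF wf_measure[of size]])
    fix g g' :: "'v multiset \<Rightarrow> 'a" and m :: "'v multiset" assume eq: "\<And>m'. (m', m) \<in> measure size \<Longrightarrow> g m' = g' m'"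
    have "size (m - d) < size m" if "d \<subseteq># m" "d \<noteq> {#}" for d
      using that by (rule size_diff_less)
    then have "(\<Oplus>d\<in>{d. d \<subseteq># m} - {{#}}. f d \<otimes> g (m - d)) = (\<Oplus>d\<in>{d. d \<subseteq># m} - {{#}}. f d \<otimes> g' (m - d))"
      if "\<forall>m'. size m' < size m \<longrightarrow> g m' \<in> carrier R"
      using that eq f by (intro finsum_cong') auto
    then show "(if \<forall>m'. size m' < size m \<longrightarrow> g m' \<in> carrier R then F g m else \<zero>) =
        (if \<forall>m'. size m' < size m \<longrightarrow> g' m' \<in> carrier R then F g' m else \<zero>)"
      using eq by (auto simp: F_def)
  qed
  then obtain g where g: "\<And>m. g m = (if \<forall>m'. size m' < size m \<longrightarrow> g m' \<in> carrier R then F g m else \<zero>)"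
    by blast
  have gc: "g m \<in> carrier R" for m
  proof (induction m rule: measure_induct_rule[where f = size])
    case (less m)
    have "(\<Oplus>d\<in>{d. d \<subseteq># m} - {{#}}. f d \<otimes> g (m - d)) \<in> carrier R"
    proof (rule finsum_closed, rule Pi_I)
      fix d assume "d \<in> {d. d \<subseteq># m} - {{#}}"
      then have "size (m - d) < size m"
        by (auto intro: size_diff_less)
      then show "f d \<otimes> g (m - d) \<in> carrier R" using less f by auto
    qed
    then have "F g m \<in> carrier R" using u by (auto simp: F_def ps_one monom_series_def)
    then show ?case using g[of m] by (metis zero_closed)
  qed
  have gF: "g m = F g m" for m using g[of m] gc by simp
  have gPS: "g \<in> carrier PS" by (rule ps_carrierI) (use gc gF in \<open>auto simp: F_def\<close>)
  have "f \<otimes>\<^bsub>PS\<^esub> g = \<one>\<^bsub>PS\<^esub>"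
  proof
    fix m
    show "(f \<otimes>\<^bsub>PS\<^esub> g) m = \<one>\<^bsub>PS\<^esub> m"
    proof (cases "set_mset m \<subseteq> I")
      case True
      let ?s = "\<Oplus>d\<in>{d. d \<subseteq># m} - {{#}}. f d \<otimes> g (m - d)"
      have s: "?s \<in> carrier R" by (rule finsum_closed) (use gc f in auto)
      have o: "\<one>\<^bsub>PS\<^esub> m \<in> carrier R" by (auto simp: ps_one monom_series_def)
      have "(f \<otimes>\<^bsub>PS\<^esub> g) m = f {#} \<otimes> g (m - {#}) \<oplus> ?s"
        unfolding ps_mult
        by (subst finsum_insert[symmetric]) (use gc f in \<open>auto simp: insert_absorb\<close>)
      also have "f {#} \<otimes> g (m - {#}) = \<one>\<^bsub>PS\<^esub> m \<ominus> ?s"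
        using True u s o by (simp add: gF[of m] F_def m_assoc[symmetric] Units_closed)
      finally show ?thesis using s o by (simp add: a_minus_def a_assoc l_neg)
    next
      case False
      then show ?thesis
        using ps_coeff_outside[OF ps_mult_closed[OF f gPS]] ps_coeff_outside[OF PS.one_closed] by simp
    qed
  qed
  then show ?thesis using f gPS by (intro PS.Units_of_comm_mult)
qed

lemma ps_unit_iff: "f \<in> carrier PS \<Longrightarrow> f \<in> Units PS \<longleftrightarrow> f {#} \<in> Units R"
proof
  assume "f \<in> Units PS"
  then obtain g where g: "g \<in> carrier PS" "f \<otimes>\<^bsub>PS\<^esub> g = \<one>\<^bsub>PS\<^esub>" "f \<in> carrier PS"
    by (auto simp: Units_def)
  have "f {#} \<otimes> g {#} = \<one>"
    using ring_hom_mult[OF coeff0_hom g(3,1)] g(2) ring_hom_one[OF coeff0_hom] by simp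
  then show "f {#} \<in> Units R" using g by (intro Units_of_comm_mult) auto
qed (rule ps_unitI)

end

section \<open>The Frobenius map in characteristic p\<close>

lemma (in cring) binomial_expansion:
  fixes n :: nat
  assumes "a \<in> carrier R" "b \<in> carrier R"
  shows "(a \<oplus> b) [^] n = (\<Oplus>k\<in>{..n}. add_pow R (n choose k) (a [^] k \<otimes> b [^] (n - k)))"
proof (induction n)
  case 0
  then show ?case using assms by simp
next
  case (Suc n)
  have cl: "(\<lambda>k. add_pow R (n choose k) (a [^] k \<otimes> b [^] (n - k))) \<in> {..n} \<rightarrow> carrier R"
    using assms by auto
  let ?f = "\<lambda>k. add_pow R (n choose k) (a [^] k \<otimes> b [^] (Suc n - k))"
  let ?g = "\<lambda>k. add_pow R (n choose k) (a [^] Suc k \<otimes> b [^] (n - k))"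
  have A: "(\<Oplus>k\<in>{..n}. add_pow R (n choose k) (a [^] k \<otimes> b [^] (n - k))) \<otimes> a = (\<Oplus>k\<in>{..n}. ?g k)"
    unfolding finsum_ldistr[OF finite_atMost assms(1) cl]
    by (rule finsum_cong') (use assms in \<open>auto simp: add_pow_ldistr add_pow_rdistr m_ac\<close>)
  have "(\<Oplus>k\<in>{..n}. add_pow R (n choose k) (a [^] k \<otimes> b [^] (n - k))) \<otimes> b = (\<Oplus>k\<in>{..n}. ?f k)"
    unfolding finsum_ldistr[OF finite_atMost assms(2) cl]
  proof (rule finsum_cong')
    fix k assume "k \<in> {..n}"
    then have "Suc n - k = Suc (n - k)" by auto
    then show "add_pow R (n choose k) (a [^] k \<otimes> b [^] (n - k)) \<otimes> b = ?f k"
      using assms by (simp add: add_pow_ldistr add_pow_rdistr m_ac)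
  qed (use assms in auto)
  also have "\<dots> = (\<Oplus>k\<in>{..Suc n}. ?f k)"
    using assms by (subst finsum_Suc) (auto intro!: finsum_closed simp: binomial_eq_0)
  also have "\<dots> = (\<Oplus>k\<in>{..n}. ?f (Suc k)) \<oplus> ?f 0"
    by (rule finsum_Suc2) (use assms in auto)
  finally have B: "(\<Oplus>k\<in>{..n}. add_pow R (n choose k) (a [^] k \<otimes> b [^] (n - k))) \<otimes> b
    = (\<Oplus>k\<in>{..n}. ?f (Suc k)) \<oplus> ?f 0" .
  have "(\<Oplus>k\<in>{..Suc n}. add_pow R (Suc n choose k) (a [^] k \<otimes> b [^] (Suc n - k)))
     = (\<Oplus>k\<in>{..n}. add_pow R (Suc n choose Suc k) (a [^] Suc k \<otimes> b [^] (Suc n - Suc k))) \<oplus> ?f 0"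
    using finsum_Suc2[of "\<lambda>k. add_pow R (Suc n choose k) (a [^] k \<otimes> b [^] (Suc n - k))" n] assms by auto
  also have "(\<Oplus>k\<in>{..n}. add_pow R (Suc n choose Suc k) (a [^] Suc k \<otimes> b [^] (Suc n - Suc k)))
     = (\<Oplus>k\<in>{..n}. ?g k \<oplus> ?f (Suc k))"
    by (rule finsum_cong') (use assms in \<open>auto simp: add.nat_pow_mult[symmetric]\<close>)
  also have "\<dots> = (\<Oplus>k\<in>{..n}. ?g k) \<oplus> (\<Oplus>k\<in>{..n}. ?f (Suc k))"
    by (rule finsum_addf) (use assms in auto)
  finally have C: "(\<Oplus>k\<in>{..Suc n}. add_pow R (Suc n choose k) (a [^] k \<otimes> b [^] (Suc n - k)))
     = (\<Oplus>k\<in>{..n}. ?g k) \<oplus> (\<Oplus>k\<in>{..n}. ?f (Suc k)) \<oplus> ?f 0" .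
  have c: "(\<Oplus>k\<in>{..n}. ?g k) \<in> carrier R" "(\<Oplus>k\<in>{..n}. ?f (Suc k)) \<in> carrier R" "?f 0 \<in> carrier R"
    using assms by (auto intro!: finsum_closed)
  have "(a \<oplus> b) [^] Suc n = (\<Oplus>k\<in>{..n}. add_pow R (n choose k) (a [^] k \<otimes> b [^] (n - k))) \<otimes> (a \<oplus> b)"
    using Suc by simp
  also have "\<dots> = (\<Oplus>k\<in>{..n}. ?g k) \<oplus> ((\<Oplus>k\<in>{..n}. ?f (Suc k)) \<oplus> ?f 0)"
    using A B assms cl by (subst r_distr) (auto intro!: finsum_closed)
  finally show ?case using C c by (simp only: a_assoc)
qed

locale cring_char_p = cring R for R (structure) +
  fixes p :: nat
  assumes prime_p: "Factorial_Ring.prime p" and char_p: "add_pow R p \<one> = \<zero>"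
begin

lemma p_pos [simp]: "p > 0"
  using prime_p by (rule prime_gt_0_nat)

lemma p_nonzero [simp]: "p \<noteq> 0"
  using p_pos by linarith

lemma p_power_ge_1 [simp]: "Suc 0 \<le> p ^ e"
  by (simp add: Suc_le_eq)

lemma char_p_mult: "a \<in> carrier R \<Longrightarrow> add_pow R p a = \<zero>"
  using add_pow_ldistr[of \<one> a p] char_p by simp

lemma char_p_dvd: "a \<in> carrier R \<Longrightarrow> p dvd n \<Longrightarrow> add_pow R n a = \<zero>"
  by (elim dvdE) (simp add: char_p_mult flip: add.nat_pow_pow)

lemma frobenius_add_p:
  assumes "a \<in> carrier R" "b \<in> carrier R"
  shows "(a \<oplus> b) [^] p = a [^] p \<oplus> b [^] p"
proof -
  let ?f = "\<lambda>k. add_pow R (p choose k) (a [^] k \<otimes> b [^] (p - k))"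
  have z: "?f k = \<zero>" if "k \<in> {..p} - {0, p}" for k
    using that prime_p assms by (intro char_p_dvd dvd_choose_prime) auto
  have "(a \<oplus> b) [^] p = (\<Oplus>k\<in>{0, p}. ?f k)"
    unfolding binomial_expansion[OF assms]
    by (rule add.finprod_mono_neutral_cong_right) (use assms z in auto)
  also have "\<dots> = b [^] p \<oplus> a [^] p"
    using assms prime_p by (subst finsum_insert) auto
  finally show ?thesis using assms by (simp add: a_comm)
qed

lemma frobenius_add:
  assumes "a \<in> carrier R" "b \<in> carrier R"
  shows "(a \<oplus> b) [^] (p ^ e) = a [^] (p ^ e) \<oplus> b [^] (p ^ e)"
  by (induction e) (use assms in \<open>simp_all add: frobenius_add_p mult.commute[of p] flip: nat_pow_pow\<close>)

lemma frobenius_zero [simp]: "\<zero> [^] (p ^ e) = \<zero>"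
  by (simp add: nat_pow_zero)

lemma frobenius_finsum:
  assumes "f \<in> A \<rightarrow> carrier R"
  shows "(\<Oplus>i\<in>A. f i) [^] (p ^ e) = (\<Oplus>i\<in>A. f i [^] (p ^ e))"
  using assms
proof (induction A rule: infinite_finite_induct)
  case (insert x A)
  then show ?case
    by (subst (1 2) finsum_insert) (auto simp: Pi_def frobenius_add)
qed simp_all

end

context power_series
begin

lemma monom_coeff_closed [simp, intro]: "a \<in> carrier R \<Longrightarrow> monom_series R a d m \<in> carrier R"
  by (simp add: monom_series_def)

lemma monom_pow:
  assumes "a \<in> carrier R" "set_mset d \<subseteq> I"
  shows "monom_series R a d [^]\<^bsub>PS\<^esub> (n::nat) = monom_series R (a [^] n) (repeat_mset n d)"
proof (induction n)
  case (Suc n)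
  then show ?case using assms by (simp add: monom_mult add.commute)
qed (simp add: ps_one)

lemma ps_decompose:
  assumes "f \<in> carrier PS" "finite D" "D \<subseteq> {d. set_mset d \<subseteq> I}"
  shows "(\<Oplus>\<^bsub>PS\<^esub>d\<in>D. monom_series R (f d) d) m = (if m \<in> D then f m else \<zero>)"
proof -
  have "(\<Oplus>\<^bsub>PS\<^esub>d\<in>D. monom_series R (f d) d) m = (\<Oplus>d\<in>D. monom_series R (f d) d m)"
    by (rule ps_finsum) (use assms in auto)
  also have "\<dots> = (if m \<in> D then f m else \<zero>)"
  proof (cases "m \<in> D")
    case True
    then have "(\<Oplus>d\<in>D. monom_series R (f d) d m) = monom_series R (f m) m m"
      by (intro finsum_single) (use assms in \<open>auto simp: monom_series_def\<close>)
    then show ?thesis using True by (simp add: monom_series_def)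
  next
    case False
    then show ?thesis by (auto intro!: add.finprod_one_eqI simp: monom_series_def)
  qed
  finally show ?thesis .
qed

end

locale power_series_char_p = power_series R I + cring_char_p R p
  for R (structure) and I :: "'v set" and p
begin

sublocale PS: cring_char_p PS p
proof
  have "(add_pow PS (n) \<one>\<^bsub>PS\<^esub>) m = add_pow R n (\<one>\<^bsub>PS\<^esub> m)" for n :: nat and m
    by (induction n) (simp_all add: ps_zero ps_add)
  then show "add_pow PS (p) \<one>\<^bsub>PS\<^esub> = \<zero>\<^bsub>PS\<^esub>"
    by (intro ext) (simp add: ps_zero char_p_mult)
qed (rule prime_p)

text \<open>The q-th power is additive for finite sums only. For fixed m the series is therefore
  split into the finite part g of its terms dividing m and a rest r. As r vanishes at every divisor
  of m, so does its product with any series at m, in particular \<open>r [^] q\<close>; and g is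
  raised to the power q termwise.\<close>

lemma ps_frobenius_coeff:
  assumes f: "f \<in> carrier PS"
  shows "(f [^]\<^bsub>PS\<^esub> (p ^ e)) m = (if \<exists>d. m = repeat_mset (p ^ e) d then f (THE d. m = repeat_mset (p ^ e) d) [^] (p ^ e) else \<zero>)"
proof -
  let ?q = "p ^ e"
  have q: "?q > 0" by simp
  have le: "d \<subseteq># repeat_mset ?q d" for d :: "'v multiset"
    using q by (auto simp: subseteq_mset_def)
  define D where "D = {d. d \<subseteq># m \<and> set_mset d \<subseteq> I}"
  have D: "finite D" "D \<subseteq> {d. set_mset d \<subseteq> I}"
    by (auto simp: D_def intro: finite_subset[OF _ finite_subset_msets[of m]])
  define g where "g = (\<Oplus>\<^bsub>PS\<^esub>d\<in>D. monom_series R (f d) d)"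
  have g: "g \<in> carrier PS" using f D by (auto simp: g_def intro!: PS.finsum_closed)
  define r where "r = f \<ominus>\<^bsub>PS\<^esub> g"
  have r: "r \<in> carrier PS" using f g by (simp add: r_def)
  have r0: "r d = \<zero>" if "d \<subseteq># m" for d
  proof -
    have "g d = f d"
      using that ps_decompose[OF f D, of d] ps_coeff_outside[OF f, of d] by (auto simp: g_def D_def)
    moreover have "r d = f d \<ominus> g d" unfolding r_def using f g by (rule ps_diff)
    ultimately show ?thesis using f by (simp add: minus_eq r_neg)
  qed
  obtain k where k: "?q = Suc k" using q by (cases ?q) auto
  have rq0: "(r [^]\<^bsub>PS\<^esub> ?q) m = \<zero>"
    unfolding k PS.nat_pow_Suc2[OF r] ps_mult
    by (rule add.finprod_one_eqI) (use r0 r ps_coeff_closed[OF PS.nat_pow_closed[OF r]] in auto)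
  have "f = g \<oplus>\<^bsub>PS\<^esub> r"
    using f g by (simp add: r_def PS.minus_eq PS.a_lcomm PS.r_neg)
  then have "(f [^]\<^bsub>PS\<^esub> ?q) m = (g [^]\<^bsub>PS\<^esub> ?q) m"
    using PS.frobenius_add[OF g r, of e] rq0 g by (simp add: ps_add)
  also have "g [^]\<^bsub>PS\<^esub> ?q = (\<Oplus>\<^bsub>PS\<^esub>d\<in>D. monom_series R (f d) d [^]\<^bsub>PS\<^esub> ?q)"
    unfolding g_def by (rule PS.frobenius_finsum) (use f D in auto)
  also have "\<dots> m = (\<Oplus>d\<in>D. (monom_series R (f d) d [^]\<^bsub>PS\<^esub> ?q) m)"
    by (rule ps_finsum) (use f D in auto)
  also have "\<dots> = (\<Oplus>d\<in>D. monom_series R (f d [^] ?q) (repeat_mset ?q d) m)"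
    by (rule finsum_cong') (use f D in \<open>auto simp: monom_pow\<close>)
  finally have *: "(f [^]\<^bsub>PS\<^esub> ?q) m = (\<Oplus>d\<in>D. monom_series R (f d [^] ?q) (repeat_mset ?q d) m)" .
  show ?thesis
  proof (cases "\<exists>d. m = repeat_mset ?q d")
    case True
    then obtain d where d: "m = repeat_mset ?q d" by blast
    have the: "(THE d. m = repeat_mset ?q d) = d"
      by (rule the_equality) (use d q in \<open>auto simp: repeat_mset_cancel1\<close>)
    show ?thesis
    proof (cases "set_mset d \<subseteq> I")
      case True
      then have "d \<in> D" using le[of d] by (simp add: D_def d)
      then have "(\<Oplus>d\<in>D. monom_series R (f d [^] ?q) (repeat_mset ?q d) m) = monom_series R (f d [^] ?q) (repeat_mset ?q d) m"
        by (intro finsum_single) (use f D q d in \<open>auto simp: monom_series_def repeat_mset_cancel1\<close>)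
      then show ?thesis using * d the by (auto simp: monom_series_def)
    next
      case False
      then have "(\<Oplus>d\<in>D. monom_series R (f d [^] ?q) (repeat_mset ?q d) m) = \<zero>"
        using q by (intro add.finprod_one_eqI) (auto simp: monom_series_def D_def d repeat_mset_cancel1)
      then show ?thesis using * d the ps_coeff_outside[OF f False] by auto
    qed
  next
    case False
    then show ?thesis using * by (auto intro!: add.finprod_one_eqI simp: monom_series_def)
  qed
qed

lemma ps_frobenius_mult_coeff:
  assumes f: "f \<in> carrier PS" and g: "g \<in> carrier PS"
  shows "(f [^]\<^bsub>PS\<^esub> (p ^ e) \<otimes>\<^bsub>PS\<^esub> g) m =
    (\<Oplus>d\<in>{d. repeat_mset (p ^ e) d \<subseteq># m}. f d [^] (p ^ e) \<otimes> g (m - repeat_mset (p ^ e) d))"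
proof -
  let ?q = "p ^ e"
  have q: "?q > 0" by simp
  let ?E = "{d. repeat_mset ?q d \<subseteq># m}"
  have the: "(THE d'. repeat_mset ?q d = repeat_mset ?q d') = d" for d :: "'v multiset"
    by (rule the_equality) (simp_all add: repeat_mset_cancel1)
  have inj: "inj_on (repeat_mset ?q) ?E" using q by (auto simp: inj_on_def repeat_mset_cancel1)
  note fq = PS.nat_pow_closed[OF f, of ?q]
  have "(f [^]\<^bsub>PS\<^esub> ?q \<otimes>\<^bsub>PS\<^esub> g) m = (\<Oplus>d\<in>repeat_mset ?q ` ?E. (f [^]\<^bsub>PS\<^esub> ?q) d \<otimes> g (m - d))"
    unfolding ps_mult
    by (rule add.finprod_mono_neutral_cong_right)
      (use g ps_coeff_closed[OF fq] in \<open>auto simp: ps_frobenius_coeff[OF f]\<close>)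
  also have "\<dots> = (\<Oplus>d\<in>?E. (f [^]\<^bsub>PS\<^esub> ?q) (repeat_mset ?q d) \<otimes> g (m - repeat_mset ?q d))"
    by (rule finsum_reindex) (use g ps_coeff_closed[OF fq] inj in auto)
  also have "\<dots> = (\<Oplus>d\<in>?E. f d [^] ?q \<otimes> g (m - repeat_mset ?q d))"
    by (rule finsum_cong') (use f g in \<open>auto simp: ps_frobenius_coeff[OF f] the\<close>)
  finally show ?thesis .
qed

end

section \<open>Free direct summands and dual systems\<close>

definition linear_functional :: "('a, 'r) ring_scheme \<Rightarrow> ('a, 'b, 'm) module_scheme \<Rightarrow> ('b \<Rightarrow> 'a) \<Rightarrow> bool" where
  "linear_functional R M \<phi> \<longleftrightarrow> \<phi> \<in> carrier M \<rightarrow> carrier R \<and>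
    (\<forall>x\<in>carrier M. \<forall>y\<in>carrier M. \<phi> (x \<oplus>\<^bsub>M\<^esub> y) = \<phi> x \<oplus>\<^bsub>R\<^esub> \<phi> y) \<and>
    (\<forall>a\<in>carrier R. \<forall>x\<in>carrier M. \<phi> (a \<odot>\<^bsub>M\<^esub> x) = a \<otimes>\<^bsub>R\<^esub> \<phi> x)"

text \<open>An elementwise substitute for a free summand: it can be carried through coefficient
  extraction and ring isomorphisms without handling submodules or complements.\<close>

definition dual_system ::
    "('a, 'r) ring_scheme \<Rightarrow> ('a, 'b, 'm) module_scheme \<Rightarrow> nat \<Rightarrow> (nat \<Rightarrow> 'b) \<Rightarrow> (nat \<Rightarrow> 'b \<Rightarrow> 'a) \<Rightarrow> bool" where
  "dual_system R M r x \<phi> \<longleftrightarrow> (\<forall>i<r. x i \<in> carrier M) \<and> (\<forall>i<r. linear_functional R M (\<phi> i)) \<and>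
    (\<forall>i<r. \<forall>j<r. \<phi> i (x j) = (if i = j then \<one>\<^bsub>R\<^esub> else \<zero>\<^bsub>R\<^esub>))"

lemma (in abelian_group) add_eq_imp_minus_eq:
  assumes "a \<oplus> b = c \<oplus> d" "a \<in> carrier G" "b \<in> carrier G" "c \<in> carrier G" "d \<in> carrier G"
  shows "a \<ominus> c = d \<ominus> b"
proof -
  have "a \<ominus> c = (a \<oplus> b) \<oplus> (\<ominus> b \<oplus> \<ominus> c)"
    using assms(2-) by (simp add: a_assoc r_neg2 minus_eq)
  also have "\<dots> = (c \<oplus> d) \<oplus> (\<ominus> c \<oplus> \<ominus> b)"
    using assms by (simp add: a_comm)
  also have "\<dots> = d \<ominus> b"
    using assms(2-) by (simp add: a_comm[of c d] a_assoc r_neg2 minus_eq)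
  finally show ?thesis .
qed

context module
begin

lemma
  assumes "linear_functional R M \<phi>"
  shows functional_closed: "\<And>x. x \<in> carrier M \<Longrightarrow> \<phi> x \<in> carrier R"
    and functional_add: "\<And>x y. x \<in> carrier M \<Longrightarrow> y \<in> carrier M \<Longrightarrow> \<phi> (x \<oplus>\<^bsub>M\<^esub> y) = \<phi> x \<oplus> \<phi> y"
    and functional_smult: "\<And>a x. a \<in> carrier R \<Longrightarrow> x \<in> carrier M \<Longrightarrow> \<phi> (a \<odot>\<^bsub>M\<^esub> x) = a \<otimes> \<phi> x"
  using assms by (auto simp: linear_functional_def)

lemma functional_zero:
  assumes "linear_functional R M \<phi>"
  shows "\<phi> \<zero>\<^bsub>M\<^esub> = \<zero>"
  using functional_smult[OF assms, of \<zero> "\<zero>\<^bsub>M\<^esub>"] functional_closed[OF assms, of "\<zero>\<^bsub>M\<^esub>"] by simp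

lemma functional_minus:
  assumes "linear_functional R M \<phi>" "x \<in> carrier M"
  shows "\<phi> (\<ominus>\<^bsub>M\<^esub> x) = \<ominus> \<phi> x"
proof -
  have "\<phi> (\<ominus>\<^bsub>M\<^esub> x) \<oplus> \<phi> x = \<zero>"
    using functional_add[OF assms(1), of "\<ominus>\<^bsub>M\<^esub> x" x] assms functional_zero[OF assms(1)]
    by (simp add: M.l_neg)
  then show ?thesis
    using functional_closed[OF assms(1)] assms(2) by (intro R.minus_equality[symmetric]) auto
qed

lemma functional_finsum:
  assumes "linear_functional R M \<phi>" "f \<in> A \<rightarrow> carrier M"
  shows "\<phi> (\<Oplus>\<^bsub>M\<^esub>i\<in>A. f i) = (\<Oplus>i\<in>A. \<phi> (f i))"
  using assms(2)
proof (induction A rule: infinite_finite_induct)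
  case (insert x A)
  then show ?case
    by (subst M.finsum_insert; (subst R.finsum_insert)?)
      (auto simp: Pi_def functional_add[OF assms(1)] functional_closed[OF assms(1)])
qed (simp_all add: functional_zero[OF assms(1)])

lemma finsum_submodule:
  assumes "submodule N R M" "f \<in> A \<rightarrow> N"
  shows "finsum (M\<lparr>carrier := N\<rparr>) f A = finsum M f A" "finsum M f A \<in> N"
proof -
  interpret N: module R "M\<lparr>carrier := N\<rparr>"
    using assms(1) module_axioms by (rule submodule.submodule_is_module)
  have sub: "N \<subseteq> carrier M" using submoduleE[OF assms(1)] by blast
  have *: "finsum (M\<lparr>carrier := N\<rparr>) f A = finsum M f A \<and> finsum M f A \<in> N" using assms(2)
  proof (induction A rule: infinite_finite_induct)
    case (insert x A)
    have "finsum (M\<lparr>carrier := N\<rparr>) f (insert x A) = f x \<oplus>\<^bsub>M\<^esub> finsum (M\<lparr>carrier := N\<rparr>) f A"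
      by (subst N.M.finsum_insert) (use insert in auto)
    moreover have "finsum M f (insert x A) = f x \<oplus>\<^bsub>M\<^esub> finsum M f A"
      by (subst M.finsum_insert) (use insert sub in auto)
    ultimately show ?case using insert submoduleE(5)[OF assms(1)] by auto
  next
    case empty
    then show ?case using N.M.finsum_empty N.M.zero_closed by simp
  next
    case (infinite A)
    then show ?case using N.M.zero_closed by simp
  qed
  show "finsum (M\<lparr>carrier := N\<rparr>) f A = finsum M f A" "finsum M f A \<in> N" using * by auto
qed

text \<open>The summand N is the span of the x i and its complement N' is the common kernel of the
  functionals. Applying \<open>\<phi> i\<close> to a combination of the x j reads off its i-th
  coefficient, which gives both the splitting of z and the uniqueness of coordinates.\<close>

lemma dual_system_free_summand:
  assumes D: "dual_system R M r x \<phi>"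
  shows "\<exists>N. direct_summand R M N \<and> free_of_rank R (M\<lparr>carrier := N\<rparr>) r"
proof -
  have x: "\<And>i. i < r \<Longrightarrow> x i \<in> carrier M" and l: "\<And>i. i < r \<Longrightarrow> linear_functional R M (\<phi> i)"
    and d: "\<And>i j. i < r \<Longrightarrow> j < r \<Longrightarrow> \<phi> i (x j) = (if i = j then \<one> else \<zero>)"
    using D by (auto simp: dual_system_def)
  note lcl = functional_closed[OF l]
  define L where "L c = (\<Oplus>\<^bsub>M\<^esub>i\<in>{..<r}. c i \<odot>\<^bsub>M\<^esub> x i)" for c
  have Lcl: "L c \<in> carrier M" if "c \<in> {..<r} \<rightarrow> carrier R" for c
    unfolding L_def using that x by (intro M.finsum_closed) auto
  have coord: "\<phi> i (L c) = c i" if "c \<in> {..<r} \<rightarrow> carrier R" "i < r" for c i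
  proof -
    have "\<phi> i (L c) = (\<Oplus>j\<in>{..<r}. \<phi> i (c j \<odot>\<^bsub>M\<^esub> x j))"
      unfolding L_def using that x by (intro functional_finsum l) auto
    also have "\<dots> = (\<Oplus>j\<in>{..<r}. if i = j then c j else \<zero>)"
      using that x d by (intro R.finsum_cong') (auto simp: Pi_iff functional_smult[OF l])
    also have "\<dots> = c i" using that by (intro R.finsum_singleton) auto
    finally show ?thesis .
  qed
  define N where "N = L ` ({..<r} \<rightarrow> carrier R)"
  define N' where "N' = {z \<in> carrier M. \<forall>i<r. \<phi> i z = \<zero>}"
  have L_add: "L c \<oplus>\<^bsub>M\<^esub> L c' = L (\<lambda>i. c i \<oplus> c' i)"
    if "c \<in> {..<r} \<rightarrow> carrier R" "c' \<in> {..<r} \<rightarrow> carrier R" for c c'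
  proof -
    have "L (\<lambda>i. c i \<oplus> c' i) = (\<Oplus>\<^bsub>M\<^esub>i\<in>{..<r}. c i \<odot>\<^bsub>M\<^esub> x i \<oplus>\<^bsub>M\<^esub> c' i \<odot>\<^bsub>M\<^esub> x i)"
      unfolding L_def by (rule M.finsum_cong') (use that x in \<open>auto simp: Pi_iff smult_l_distr\<close>)
    then show ?thesis unfolding L_def using that x by (subst M.finsum_addf[symmetric]) auto
  qed
  have L_smult: "a \<odot>\<^bsub>M\<^esub> L c = L (\<lambda>i. a \<otimes> c i)"
    if "a \<in> carrier R" "c \<in> {..<r} \<rightarrow> carrier R" for a c
    unfolding L_def
    by (subst finsum_smult_ldistr) (use that x in \<open>auto simp: Pi_iff smult_assoc1 intro!: M.finsum_cong'\<close>)
  have minus_smult: "\<ominus>\<^bsub>M\<^esub> z = (\<ominus> \<one>) \<odot>\<^bsub>M\<^esub> z" if "z \<in> carrier M" for z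
    using that by (simp add: smult_l_minus)
  have subN: "submodule N R M"
  proof (rule submoduleI)
    show "N \<subseteq> carrier M" using Lcl by (auto simp: N_def)
    have "L (\<lambda>i. \<zero>) = \<zero>\<^bsub>M\<^esub>" unfolding L_def using x by (intro M.add.finprod_one_eqI) auto
    then show "\<zero>\<^bsub>M\<^esub> \<in> N" unfolding N_def by (intro image_eqI[of _ L "\<lambda>i. \<zero>"]) auto
    show sm: "a \<odot>\<^bsub>M\<^esub> z \<in> N" if az: "a \<in> carrier R" "z \<in> N" for a z
    proof -
      obtain c where c: "z = L c" "c \<in> {..<r} \<rightarrow> carrier R" using az unfolding N_def by blast
      show ?thesis unfolding N_def c(1) L_smult[OF az(1) c(2)] using az c by (intro imageI) auto
    qed
    show "\<ominus>\<^bsub>M\<^esub> z \<in> N" if "z \<in> N" for z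
      using that sm[of "\<ominus> \<one>" z] minus_smult[of z] Lcl by (auto simp: N_def)
    show "z \<oplus>\<^bsub>M\<^esub> z' \<in> N" if zz: "z \<in> N" "z' \<in> N" for z z'
    proof -
      obtain c c' where c: "z = L c" "c \<in> {..<r} \<rightarrow> carrier R" "z' = L c'" "c' \<in> {..<r} \<rightarrow> carrier R"
        using zz unfolding N_def by blast
      show ?thesis unfolding N_def c(1,3) L_add[OF c(2,4)] using c by (intro imageI) auto
    qed
  qed
  have subN': "submodule N' R M"
    by (rule submoduleI)
      (auto simp: N'_def functional_zero[OF l] functional_minus[OF l] functional_add[OF l] functional_smult[OF l])
  have "N <+>\<^bsub>M\<^esub> N' = carrier M"
  proof
    show "N <+>\<^bsub>M\<^esub> N' \<subseteq> carrier M" using Lcl by (auto simp: set_add_def' N_def N'_def)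
    show "carrier M \<subseteq> N <+>\<^bsub>M\<^esub> N'"
    proof
      fix z assume z: "z \<in> carrier M"
      define c where "c i = \<phi> i z" for i
      have c: "c \<in> {..<r} \<rightarrow> carrier R" using z lcl by (auto simp: c_def)
      have "z \<ominus>\<^bsub>M\<^esub> L c \<in> N'"
        using z Lcl[OF c] coord[OF c] lcl
        by (auto simp: N'_def M.minus_eq functional_add[OF l] functional_minus[OF l] c_def R.r_neg)
      moreover have "z = L c \<oplus>\<^bsub>M\<^esub> (z \<ominus>\<^bsub>M\<^esub> L c)"
        using z Lcl[OF c] by (simp add: M.minus_eq M.a_lcomm M.r_neg)
      ultimately show "z \<in> N <+>\<^bsub>M\<^esub> N'" using c by (auto simp: set_add_def' N_def)
    qed
  qed
  moreover have "N \<inter> N' = {\<zero>\<^bsub>M\<^esub>}"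
  proof
    show "N \<inter> N' \<subseteq> {\<zero>\<^bsub>M\<^esub>}"
    proof
      fix z assume "z \<in> N \<inter> N'"
      then obtain c where c: "z = L c" "c \<in> {..<r} \<rightarrow> carrier R" and z: "\<forall>i<r. \<phi> i z = \<zero>"
        unfolding N_def N'_def by blast
      have "c i = \<zero>" if "i < r" for i using coord[OF c(2) that] z that c(1) by simp
      then have "z = \<zero>\<^bsub>M\<^esub>" unfolding c(1) L_def using x by (intro M.add.finprod_one_eqI) auto
      then show "z \<in> {\<zero>\<^bsub>M\<^esub>}" by simp
    qed
    show "{\<zero>\<^bsub>M\<^esub>} \<subseteq> N \<inter> N'" using submoduleE(2)[OF subN] subgroup.one_closed[OF submodule.axioms(1)[OF subN]]
      subgroup.one_closed[OF submodule.axioms(1)[OF subN']] by simp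
  qed
  ultimately have "direct_summand R M N" using subN subN' by (auto simp: direct_summand_def)
  moreover have "free_of_rank R (M\<lparr>carrier := N\<rparr>) r"
    unfolding free_of_rank_def
  proof (rule bexI[of _ x], intro ballI)
    have xN: "x i \<in> N" if "i < r" for i
    proof -
      have "L (\<lambda>j. if i = j then \<one> else \<zero>) = (\<Oplus>\<^bsub>M\<^esub>j\<in>{..<r}. if i = j then x j else \<zero>\<^bsub>M\<^esub>)"
        unfolding L_def using x by (intro M.finsum_cong') auto
      also have "\<dots> = x i" using that x by (intro M.finsum_singleton) auto
      finally show ?thesis unfolding N_def by (intro image_eqI[of _ L "\<lambda>j. if i = j then \<one> else \<zero>"]) auto
    qed
    then show "x \<in> {..<r} \<rightarrow> carrier (M\<lparr>carrier := N\<rparr>)" by auto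
    have fs: "finsum (M\<lparr>carrier := N\<rparr>) (\<lambda>i. c i \<odot>\<^bsub>M\<^esub> x i) {..<r} = L c" if "c \<in> {..<r} \<rightarrow> carrier R" for c
      unfolding L_def using that xN by (intro finsum_submodule subN) (auto intro!: submoduleE(4)[OF subN])
    fix z assume "z \<in> carrier (M\<lparr>carrier := N\<rparr>)"
    then obtain c where c: "z = L c" "c \<in> {..<r} \<rightarrow> carrier R" unfolding N_def by auto
    have r1: "restrict c {..<r} \<in> {..<r} \<rightarrow> carrier R" using c by auto
    have r2: "L (restrict c {..<r}) = L c" unfolding L_def using c x by (intro M.finsum_cong') auto
    show "\<exists>!c. c \<in> {..<r} \<rightarrow>\<^sub>E carrier R \<and> z = finsum (M\<lparr>carrier := N\<rparr>) (\<lambda>i. c i \<odot>\<^bsub>M\<lparr>carrier := N\<rparr>\<^esub> x i) {..<r}"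
    proof (rule ex1I[of _ "restrict c {..<r}"])
      show "restrict c {..<r} \<in> {..<r} \<rightarrow>\<^sub>E carrier R \<and> z = finsum (M\<lparr>carrier := N\<rparr>) (\<lambda>i. restrict c {..<r} i \<odot>\<^bsub>M\<lparr>carrier := N\<rparr>\<^esub> x i) {..<r}"
        using c fs[OF r1] r2 by auto
      fix c' assume c': "c' \<in> {..<r} \<rightarrow>\<^sub>E carrier R \<and> z = finsum (M\<lparr>carrier := N\<rparr>) (\<lambda>i. c' i \<odot>\<^bsub>M\<lparr>carrier := N\<rparr>\<^esub> x i) {..<r}"
      then have c'2: "c' \<in> {..<r} \<rightarrow> carrier R" by (auto simp: PiE_def)
      have eq: "L c' = L c" using c' fs[OF c'2] c(1) by simp
      have "c' i = c i" if "i < r" for i using coord[OF c'2 that] coord[OF c(2) that] eq by simp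
      then show "c' = restrict c {..<r}" using c' by (intro ext) (auto simp: PiE_def extensional_def)
    qed
  qed
  ultimately show ?thesis by blast
qed

text \<open>The functionals are the coordinates, with respect to the basis b, of the projection to N
  along the complement.\<close>

lemma free_summand_dual_system:
  assumes N: "direct_summand R M N" and F: "free_of_rank R (M\<lparr>carrier := N\<rparr>) r"
  shows "\<exists>x \<phi>. dual_system R M r x \<phi>"
proof -
  obtain N' where subN: "submodule N R M" and subN': "submodule N' R M"
    and sum: "N <+>\<^bsub>M\<^esub> N' = carrier M" and int: "N \<inter> N' = {\<zero>\<^bsub>M\<^esub>}"
    using N by (auto simp: direct_summand_def)
  obtain b where b: "b \<in> {..<r} \<rightarrow> N"
    and bu: "\<And>z. z \<in> N \<Longrightarrow> \<exists>!c. c \<in> {..<r} \<rightarrow>\<^sub>E carrier R \<and> z = finsum (M\<lparr>carrier := N\<rparr>) (\<lambda>i. c i \<odot>\<^bsub>M\<^esub> b i) {..<r}"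
    using F by (auto simp: free_of_rank_def)
  note sN = submoduleE[OF subN] and sN' = submoduleE[OF subN']
  have bN: "b i \<in> N" "b i \<in> carrier M" if "i < r" for i using b that sN(1) by auto
  define L where "L c = (\<Oplus>\<^bsub>M\<^esub>i\<in>{..<r}. c i \<odot>\<^bsub>M\<^esub> b i)" for c
  have fs: "finsum (M\<lparr>carrier := N\<rparr>) (\<lambda>i. c i \<odot>\<^bsub>M\<^esub> b i) {..<r} = L c" and LN: "L c \<in> N"
    if "c \<in> {..<r} \<rightarrow> carrier R" for c
    unfolding L_def using that bN sN(4)
    by (auto simp: Pi_iff intro!: finsum_submodule subN)
  have Lex: "\<exists>!c. c \<in> {..<r} \<rightarrow>\<^sub>E carrier R \<and> z = L c" if "z \<in> N" for z
    using bu[OF that] fs by (metis (no_types, lifting) PiE_def IntD1)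
  have LM: "L c \<in> carrier M" if "c \<in> {..<r} \<rightarrow> carrier R" for c using LN[OF that] sN(1) by auto
  have L_cong: "L c = L c'" if "\<And>i. i < r \<Longrightarrow> c i = c' i" "c' \<in> {..<r} \<rightarrow> carrier R" for c c'
    unfolding L_def using that bN by (intro M.finsum_cong') auto
  have L_add: "L c \<oplus>\<^bsub>M\<^esub> L c' = L (\<lambda>i. c i \<oplus> c' i)"
    if "c \<in> {..<r} \<rightarrow> carrier R" "c' \<in> {..<r} \<rightarrow> carrier R" for c c'
  proof -
    have "L (\<lambda>i. c i \<oplus> c' i) = (\<Oplus>\<^bsub>M\<^esub>i\<in>{..<r}. c i \<odot>\<^bsub>M\<^esub> b i \<oplus>\<^bsub>M\<^esub> c' i \<odot>\<^bsub>M\<^esub> b i)"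
      unfolding L_def by (rule M.finsum_cong') (use that bN in \<open>auto simp: Pi_iff smult_l_distr\<close>)
    then show ?thesis unfolding L_def using that bN by (subst M.finsum_addf[symmetric]) auto
  qed
  have L_smult: "a \<odot>\<^bsub>M\<^esub> L c = L (\<lambda>i. a \<otimes> c i)"
    if "a \<in> carrier R" "c \<in> {..<r} \<rightarrow> carrier R" for a c
    unfolding L_def
    by (subst finsum_smult_ldistr) (use that bN in \<open>auto simp: Pi_iff smult_assoc1 intro!: M.finsum_cong'\<close>)
  \<comment> \<open>\<open>P z c\<close> says that c is the coordinate vector of the N-component of
    z. Uniqueness combines the trivial intersection of N and N' with uniqueness of coordinates in N.
    The vectors are extensional, as \<open>free_of_rank\<close> prescribes, hence the later use of
    \<open>restrict\<close>.\<close>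
  define P where "P z c \<longleftrightarrow> c \<in> {..<r} \<rightarrow>\<^sub>E carrier R \<and> (\<exists>n'\<in>N'. z = L c \<oplus>\<^bsub>M\<^esub> n')" for z c
  have Pcl: "c \<in> {..<r} \<rightarrow> carrier R" if "P z c" for z c using that by (auto simp: P_def PiE_def)
  have Pex: "\<exists>c. P z c" if z: "z \<in> carrier M" for z
  proof -
    obtain n n' where nn: "n \<in> N" "n' \<in> N'" "z = n \<oplus>\<^bsub>M\<^esub> n'" using z unfolding sum[symmetric] set_add_def' by auto
    then show ?thesis using Lex[OF nn(1)] by (auto simp: P_def)
  qed
  have Puniq: "c = c'" if c: "P z c" and c': "P z c'" for z c c'
  proof -
    obtain n n' where n: "n \<in> N'" "z = L c \<oplus>\<^bsub>M\<^esub> n" "n' \<in> N'" "z = L c' \<oplus>\<^bsub>M\<^esub> n'"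
      using c c' by (auto simp: P_def)
    have cl: "L c \<in> carrier M" "L c' \<in> carrier M" "n \<in> carrier M" "n' \<in> carrier M"
      using LM Pcl[OF c] Pcl[OF c'] n sN'(1) by auto
    have eq: "L c \<ominus>\<^bsub>M\<^esub> L c' = n' \<ominus>\<^bsub>M\<^esub> n"
      using n(2,4) cl by (intro M.add_eq_imp_minus_eq) auto
    have "L c \<ominus>\<^bsub>M\<^esub> L c' \<in> N" using LN[OF Pcl[OF c]] LN[OF Pcl[OF c']] sN by (simp add: M.minus_eq)
    moreover have "n' \<ominus>\<^bsub>M\<^esub> n \<in> N'" using n sN' by (simp add: M.minus_eq)
    ultimately have "L c \<ominus>\<^bsub>M\<^esub> L c' = \<zero>\<^bsub>M\<^esub>" using eq int by auto
    then have "L c = L c'"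
      using cl M.minus_equality[of "L c" "\<ominus>\<^bsub>M\<^esub> L c'"] by (simp add: M.minus_eq)
    then show ?thesis using Lex[OF LN[OF Pcl[OF c]]] c c' by (auto simp: P_def)
  qed
  define \<phi> where "\<phi> i z = (THE c. P z c) i" for i z
  have \<phi>: "\<phi> i z = c i" if "P z c" for i z c
  proof -
    have "(THE c. P z c) = c" by (rule the_equality[of "P z", OF that]) (rule Puniq[OF _ that])
    then show ?thesis by (simp add: \<phi>_def)
  qed
  have P_intro: "P z (restrict c {..<r})" if "c \<in> {..<r} \<rightarrow> carrier R" "n' \<in> N'" "z = L c \<oplus>\<^bsub>M\<^esub> n'" for z c n'
  proof -
    have "L (restrict c {..<r}) = L c" using that(1) by (intro L_cong) auto
    then show ?thesis using that by (auto simp: P_def)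
  qed
  have lin: "linear_functional R M (\<phi> i)" if i: "i < r" for i
    unfolding linear_functional_def
  proof (intro conjI ballI Pi_I)
    fix z assume z: "z \<in> carrier M"
    then obtain c where c: "P z c" using Pex by blast
    show "\<phi> i z \<in> carrier R" using \<phi>[OF c] Pcl[OF c] i by auto
  next
    fix z z' assume z: "z \<in> carrier M" "z' \<in> carrier M"
    then obtain c c' where c: "P z c" and c': "P z' c'" using Pex by metis
    obtain n n' where n: "n \<in> N'" "z = L c \<oplus>\<^bsub>M\<^esub> n" "n' \<in> N'" "z' = L c' \<oplus>\<^bsub>M\<^esub> n'"
      using c c' by (auto simp: P_def)
    have cl: "L c \<in> carrier M" "L c' \<in> carrier M" "n \<in> carrier M" "n' \<in> carrier M"
      using LM Pcl[OF c] Pcl[OF c'] n sN'(1) by auto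
    have "P (z \<oplus>\<^bsub>M\<^esub> z') (restrict (\<lambda>i. c i \<oplus> c' i) {..<r})"
      by (rule P_intro[of _ "n \<oplus>\<^bsub>M\<^esub> n'"])
        (use Pcl[OF c] Pcl[OF c'] n sN' cl in \<open>auto simp: L_add[symmetric] M.a_ac\<close>)
    then show "\<phi> i (z \<oplus>\<^bsub>M\<^esub> z') = \<phi> i z \<oplus> \<phi> i z'" using \<phi>[OF c] \<phi>[OF c'] \<phi> i by auto
  next
    fix a z assume z: "a \<in> carrier R" "z \<in> carrier M"
    then obtain c where c: "P z c" using Pex by metis
    obtain n where n: "n \<in> N'" "z = L c \<oplus>\<^bsub>M\<^esub> n" using c by (auto simp: P_def)
    have cl: "L c \<in> carrier M" "n \<in> carrier M"
      using LM Pcl[OF c] n sN'(1) by auto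
    have "P (a \<odot>\<^bsub>M\<^esub> z) (restrict (\<lambda>i. a \<otimes> c i) {..<r})"
      by (rule P_intro[of _ "a \<odot>\<^bsub>M\<^esub> n"])
        (use Pcl[OF c] n z sN' cl in \<open>auto simp: L_smult[symmetric] smult_r_distr\<close>)
    then show "\<phi> i (a \<odot>\<^bsub>M\<^esub> z) = a \<otimes> \<phi> i z" using \<phi>[OF c] \<phi> i by auto
  qed
  have "\<phi> i (b j) = (if i = j then \<one> else \<zero>)" if ij: "i < r" "j < r" for i j
  proof -
    have "L (\<lambda>i. if j = i then \<one> else \<zero>) = (\<Oplus>\<^bsub>M\<^esub>i\<in>{..<r}. if j = i then b i else \<zero>\<^bsub>M\<^esub>)"
      unfolding L_def using bN by (intro M.finsum_cong') auto
    also have "\<dots> = b j" using ij bN by (intro M.finsum_singleton) auto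
    finally have "P (b j) (restrict (\<lambda>i. if j = i then \<one> else \<zero>) {..<r})"
      using bN ij by (intro P_intro[of _ "\<zero>\<^bsub>M\<^esub>"]) (auto simp: int[symmetric] intro: subgroup.one_closed[OF submodule.axioms(1)[OF subN'], simplified])
    from \<phi>[OF this] show ?thesis using ij by auto
  qed
  then have "dual_system R M r b \<phi>" using bN lin by (auto simp: dual_system_def)
  then show ?thesis by blast
qed

lemma max_free_rank_eq: "max_free_rank R M = (GREATEST r. \<exists>x \<phi>. dual_system R M r x \<phi>)"
  unfolding max_free_rank_def
  by (rule arg_cong[where f = Greatest]) (use dual_system_free_summand free_summand_dual_system in blast)

end

lemma (in cring_char_p) frobenius_pushforward_module: "module R (frobenius_pushforward p e R)"
proof (rule moduleI)
  show "abelian_group (frobenius_pushforward p e R)"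
    by (rule abelian_groupI)
      (auto simp: frobenius_pushforward_def a_assoc intro: a_comm l_neg a_inv_closed)
qed (auto simp: frobenius_pushforward_def frobenius_add l_distr r_distr nat_pow_distrib m_assoc is_cring)

definition frobenius_dual_system ::
    "nat \<Rightarrow> nat \<Rightarrow> ('a, 'r) ring_scheme \<Rightarrow> nat \<Rightarrow> (nat \<Rightarrow> 'a) \<Rightarrow> (nat \<Rightarrow> 'a \<Rightarrow> 'a) \<Rightarrow> bool" where
  "frobenius_dual_system p e R = dual_system R (frobenius_pushforward p e R)"

lemma linear_functional_frobenius_iff:
  "linear_functional R (frobenius_pushforward p e R) \<phi> \<longleftrightarrow> \<phi> \<in> carrier R \<rightarrow> carrier R \<and>
    (\<forall>x\<in>carrier R. \<forall>y\<in>carrier R. \<phi> (x \<oplus>\<^bsub>R\<^esub> y) = \<phi> x \<oplus>\<^bsub>R\<^esub> \<phi> y) \<and>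
    (\<forall>a\<in>carrier R. \<forall>x\<in>carrier R. \<phi> (a [^]\<^bsub>R\<^esub> (p ^ e) \<otimes>\<^bsub>R\<^esub> x) = a \<otimes>\<^bsub>R\<^esub> \<phi> x)"
  by (simp add: linear_functional_def frobenius_pushforward_def)

lemma (in cring_char_p) frobenius_free_rank_eq:
  "frobenius_free_rank p R e = (GREATEST r. \<exists>x \<phi>. frobenius_dual_system p e R r x \<phi>)"
  unfolding frobenius_free_rank_def frobenius_dual_system_def
  by (rule module.max_free_rank_eq[OF frobenius_pushforward_module])

section \<open>Linear algebra over a field\<close>

text \<open>More vectors than coordinates: Gaussian elimination, one coordinate b per induction
  step. A row i0 with nonzero entry at b serves as pivot and clears that coordinate in the other
  rows, which still outnumber the remaining coordinates.\<close>

lemma (in field) dependent_family: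
  assumes "finite B" "card B < card A" "\<And>i b. i \<in> A \<Longrightarrow> b \<in> B \<Longrightarrow> m i b \<in> carrier R"
  shows "\<exists>c. (\<forall>i\<in>A. c i \<in> carrier R) \<and> (\<exists>i\<in>A. c i \<noteq> \<zero>) \<and> (\<forall>b\<in>B. (\<Oplus>i\<in>A. c i \<otimes> m i b) = \<zero>)"
  using assms
proof (induction B arbitrary: A m rule: finite_induct)
  case empty
  then have "A \<noteq> {}" by auto
  then show ?case by (intro exI[of _ "\<lambda>_. \<one>"]) auto
next
  case (insert b B)
  have finA: "finite A" using insert.prems(1) by (rule card_gt_0_iff[THEN iffD1, THEN conjunct2, OF le_less_trans[OF le0]])
  show ?case
  proof (cases "\<forall>i\<in>A. m i b = \<zero>")
    case True
    obtain c where c: "\<forall>i\<in>A. c i \<in> carrier R" "\<exists>i\<in>A. c i \<noteq> \<zero>" "\<forall>b\<in>B. (\<Oplus>i\<in>A. c i \<otimes> m i b) = \<zero>"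
      using insert.IH[of A m] insert.prems insert.hyps by auto
    have "(\<Oplus>i\<in>A. c i \<otimes> m i b) = \<zero>"
      using True c(1) by (intro add.finprod_one_eqI) auto
    then show ?thesis using c by blast
  next
    case False
    then obtain i0 where i0: "i0 \<in> A" "m i0 b \<noteq> \<zero>" by blast
    have u: "m i0 b \<in> Units R" using i0 insert.prems(2) field_Units by auto
    define A' where "A' = A - {i0}"
    have A: "A = insert i0 A'" "i0 \<notin> A'" "finite A'" using i0 finA by (auto simp: A'_def)
    define t where "t i = m i b \<otimes> inv (m i0 b)" for i
    have t: "t i \<in> carrier R" "t i \<otimes> m i0 b = m i b" if "i \<in> A" for i
      using that insert.prems(2)[of i b] u by (auto simp: t_def m_assoc Units_closed)
    define m' where "m' i b' = m i b' \<ominus> t i \<otimes> m i0 b'" for i b'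
    have mc: "m i b' \<in> carrier R" if "i \<in> A" "b' \<in> insert b B" for i b'
      using insert.prems(2) that by blast
    have m'c: "m' i b' \<in> carrier R" if "i \<in> A" "b' \<in> insert b B" for i b'
      using mc[OF that] mc[OF i0(1) that(2)] t(1)[OF that(1)] by (simp add: m'_def)
    have "card B < card A'" using A insert.prems(1) insert.hyps by simp
    then obtain c where c: "\<forall>i\<in>A'. c i \<in> carrier R" "\<exists>i\<in>A'. c i \<noteq> \<zero>" "\<forall>b\<in>B. (\<Oplus>i\<in>A'. c i \<otimes> m' i b) = \<zero>"
      using insert.IH[of A' m'] m'c A(1) by auto
    \<comment> \<open>Passing from m to m' subtracted the multiple t i of the pivot row from row i.
      Giving the pivot row the coefficient \<open>\<ominus> s\<close> compensates for this in every
      coordinate at once.\<close>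
    define s where "s = (\<Oplus>i\<in>A'. c i \<otimes> t i)"
    have s: "s \<in> carrier R" unfolding s_def using c t A by (intro finsum_closed) auto
    define c' where "c' i = (if i = i0 then \<ominus> s else c i)" for i
    have key: "(\<Oplus>i\<in>A. c' i \<otimes> m i b') = (\<Oplus>i\<in>A'. c i \<otimes> m' i b')" if b': "b' \<in> insert b B" for b'
    proof -
      have "(\<Oplus>i\<in>A. c' i \<otimes> m i b') = c' i0 \<otimes> m i0 b' \<oplus> (\<Oplus>i\<in>A'. c' i \<otimes> m i b')"
        unfolding A(1) by (rule finsum_insert) (use A c s mc b' in \<open>auto simp: c'_def\<close>)
      also have "(\<Oplus>i\<in>A'. c' i \<otimes> m i b') = (\<Oplus>i\<in>A'. c i \<otimes> m i b')"
        by (rule finsum_cong') (use A c mc b' in \<open>auto simp: c'_def\<close>)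
      also have "\<dots> = (\<Oplus>i\<in>A'. c i \<otimes> m' i b' \<oplus> c i \<otimes> t i \<otimes> m i0 b')"
      proof (rule finsum_cong')
        fix i assume i: "i \<in> A'"
        have cl: "c i \<in> carrier R" "t i \<in> carrier R" "m i b' \<in> carrier R" "m i0 b' \<in> carrier R"
          using c t A mc b' i by auto
        have "m' i b' \<oplus> t i \<otimes> m i0 b' = m i b'"
          using cl by (simp add: m'_def minus_eq a_assoc l_neg)
        then show "c i \<otimes> m i b' = c i \<otimes> m' i b' \<oplus> c i \<otimes> t i \<otimes> m i0 b'"
          using cl m'c[of i b'] b' A i by (metis insertI2 m_assoc m_closed r_distr)
      qed (use A c mc m'c t b' in auto)
      also have "\<dots> = (\<Oplus>i\<in>A'. c i \<otimes> m' i b') \<oplus> (\<Oplus>i\<in>A'. c i \<otimes> t i \<otimes> m i0 b')"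
        by (rule finsum_addf) (use A c mc m'c t b' in auto)
      also have "(\<Oplus>i\<in>A'. c i \<otimes> t i \<otimes> m i0 b') = s \<otimes> m i0 b'"
        unfolding s_def by (rule finsum_ldistr[symmetric]) (use A c mc t b' in auto)
      also have "c' i0 \<otimes> m i0 b' \<oplus> ((\<Oplus>i\<in>A'. c i \<otimes> m' i b') \<oplus> s \<otimes> m i0 b') = (\<Oplus>i\<in>A'. c i \<otimes> m' i b')"
      proof -
        have cl: "(\<Oplus>i\<in>A'. c i \<otimes> m' i b') \<in> carrier R" "m i0 b' \<in> carrier R"
          using A c m'c mc b' by (auto intro!: finsum_closed)
        have "\<ominus> w \<oplus> (x \<oplus> w) = x" if "x \<in> carrier R" "w \<in> carrier R" for x w
          using that by (simp add: a_comm[of x w] r_neg1)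
        from this[OF cl(1), of "s \<otimes> m i0 b'"] show ?thesis using s cl by (simp add: c'_def l_minus)
      qed
      finally show ?thesis .
    qed
    have "(\<Oplus>i\<in>A'. c i \<otimes> m' i b) = \<zero>"
      by (rule add.finprod_one_eqI) (use c A t mc in \<open>auto simp: m'_def r_neg minus_eq\<close>)
    then have "\<forall>b'\<in>insert b B. (\<Oplus>i\<in>A. c' i \<otimes> m i b') = \<zero>" using key c(3) by auto
    moreover have "\<forall>i\<in>A. c' i \<in> carrier R" using c s A by (auto simp: c'_def)
    moreover have "\<exists>i\<in>A. c' i \<noteq> \<zero>" using c(2) A by (auto simp: c'_def)
    ultimately show ?thesis by blast
  qed
qed

text \<open>If A were larger than B, some nonzero vector c would satisfy V c = 0, and then c = U (V
  c) = 0. This is the rank argument behind both upper bounds for the length of dual systems.\<close>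

lemma (in field) identity_factor_card:
  assumes "finite A" "finite B"
    and U: "\<And>i l. i \<in> A \<Longrightarrow> l \<in> B \<Longrightarrow> U i l \<in> carrier R"
    and V: "\<And>l j. l \<in> B \<Longrightarrow> j \<in> A \<Longrightarrow> V l j \<in> carrier R"
    and UV: "\<And>i j. i \<in> A \<Longrightarrow> j \<in> A \<Longrightarrow> (\<Oplus>l\<in>B. U i l \<otimes> V l j) = (if i = j then \<one> else \<zero>)"
  shows "card A \<le> card B"
proof (rule ccontr)
  assume "\<not> card A \<le> card B"
  then obtain c i where c: "\<forall>i\<in>A. c i \<in> carrier R" and i: "i \<in> A" "c i \<noteq> \<zero>"
    and z: "\<forall>l\<in>B. (\<Oplus>j\<in>A. c j \<otimes> V l j) = \<zero>"
    using dependent_family[of B A "\<lambda>j l. V l j"] assms by force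
  have "c i = (\<Oplus>j\<in>A. if i = j then c j else \<zero>)"
    using assms(1) i c by (intro finsum_singleton[symmetric]) auto
  also have "\<dots> = (\<Oplus>j\<in>A. \<Oplus>l\<in>B. U i l \<otimes> (c j \<otimes> V l j))"
  proof (rule finsum_cong')
    fix j assume j: "j \<in> A"
    have "(\<Oplus>l\<in>B. U i l \<otimes> (c j \<otimes> V l j)) = (\<Oplus>l\<in>B. c j \<otimes> (U i l \<otimes> V l j))"
      by (rule finsum_cong') (use U V c i j in \<open>auto simp: m_lcomm\<close>)
    also have "\<dots> = c j \<otimes> (\<Oplus>l\<in>B. U i l \<otimes> V l j)"
      by (rule finsum_rdistr[symmetric]) (use assms(2) U V c i j in auto)
    also have "\<dots> = (if i = j then c j else \<zero>)" using UV[OF i(1) j] c j by auto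
    finally show "(if i = j then c j else \<zero>) = (\<Oplus>l\<in>B. U i l \<otimes> (c j \<otimes> V l j))" by simp
  qed (use U V c i in \<open>auto intro!: finsum_closed\<close>)
  also have "\<dots> = (\<Oplus>l\<in>B. \<Oplus>j\<in>A. U i l \<otimes> (c j \<otimes> V l j))"
    by (rule finsum_swap) (use assms(1,2) U V c i in auto)
  also have "\<dots> = (\<Oplus>l\<in>B. U i l \<otimes> (\<Oplus>j\<in>A. c j \<otimes> V l j))"
    by (rule finsum_cong') (use assms(1,2) U V c i in \<open>auto intro!: finsum_rdistr[symmetric] finsum_closed\<close>)
  also have "\<dots> = \<zero>" by (rule add.finprod_one_eqI) (use z U i in auto)
  finally show False using i by simp
qed

section \<open>Monomials with all exponents below q\<close>

definition monomial_box :: "nat \<Rightarrow> 'v set \<Rightarrow> 'v multiset set" where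
  "monomial_box q I = {m. set_mset m \<subseteq> I \<and> (\<forall>v. count m v < q)}"

lemma card_monomial_box:
  assumes "finite I" "q > 0"
  shows "finite (monomial_box q I)" "card (monomial_box q I) = q ^ card I"
proof -
  have "bij_betw (\<lambda>m. restrict (count m) I) (monomial_box q I) (I \<rightarrow>\<^sub>E {..<q})"
  proof (intro bij_betwI')
    fix m m' assume m: "m \<in> monomial_box q I" "m' \<in> monomial_box q I"
    show "(restrict (count m) I = restrict (count m') I) = (m = m')"
    proof
      assume eq: "restrict (count m) I = restrict (count m') I"
      show "m = m'"
      proof (rule multiset_eqI)
        fix v show "count m v = count m' v"
        proof (cases "v \<in> I")
          case True then show ?thesis using fun_cong[OF eq, of v] by simp
        next
          case False
          then have "v \<notin># m" "v \<notin># m'" using m by (auto simp: monomial_box_def)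
          then show ?thesis by (simp add: not_in_iff)
        qed
      qed
    qed simp
  next
    fix m assume "m \<in> monomial_box q I"
    then show "restrict (count m) I \<in> I \<rightarrow>\<^sub>E {..<q}" by (auto simp: monomial_box_def)
  next
    fix f assume f: "f \<in> I \<rightarrow>\<^sub>E {..<q}"
    define m where "m = (\<Sum>v\<in>I. replicate_mset (f v) v)"
    have c: "count m v = (if v \<in> I then f v else 0)" for v
      using assms(1) by (auto simp: m_def count_sum if_distrib sum.delta' cong: if_cong)
    have "m \<in> monomial_box q I"
    proof -
      have "v \<in> I" if "v \<in># m" for v
        using that c[of v] by (auto simp flip: count_greater_zero_iff split: if_splits)
      moreover have "count m v < q" for v using c[of v] f assms(2) by auto
      ultimately show ?thesis by (auto simp: monomial_box_def)
    qed
    moreover have "f = restrict (count m) I"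
      using f c by (intro ext) (auto simp: PiE_def extensional_def)
    ultimately show "\<exists>m\<in>monomial_box q I. f = restrict (count m) I" by blast
  qed
  moreover have "finite (I \<rightarrow>\<^sub>E {..<q})" "card (I \<rightarrow>\<^sub>E {..<q}) = q ^ card I"
    using assms(1) by (auto simp: card_PiE intro!: finite_PiE)
  ultimately show "finite (monomial_box q I)" "card (monomial_box q I) = q ^ card I"
    by (auto simp: bij_betw_finite bij_betw_same_card)
qed

lemma additive_map_zero:
  assumes "abelian_group G" "abelian_group H" "h \<in> carrier G \<rightarrow> carrier H"
    and add: "\<And>x y. x \<in> carrier G \<Longrightarrow> y \<in> carrier G \<Longrightarrow> h (x \<oplus>\<^bsub>G\<^esub> y) = h x \<oplus>\<^bsub>H\<^esub> h y"
  shows "h \<zero>\<^bsub>G\<^esub> = \<zero>\<^bsub>H\<^esub>"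
proof -
  interpret G: abelian_group G by fact
  interpret H: abelian_group H by fact
  have "h \<zero>\<^bsub>G\<^esub> \<in> carrier H" using assms(3) by auto
  moreover have "h \<zero>\<^bsub>G\<^esub> \<oplus>\<^bsub>H\<^esub> h \<zero>\<^bsub>G\<^esub> = h \<zero>\<^bsub>G\<^esub>"
    using add[of "\<zero>\<^bsub>G\<^esub>" "\<zero>\<^bsub>G\<^esub>"] by simp
  ultimately show ?thesis using H.add.r_cancel_one' by metis
qed

lemma additive_map_finsum:
  assumes "abelian_group G" "abelian_group H" "h \<in> carrier G \<rightarrow> carrier H"
    and add: "\<And>x y. x \<in> carrier G \<Longrightarrow> y \<in> carrier G \<Longrightarrow> h (x \<oplus>\<^bsub>G\<^esub> y) = h x \<oplus>\<^bsub>H\<^esub> h y"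
    and "F \<in> A \<rightarrow> carrier G"
  shows "h (\<Oplus>\<^bsub>G\<^esub>i\<in>A. F i) = (\<Oplus>\<^bsub>H\<^esub>i\<in>A. h (F i))"
proof -
  interpret G: abelian_group G by fact
  interpret H: abelian_group H by fact
  note zero = additive_map_zero[OF assms(1-4)]
  show ?thesis using assms(5)
  proof (induction A rule: infinite_finite_induct)
    case (insert x A)
    then show ?case
      by (subst G.finsum_insert; (subst H.finsum_insert)?) (use assms(3) in \<open>auto simp: Pi_iff add\<close>)
  qed (simp_all add: zero)
qed

context power_series
begin

text \<open>An additive map that kills the ideal generated by the q-th powers of the variables sees
  only the finitely many coefficients in the box. Since \<open>\<theta>\<close> is merely additive,
  the part of z outside the box has to be exhibited as a finite sum of multiples of these
  powers.\<close>

lemma vanishing_on_box: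
  assumes "finite I" "q > 0" and K: "abelian_group K"
    and cl: "\<theta> \<in> carrier PS \<rightarrow> carrier K"
    and add: "\<And>f g. f \<in> carrier PS \<Longrightarrow> g \<in> carrier PS \<Longrightarrow> \<theta> (f \<oplus>\<^bsub>PS\<^esub> g) = \<theta> f \<oplus>\<^bsub>K\<^esub> \<theta> g"
    and van: "\<And>v g. v \<in> I \<Longrightarrow> g \<in> carrier PS \<Longrightarrow>
      \<theta> (monom_series R \<one> (replicate_mset q v) \<otimes>\<^bsub>PS\<^esub> g) = \<zero>\<^bsub>K\<^esub>"
    and z: "z \<in> carrier PS"
  shows "\<theta> z = (\<Oplus>\<^bsub>K\<^esub>\<alpha>\<in>monomial_box q I. \<theta> (monom_series R (z \<alpha>) \<alpha>))"
proof -
  interpret K: abelian_group K by (rule K)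
  let ?B = "monomial_box q I"
  have B: "finite ?B" "?B \<subseteq> {d. set_mset d \<subseteq> I}"
    using card_monomial_box[OF assms(1,2)] by (auto simp: monomial_box_def)
  \<comment> \<open>A monomial outside the box may have several exponents that are at least q.
    Choosing one variable for each such monomial puts every outer coefficient of z into exactly one
    of the series g v.\<close>
  define pick where "pick m = (SOME v. v \<in> I \<and> q \<le> count m v)" for m
  have pick: "pick m \<in> I \<and> q \<le> count m (pick m)" if m: "set_mset m \<subseteq> I" "m \<notin> ?B" for m
  proof -
    obtain v where v: "q \<le> count m v" using m by (auto simp: monomial_box_def not_less)
    then have "v \<in># m" using assms(2) by (intro count_inI) linarith
    then have "\<exists>v. v \<in> I \<and> q \<le> count m v" using v m(1) by blast
    from someI_ex[OF this] show ?thesis unfolding pick_def .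
  qed
  define g where "g v m = (if pick (m + replicate_mset q v) = v \<and> v \<in> I then z (m + replicate_mset q v) else \<zero>)" for v m
  have g: "g v \<in> carrier PS" for v
  proof (rule ps_carrierI)
    fix m assume "\<not> set_mset m \<subseteq> I"
    then have "z (m + replicate_mset q v) = \<zero>" by (intro ps_coeff_outside[OF z]) auto
    then show "g v m = \<zero>" by (simp add: g_def)
  qed (use z in \<open>simp add: g_def\<close>)
  let ?y = "\<lambda>v. monom_series R \<one> (replicate_mset q v)"
  have y: "?y v \<in> carrier PS" if "v \<in> I" for v using that by auto
  have yg: "(\<lambda>v. ?y v \<otimes>\<^bsub>PS\<^esub> g v) \<in> I \<rightarrow> carrier PS" using y g by auto
  have mz: "(\<lambda>\<alpha>. monom_series R (z \<alpha>) \<alpha>) \<in> ?B \<rightarrow> carrier PS" using z B by auto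
  have "z = (\<Oplus>\<^bsub>PS\<^esub>\<alpha>\<in>?B. monom_series R (z \<alpha>) \<alpha>) \<oplus>\<^bsub>PS\<^esub> (\<Oplus>\<^bsub>PS\<^esub>v\<in>I. ?y v \<otimes>\<^bsub>PS\<^esub> g v)"
  proof
    fix m
    have "(\<Oplus>\<^bsub>PS\<^esub>v\<in>I. ?y v \<otimes>\<^bsub>PS\<^esub> g v) m = (\<Oplus>v\<in>I. (?y v \<otimes>\<^bsub>PS\<^esub> g v) m)"
      using yg by (rule ps_finsum)
    also have "\<dots> = (\<Oplus>v\<in>I. if q \<le> count m v \<and> pick m = v then z m else \<zero>)"
    proof (rule finsum_cong')
      fix v assume v: "v \<in> I"
      have "replicate_mset q v \<subseteq># m \<Longrightarrow> m - replicate_mset q v + replicate_mset q v = m"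
        by (simp add: subset_mset.diff_add)
      then show "(?y v \<otimes>\<^bsub>PS\<^esub> g v) m = (if q \<le> count m v \<and> pick m = v then z m else \<zero>)"
        using v z g by (subst monom_mult_coeff) (auto simp: g_def count_le_replicate_mset_subset_eq)
    qed (use z in auto)
    also have "\<dots> = (if m \<in> ?B then \<zero> else z m)"
    proof (cases "set_mset m \<subseteq> I \<and> m \<notin> ?B")
      case True
      then have p: "pick m \<in> I" "q \<le> count m (pick m)" using pick by auto
      have "(\<Oplus>v\<in>I. if q \<le> count m v \<and> pick m = v then z m else \<zero>)
         = (if q \<le> count m (pick m) \<and> pick m = pick m then z m else \<zero>)"
        by (rule finsum_single) (use assms(1) p z in auto)
      then show ?thesis using True p by simp
    next
      case False
      have "(\<Oplus>v\<in>I. if q \<le> count m v \<and> pick m = v then z m else \<zero>) = \<zero>"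
      proof (rule add.finprod_one_eqI)
        fix v assume v: "v \<in> I"
        show "(if q \<le> count m v \<and> pick m = v then z m else \<zero>) = \<zero>"
          using False ps_coeff_outside[OF z, of m] by (auto simp: monomial_box_def dest: leD)
      qed
      moreover have "m \<notin> ?B \<Longrightarrow> z m = \<zero>" using False ps_coeff_outside[OF z, of m] by blast
      ultimately show ?thesis by simp
    qed
    finally show "z m = ((\<Oplus>\<^bsub>PS\<^esub>\<alpha>\<in>?B. monom_series R (z \<alpha>) \<alpha>) \<oplus>\<^bsub>PS\<^esub> (\<Oplus>\<^bsub>PS\<^esub>v\<in>I. ?y v \<otimes>\<^bsub>PS\<^esub> g v)) m"
      using z by (simp add: ps_add ps_decompose[OF z B])
  qed
  then have "\<theta> z = \<theta> ((\<Oplus>\<^bsub>PS\<^esub>\<alpha>\<in>?B. monom_series R (z \<alpha>) \<alpha>) \<oplus>\<^bsub>PS\<^esub> (\<Oplus>\<^bsub>PS\<^esub>v\<in>I. ?y v \<otimes>\<^bsub>PS\<^esub> g v))"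
    by (rule arg_cong)
  also have "\<dots> = \<theta> (\<Oplus>\<^bsub>PS\<^esub>\<alpha>\<in>?B. monom_series R (z \<alpha>) \<alpha>) \<oplus>\<^bsub>K\<^esub> \<theta> (\<Oplus>\<^bsub>PS\<^esub>v\<in>I. ?y v \<otimes>\<^bsub>PS\<^esub> g v)"
    by (rule add[OF PS.finsum_closed[OF mz] PS.finsum_closed[OF yg]])
  also have "\<theta> (\<Oplus>\<^bsub>PS\<^esub>v\<in>I. ?y v \<otimes>\<^bsub>PS\<^esub> g v) = (\<Oplus>\<^bsub>K\<^esub>v\<in>I. \<theta> (?y v \<otimes>\<^bsub>PS\<^esub> g v))"
    by (rule additive_map_finsum[OF PS.is_abelian_group K cl add yg])
  also have "\<dots> = \<zero>\<^bsub>K\<^esub>"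
    by (rule K.add.finprod_one_eqI) (use van g in auto)
  also have "\<theta> (\<Oplus>\<^bsub>PS\<^esub>\<alpha>\<in>?B. monom_series R (z \<alpha>) \<alpha>) = (\<Oplus>\<^bsub>K\<^esub>\<alpha>\<in>?B. \<theta> (monom_series R (z \<alpha>) \<alpha>))"
    by (rule additive_map_finsum[OF PS.is_abelian_group K cl add mz])
  finally show ?thesis using cl mz by (auto simp: Pi_iff intro!: K.finsum_closed K.r_zero)
qed

end

section \<open>Splitting ranks of power series rings\<close>

context module
begin

lemma dual_system_of_family:
  assumes "finite T" "\<And>i. i \<in> T \<Longrightarrow> x i \<in> carrier M"
    "\<And>i. i \<in> T \<Longrightarrow> linear_functional R M (\<phi> i)"
    "\<And>i j. i \<in> T \<Longrightarrow> j \<in> T \<Longrightarrow> \<phi> i (x j) = (if i = j then \<one> else \<zero>)"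
  shows "\<exists>x \<phi>. dual_system R M (card T) x \<phi>"
proof -
  obtain h where h: "bij_betw h {..<card T} T"
    using ex_bij_betw_nat_finite[OF assms(1)] by (auto simp: atLeast0LessThan)
  have hT: "h i \<in> T" if "i < card T" for i using h that by (auto simp: bij_betw_def)
  have inj: "h i = h j \<longleftrightarrow> i = j" if "i < card T" "j < card T" for i j
    using h that by (auto simp: bij_betw_def inj_on_def)
  have "dual_system R M (card T) (\<lambda>i. x (h i)) (\<lambda>i. \<phi> (h i))"
    using assms hT inj by (simp add: dual_system_def)
  then show ?thesis by blast
qed

text \<open>If the pairing were not determined modulo the maximal ideal by the given dual system, the
  component of \<^term>\<open>z\<close> orthogonal to the system would extend it.\<close>

lemma maximal_dual_system_pairing:
  assumes K: "field K" and \<epsilon>: "\<epsilon> \<in> ring_hom R K"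
    and unit: "\<And>a. a \<in> carrier R \<Longrightarrow> \<epsilon> a \<noteq> \<zero>\<^bsub>K\<^esub> \<Longrightarrow> a \<in> Units R"
    and D: "dual_system R M r x \<phi>" and max: "\<not> (\<exists>x \<phi>. dual_system R M (Suc r) x \<phi>)"
    and \<psi>: "linear_functional R M \<psi>" and z: "z \<in> carrier M"
  shows "\<epsilon> (\<psi> z) = (\<Oplus>\<^bsub>K\<^esub>l\<in>{..<r}. \<epsilon> (\<psi> (x l)) \<otimes>\<^bsub>K\<^esub> \<epsilon> (\<phi> l z))"
proof -
  interpret K: field K by (rule K)
  interpret \<epsilon>: ring_hom_cring R K \<epsilon> by unfold_locales (rule \<epsilon>)
  have x: "\<And>i. i < r \<Longrightarrow> x i \<in> carrier M" and l: "\<And>i. i < r \<Longrightarrow> linear_functional R M (\<phi> i)"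
    and d: "\<And>i j. i < r \<Longrightarrow> j < r \<Longrightarrow> \<phi> i (x j) = (if i = j then \<one> else \<zero>)"
    using D by (auto simp: dual_system_def)
  note lcl = functional_closed[OF l] and \<psi>cl = functional_closed[OF \<psi>]
  define s where "s w = (\<Oplus>i\<in>{..<r}. \<psi> (x i) \<otimes> \<phi> i w)" for w
  have scl: "s w \<in> carrier R" if "w \<in> carrier M" for w
    unfolding s_def using that x lcl \<psi>cl by (intro R.finsum_closed) auto
  define z1 where "z1 = (\<Oplus>\<^bsub>M\<^esub>i\<in>{..<r}. \<phi> i z \<odot>\<^bsub>M\<^esub> x i)"
  have z1: "z1 \<in> carrier M" unfolding z1_def using x lcl z by (intro M.finsum_closed) auto
  define z' where "z' = z \<ominus>\<^bsub>M\<^esub> z1"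
  have z': "z' \<in> carrier M" using z z1 by (simp add: z'_def)
  have fz': "f z' = f z \<ominus> f z1" if "linear_functional R M f" for f
    unfolding z'_def M.minus_eq R.minus_eq using that z z1 by (simp add: functional_add functional_minus)
  have \<phi>z1: "\<phi> i z1 = \<phi> i z" if "i < r" for i
  proof -
    have "\<phi> i z1 = (\<Oplus>j\<in>{..<r}. \<phi> i (\<phi> j z \<odot>\<^bsub>M\<^esub> x j))"
      unfolding z1_def by (rule functional_finsum[OF l[OF that]]) (use x lcl z in auto)
    also have "\<dots> = (\<Oplus>j\<in>{..<r}. if i = j then \<phi> j z else \<zero>)"
      by (rule R.finsum_cong') (use x lcl z that d functional_smult[OF l[OF that]] in auto)
    also have "\<dots> = \<phi> i z" by (rule R.finsum_singleton) (use that lcl z in auto)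
    finally show ?thesis .
  qed
  have \<phi>z': "\<phi> i z' = \<zero>" if "i < r" for i
    using fz'[OF l[OF that]] \<phi>z1[OF that] lcl[OF that z] by (simp add: R.minus_eq R.r_neg)
  have \<psi>z1: "\<psi> z1 = s z"
  proof -
    have "\<psi> z1 = (\<Oplus>j\<in>{..<r}. \<psi> (\<phi> j z \<odot>\<^bsub>M\<^esub> x j))"
      unfolding z1_def by (rule functional_finsum[OF \<psi>]) (use x lcl z in auto)
    also have "\<dots> = s z" unfolding s_def
      by (rule R.finsum_cong') (use x lcl z \<psi>cl functional_smult[OF \<psi>] in \<open>auto simp: R.m_comm\<close>)
    finally show ?thesis .
  qed
  define u where "u = \<psi> z'"
  have u: "u \<in> carrier R" "u = \<psi> z \<ominus> s z"
    using \<psi>cl[OF z'] by (simp add: u_def) (simp add: u_def fz'[OF \<psi>] \<psi>z1)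
  have \<epsilon>u: "\<epsilon> u = \<zero>\<^bsub>K\<^esub>"
  proof (rule ccontr)
    assume "\<epsilon> u \<noteq> \<zero>\<^bsub>K\<^esub>"
    then have U: "u \<in> Units R" by (rule unit[OF u(1)])
    \<comment> \<open>The functional to be added: s is the part of \<open>\<psi>\<close> visible to
      the system. It agrees with \<open>\<psi>\<close> on every x j and vanishes on z', so
      \<open>\<psi>'\<close> is zero on the x j and, after division by u, one on z'.\<close>
    define \<psi>' where "\<psi>' w = inv u \<otimes> (\<psi> w \<ominus> s w)" for w
    have s_add: "s (w \<oplus>\<^bsub>M\<^esub> w') = s w \<oplus> s w'" if "w \<in> carrier M" "w' \<in> carrier M" for w w'
    proof -
      have "s (w \<oplus>\<^bsub>M\<^esub> w') = (\<Oplus>i\<in>{..<r}. \<psi> (x i) \<otimes> \<phi> i w \<oplus> \<psi> (x i) \<otimes> \<phi> i w')"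
        unfolding s_def
        by (rule R.finsum_cong') (use that x lcl \<psi>cl functional_add[OF l] in \<open>auto simp: R.r_distr\<close>)
      then show ?thesis unfolding s_def using that x lcl \<psi>cl by (subst R.finsum_addf[symmetric]) auto
    qed
    have s_smult: "s (a \<odot>\<^bsub>M\<^esub> w) = a \<otimes> s w" if "a \<in> carrier R" "w \<in> carrier M" for a w
      unfolding s_def
      by (subst R.finsum_rdistr)
        (use that x lcl \<psi>cl functional_smult[OF l] in \<open>auto simp: R.m_lcomm intro!: R.finsum_cong'\<close>)
    have \<psi>': "linear_functional R M \<psi>'"
      unfolding linear_functional_def
    proof (intro conjI ballI Pi_I)
      fix w assume "w \<in> carrier M"
      then show "\<psi>' w \<in> carrier R" using U scl \<psi>cl by (simp add: \<psi>'_def)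
    next
      fix w w' assume w: "w \<in> carrier M" "w' \<in> carrier M"
      note c = scl[OF w(1)] scl[OF w(2)] \<psi>cl[OF w(1)] \<psi>cl[OF w(2)] U
      have "\<psi> w \<oplus> \<psi> w' \<ominus> (s w \<oplus> s w') = (\<psi> w \<ominus> s w) \<oplus> (\<psi> w' \<ominus> s w')"
        using c by (simp add: R.minus_eq R.minus_add R.a_ac)
      then show "\<psi>' (w \<oplus>\<^bsub>M\<^esub> w') = \<psi>' w \<oplus> \<psi>' w'"
        using c w by (simp add: \<psi>'_def functional_add[OF \<psi>] s_add R.r_distr)
    next
      fix a w assume w: "a \<in> carrier R" "w \<in> carrier M"
      note c = w(1) scl[OF w(2)] \<psi>cl[OF w(2)] U
      have "a \<otimes> \<psi> w \<ominus> a \<otimes> s w = a \<otimes> (\<psi> w \<ominus> s w)"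
        using c by (simp add: R.minus_eq R.r_distr R.r_minus)
      then show "\<psi>' (a \<odot>\<^bsub>M\<^esub> w) = a \<otimes> \<psi>' w"
        using c w by (simp add: \<psi>'_def functional_smult[OF \<psi>] s_smult R.m_lcomm)
    qed
    have "s z' = \<zero>" unfolding s_def
      by (rule R.add.finprod_one_eqI) (use \<phi>z' x \<psi>cl in auto)
    then have \<psi>'z': "\<psi>' z' = \<one>" using U u(1) by (simp add: \<psi>'_def u_def[symmetric] R.minus_eq)
    have \<psi>'x: "\<psi>' (x j) = \<zero>" if "j < r" for j
    proof -
      have "s (x j) = (\<Oplus>i\<in>{..<r}. if j = i then \<psi> (x i) else \<zero>)" unfolding s_def
        by (rule R.finsum_cong') (use that x \<psi>cl d in auto)
      also have "\<dots> = \<psi> (x j)" by (rule R.finsum_singleton) (use that x \<psi>cl in auto)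
      finally show ?thesis using U x[OF that] \<psi>cl by (simp add: \<psi>'_def R.minus_eq R.r_neg)
    qed
    have "dual_system R M (Suc r) (x(r := z')) (\<phi>(r := \<psi>'))"
      using x l d \<psi>' z' \<psi>'x \<psi>'z' \<phi>z' by (auto simp: dual_system_def less_Suc_eq)
    then show False using max by blast
  qed
  have "\<epsilon> (\<psi> z) = \<epsilon> (u \<oplus> s z)"
    using u scl[OF z] \<psi>cl[OF z] by (simp add: R.minus_eq R.a_assoc R.l_neg)
  also have "\<dots> = \<epsilon> (s z)" using u scl[OF z] \<epsilon>u by simp
  also have "\<dots> = (\<Oplus>\<^bsub>K\<^esub>l\<in>{..<r}. \<epsilon> (\<psi> (x l)) \<otimes>\<^bsub>K\<^esub> \<epsilon> (\<phi> l z))"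
    unfolding s_def
    by (subst \<epsilon>.hom_finsum) (use x lcl \<psi>cl z in \<open>auto intro!: K.finsum_cong'\<close>)
  finally show ?thesis .
qed

end

context power_series_char_p
begin

lemma monom_frobenius:
  assumes "a \<in> carrier R" "b \<in> carrier R" "set_mset d \<subseteq> I"
  shows "monom_series R (a [^] (p ^ e) \<otimes> b) d
    = const_series R a [^]\<^bsub>PS\<^esub> (p ^ e) \<otimes>\<^bsub>PS\<^esub> monom_series R b d"
  unfolding const_series_eq_monom using assms
  by (subst monom_pow) (auto simp: monom_mult)

lemma variable_frobenius:
  assumes "v \<in> I"
  shows "monom_series R \<one> (replicate_mset (p ^ e) v) = monom_series R \<one> {#v#} [^]\<^bsub>PS\<^esub> (p ^ e)"
  using assms by (subst monom_pow) auto

text \<open>Every exponent vector is uniquely q \<gamma> + \<alpha> with \<alpha> in the box. For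
  each \<alpha>, the coefficients at q \<gamma> + \<alpha> form a slice of the series, and each
  slice behaves like a series with coefficients in the pushforward of R. A dual system of R applied
  on each slice separately gives the longer one.\<close>

lemma dual_system_lift:
  assumes fin: "finite I" and D: "frobenius_dual_system p e R r x \<phi>"
  shows "\<exists>x \<phi>. frobenius_dual_system p e PS ((p ^ e) ^ card I * r) x \<phi>"
proof -
  let ?q = "p ^ e"
  let ?B = "monomial_box ?q I"
  let ?M = "frobenius_pushforward p e R"
  interpret M: module R ?M by (rule frobenius_pushforward_module)
  interpret P: module PS "frobenius_pushforward p e PS" by (rule PS.frobenius_pushforward_module)
  have x: "\<And>i. i < r \<Longrightarrow> x i \<in> carrier R"
    and l: "\<And>i. i < r \<Longrightarrow> linear_functional R ?M (\<phi> i)"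
    and d: "\<And>i j. i < r \<Longrightarrow> j < r \<Longrightarrow> \<phi> i (x j) = (if i = j then \<one> else \<zero>)"
    using D by (auto simp: dual_system_def frobenius_dual_system_def frobenius_pushforward_def)
  have lcl: "\<phi> i z \<in> carrier R" if "i < r" "z \<in> carrier R" for i z
    using l[OF that(1)] that(2) by (auto simp: linear_functional_frobenius_iff)
  have ladd: "\<phi> i (z \<oplus> z') = \<phi> i z \<oplus> \<phi> i z'" if "i < r" "z \<in> carrier R" "z' \<in> carrier R" for i z z'
    using l[OF that(1)] that(2,3) by (auto simp: linear_functional_frobenius_iff)
  have lsm: "\<phi> i (a [^] ?q \<otimes> z) = a \<otimes> \<phi> i z" if "i < r" "a \<in> carrier R" "z \<in> carrier R" for i a z
    using l[OF that(1)] that(2,3) by (auto simp: linear_functional_frobenius_iff)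
  have lzero: "\<phi> i \<zero> = \<zero>" if "i < r" for i
    using lsm[OF that, of \<zero> \<zero>] lcl[OF that, of \<zero>] by simp
  \<comment> \<open>For t = (\<alpha>, i), the functional applies \<open>\<phi> i\<close> to every
    coefficient of the slice of z belonging to \<alpha>; the dual element \<open>W t\<close> places
    x i at the monomial \<alpha>.\<close>
  define \<Phi> where "\<Phi> t z \<gamma> = \<phi> (snd t) (z (repeat_mset ?q \<gamma> + fst t))" for t :: "'v multiset \<times> nat" and z \<gamma>
  define W where "W t = monom_series R (x (snd t)) (fst t)" for t :: "'v multiset \<times> nat"
  let ?T = "?B \<times> {..<r}"
  have Wc: "W t \<in> carrier PS" if "t \<in> ?T" for t
    using that x by (auto simp: W_def monomial_box_def)
  have \<Phi>c: "\<Phi> t z \<in> carrier PS" if t: "t \<in> ?T" and z: "z \<in> carrier PS" for t z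
  proof (rule ps_carrierI)
    fix m assume "\<not> set_mset m \<subseteq> I"
    then obtain v where v: "v \<in># m" "v \<notin> I" by blast
    then have "count (repeat_mset ?q m) v > 0" by simp
    then have "v \<in># repeat_mset ?q m" by (simp only: count_greater_zero_iff)
    then have "\<not> set_mset (repeat_mset ?q m + fst t) \<subseteq> I" using v(2) by auto
    then have "z (repeat_mset ?q m + fst t) = \<zero>" by (rule ps_coeff_outside[OF z])
    then show "\<Phi> t z m = \<zero>" using t lzero by (auto simp: \<Phi>_def)
  qed (use t z lcl in \<open>auto simp: \<Phi>_def\<close>)
  \<comment> \<open>Because the exponents of \<alpha> are below q, a multiple q d divides q \<gamma>
    + \<alpha> exactly when d divides \<gamma>. Hence the convolution with a q-th power restricts to
    the ordinary convolution on each slice, which is linearity of \<open>\<Phi> t\<close> over the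
    power series ring.\<close>
  have sub: "repeat_mset ?q d \<subseteq># repeat_mset ?q \<gamma> + \<alpha> \<longleftrightarrow> d \<subseteq># \<gamma>" if "\<alpha> \<in> ?B" for d \<gamma> \<alpha> :: "'v multiset"
  proof -
    have "?q * a \<le> ?q * b + c \<longleftrightarrow> a \<le> b" if "c < ?q" for a b c :: nat
    proof
      assume "?q * a \<le> ?q * b + c"
      then have "?q * a < ?q * Suc b" using that by simp
      then show "a \<le> b" by (simp only: mult_less_cancel1 less_Suc_eq_le)
    next
      assume "a \<le> b"
      then show "?q * a \<le> ?q * b + c" by (meson mult_le_mono2 trans_le_add1)
    qed
    then show ?thesis using that by (simp add: subseteq_mset_def monomial_box_def)
  qed
  have diff: "repeat_mset ?q \<gamma> + \<alpha> - repeat_mset ?q d = repeat_mset ?q (\<gamma> - d) + \<alpha>" if "d \<subseteq># \<gamma>" for d \<gamma> \<alpha> :: "'v multiset"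
    using that by (auto simp: multiset_eq_iff subseteq_mset_def diff_mult_distrib2)
  have lin: "linear_functional PS (frobenius_pushforward p e PS) (\<Phi> t)" if t: "t \<in> ?T" for t
    unfolding linear_functional_frobenius_iff
  proof (intro conjI ballI Pi_I)
    show "\<Phi> t z \<in> carrier PS" if "z \<in> carrier PS" for z using \<Phi>c[OF t that] .
    show "\<Phi> t (z \<oplus>\<^bsub>PS\<^esub> z') = \<Phi> t z \<oplus>\<^bsub>PS\<^esub> \<Phi> t z'" if "z \<in> carrier PS" "z' \<in> carrier PS" for z z'
      using t that by (intro ext) (auto simp: \<Phi>_def ps_add ladd)
    fix b z assume b: "b \<in> carrier PS" and z: "z \<in> carrier PS"
    show "\<Phi> t (b [^]\<^bsub>PS\<^esub> ?q \<otimes>\<^bsub>PS\<^esub> z) = b \<otimes>\<^bsub>PS\<^esub> \<Phi> t z"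
    proof
      fix \<gamma>
      obtain \<alpha> i where ti: "t = (\<alpha>, i)" "\<alpha> \<in> ?B" "i < r" using t by auto
      have "\<Phi> t (b [^]\<^bsub>PS\<^esub> ?q \<otimes>\<^bsub>PS\<^esub> z) \<gamma>
          = \<phi> i (\<Oplus>d\<in>{d. d \<subseteq># \<gamma>}. b d [^] ?q \<otimes> z (repeat_mset ?q \<gamma> + \<alpha> - repeat_mset ?q d))"
        unfolding \<Phi>_def ti ps_frobenius_mult_coeff[OF b z] by (simp add: sub[OF ti(2)])
      also have "\<dots> = (\<Oplus>d\<in>{d. d \<subseteq># \<gamma>}. \<phi> i (b d [^] ?q \<otimes> z (repeat_mset ?q \<gamma> + \<alpha> - repeat_mset ?q d)))"
        by (rule additive_map_finsum[OF is_abelian_group is_abelian_group])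
          (use ti lcl ladd b z in auto)
      also have "\<dots> = (\<Oplus>d\<in>{d. d \<subseteq># \<gamma>}. b d \<otimes> \<Phi> t z (\<gamma> - d))"
        by (rule finsum_cong') (use ti lcl lsm b z in \<open>auto simp: \<Phi>_def diff\<close>)
      finally show "\<Phi> t (b [^]\<^bsub>PS\<^esub> ?q \<otimes>\<^bsub>PS\<^esub> z) \<gamma> = (b \<otimes>\<^bsub>PS\<^esub> \<Phi> t z) \<gamma>"
        by (simp add: ps_mult)
    qed
  qed
  have dual: "\<Phi> t (W t') = (if t = t' then \<one>\<^bsub>PS\<^esub> else \<zero>\<^bsub>PS\<^esub>)" if t: "t \<in> ?T" "t' \<in> ?T" for t t'
  proof
    fix \<gamma>
    obtain \<alpha> i \<beta> j where ti: "t = (\<alpha>, i)" "t' = (\<beta>, j)" "\<alpha> \<in> ?B" "\<beta> \<in> ?B" "i < r" "j < r"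
      using t by auto
    \<comment> \<open>Uniqueness of division with remainder by q: \<beta> has exponents below q, so
      its quotient part \<gamma> is empty.\<close>
    have iff: "repeat_mset ?q \<gamma> + \<alpha> = \<beta> \<longleftrightarrow> \<gamma> = {#} \<and> \<alpha> = \<beta>"
    proof
      assume eq: "repeat_mset ?q \<gamma> + \<alpha> = \<beta>"
      have "count \<gamma> v = 0" for v
      proof (rule ccontr)
        assume "count \<gamma> v \<noteq> 0"
        then have "?q \<le> count \<beta> v" unfolding eq[symmetric] by (cases "count \<gamma> v") auto
        then show False using ti(4) by (auto simp: monomial_box_def dest: leD)
      qed
      then have "\<gamma> = {#}" by (auto simp: multiset_eq_iff)
      then show "\<gamma> = {#} \<and> \<alpha> = \<beta>" using eq by simp
    qed auto
    show "\<Phi> t (W t') \<gamma> = (if t = t' then \<one>\<^bsub>PS\<^esub> else \<zero>\<^bsub>PS\<^esub>) \<gamma>"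
      using ti d[of i j] lzero[of i] iff by (auto simp: \<Phi>_def W_def monom_series_def ps_one ps_zero)
  qed
  have finB: "finite ?B" "card ?B = ?q ^ card I" using card_monomial_box[OF fin, of ?q] by auto
  have "\<exists>x \<phi>. dual_system PS (frobenius_pushforward p e PS) (card ?T) x \<phi>"
    by (rule P.dual_system_of_family[of ?T W \<Phi>])
      (use finB Wc lin dual in \<open>auto simp: frobenius_pushforward_def\<close>)
  then show ?thesis using finB by (simp add: frobenius_dual_system_def card_cartesian_product)
qed

text \<open>Reduction of the pairing matrix to the residue field turns it into the identity matrix
  of size s. Only the box coefficients of each Z j survive this reduction, and on each of them
  \<open>maximal_dual_system_pairing\<close> writes the pairing as an inner product of length r. The
  identity thus factors through q^|I| r coordinates.\<close>

lemma dual_system_bound: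
  assumes fin: "finite I" and K: "field K" and \<epsilon>: "\<epsilon> \<in> ring_hom R K"
    and unit: "\<And>a. a \<in> carrier R \<Longrightarrow> \<epsilon> a \<noteq> \<zero>\<^bsub>K\<^esub> \<Longrightarrow> a \<in> Units R"
    and D: "frobenius_dual_system p e R r x \<phi>"
    and max: "\<not> (\<exists>x \<phi>. frobenius_dual_system p e R (Suc r) x \<phi>)"
    and E: "frobenius_dual_system p e PS s Z \<Psi>"
  shows "s \<le> (p ^ e) ^ card I * r"
proof -
  let ?q = "p ^ e"
  let ?B = "monomial_box ?q I"
  let ?M = "frobenius_pushforward p e R"
  interpret M: module R ?M by (rule frobenius_pushforward_module)
  interpret K: field K by (rule K)
  interpret \<epsilon>: ring_hom_cring R K \<epsilon> by unfold_locales (rule \<epsilon>)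
  have x: "\<And>i. i < r \<Longrightarrow> x i \<in> carrier R"
    and l: "\<And>i. i < r \<Longrightarrow> linear_functional R ?M (\<phi> i)"
    using D by (auto simp: dual_system_def frobenius_dual_system_def frobenius_pushforward_def)
  have lcl: "\<phi> i z \<in> carrier R" if "i < r" "z \<in> carrier R" for i z
    using l[OF that(1)] that(2) by (auto simp: linear_functional_frobenius_iff)
  have Z: "\<And>i. i < s \<Longrightarrow> Z i \<in> carrier PS"
    and L: "\<And>i. i < s \<Longrightarrow> linear_functional PS (frobenius_pushforward p e PS) (\<Psi> i)"
    and d: "\<And>i j. i < s \<Longrightarrow> j < s \<Longrightarrow> \<Psi> i (Z j) = (if i = j then \<one>\<^bsub>PS\<^esub> else \<zero>\<^bsub>PS\<^esub>)"
    using E by (auto simp: dual_system_def frobenius_dual_system_def frobenius_pushforward_def)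
  have Lcl: "\<Psi> i z \<in> carrier PS" if "i < s" "z \<in> carrier PS" for i z
    using L[OF that(1)] that(2) by (auto simp: linear_functional_frobenius_iff)
  have Ladd: "\<Psi> i (z \<oplus>\<^bsub>PS\<^esub> z') = \<Psi> i z \<oplus>\<^bsub>PS\<^esub> \<Psi> i z'" if "i < s" "z \<in> carrier PS" "z' \<in> carrier PS" for i z z'
    using L[OF that(1)] that(2,3) by (auto simp: linear_functional_frobenius_iff)
  have Lsm: "\<Psi> i (a [^]\<^bsub>PS\<^esub> ?q \<otimes>\<^bsub>PS\<^esub> z) = a \<otimes>\<^bsub>PS\<^esub> \<Psi> i z" if "i < s" "a \<in> carrier PS" "z \<in> carrier PS" for i a z
    using L[OF that(1)] that(2,3) by (auto simp: linear_functional_frobenius_iff)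
  \<comment> \<open>Restriction of \<open>\<Psi> i\<close> to the monomials with exponent \<alpha>,
    followed by the constant coefficient. Linearity over R holds because the q-th power of a
    constant series is pulled out of \<open>\<Psi> i\<close> as that constant.\<close>
  define \<psi> where "\<psi> i \<alpha> z = \<Psi> i (monom_series R z \<alpha>) {#}" for i \<alpha> z
  have \<psi>: "linear_functional R ?M (\<psi> i \<alpha>)" if i: "i < s" and \<alpha>: "\<alpha> \<in> ?B" for i \<alpha>
    unfolding linear_functional_frobenius_iff
  proof (intro conjI ballI Pi_I)
    have \<alpha>': "set_mset \<alpha> \<subseteq> I" using \<alpha> by (simp add: monomial_box_def)
    show "\<psi> i \<alpha> z \<in> carrier R" if "z \<in> carrier R" for z
      unfolding \<psi>_def using Lcl[OF i monom_closed[OF that \<alpha>']] by blast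
    show "\<psi> i \<alpha> (z \<oplus> z') = \<psi> i \<alpha> z \<oplus> \<psi> i \<alpha> z'" if "z \<in> carrier R" "z' \<in> carrier R" for z z'
    proof -
      have "monom_series R (z \<oplus> z') \<alpha> = monom_series R z \<alpha> \<oplus>\<^bsub>PS\<^esub> monom_series R z' \<alpha>"
        using that by (intro ext) (auto simp: monom_series_def ps_add)
      then show ?thesis
        unfolding \<psi>_def using Ladd[OF i monom_closed[OF that(1) \<alpha>'] monom_closed[OF that(2) \<alpha>']]
        by (simp add: ps_add)
    qed
    fix a z assume a: "a \<in> carrier R" and z: "z \<in> carrier R"
    have c: "const_series R a \<in> carrier PS" using a by (auto simp: const_series_eq_monom)
    show "\<psi> i \<alpha> (a [^] ?q \<otimes> z) = a \<otimes> \<psi> i \<alpha> z"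
      unfolding \<psi>_def monom_frobenius[OF a z \<alpha>'] Lsm[OF i c monom_closed[OF z \<alpha>']]
      using ring_hom_mult[OF coeff0_hom c Lcl[OF i monom_closed[OF z \<alpha>']]]
      by (simp add: const_series_def)
  qed
  define \<theta> where "\<theta> i z = \<epsilon> (\<Psi> i z {#})" for i z
  have expand: "\<theta> i (Z j) = (\<Oplus>\<^bsub>K\<^esub>t\<in>?B \<times> {..<r}. \<epsilon> (\<psi> i (fst t) (x (snd t))) \<otimes>\<^bsub>K\<^esub> \<epsilon> (\<phi> (snd t) (Z j (fst t))))"
    if i: "i < s" and j: "j < s" for i j
  proof -
    have "\<theta> i (Z j) = (\<Oplus>\<^bsub>K\<^esub>\<alpha>\<in>?B. \<theta> i (monom_series R (Z j \<alpha>) \<alpha>))"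
    proof (rule vanishing_on_box[OF fin _ K.is_abelian_group])
      show "\<theta> i \<in> carrier PS \<rightarrow> carrier K" using Lcl[OF i] by (auto simp: \<theta>_def)
      show "\<theta> i (f \<oplus>\<^bsub>PS\<^esub> g) = \<theta> i f \<oplus>\<^bsub>K\<^esub> \<theta> i g" if "f \<in> carrier PS" "g \<in> carrier PS" for f g
        using Ladd[OF i that] Lcl[OF i that(1)] Lcl[OF i that(2)] by (simp add: \<theta>_def ps_add)
      fix v g assume v: "v \<in> I" and g: "g \<in> carrier PS"
      have vc: "monom_series R \<one> {#v#} \<in> carrier PS" using v by auto
      \<comment> \<open>The q-th power of the variable leaves \<open>\<Psi> i\<close> as the
        variable itself, which has no constant term.\<close>
      have "\<theta> i (monom_series R \<one> (replicate_mset ?q v) \<otimes>\<^bsub>PS\<^esub> g)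
          = \<epsilon> ((monom_series R \<one> {#v#} \<otimes>\<^bsub>PS\<^esub> \<Psi> i g) {#})"
        unfolding \<theta>_def variable_frobenius[OF v] Lsm[OF i vc g] ..
      also have "\<dots> = \<epsilon> \<zero>" using Lcl[OF i g] by (subst monom_mult_coeff) auto
      finally show "\<theta> i (monom_series R \<one> (replicate_mset ?q v) \<otimes>\<^bsub>PS\<^esub> g) = \<zero>\<^bsub>K\<^esub>" by simp
    qed (use Z[OF j] in auto)
    also have "\<dots> = (\<Oplus>\<^bsub>K\<^esub>\<alpha>\<in>?B. \<Oplus>\<^bsub>K\<^esub>l\<in>{..<r}. \<epsilon> (\<psi> i \<alpha> (x l)) \<otimes>\<^bsub>K\<^esub> \<epsilon> (\<phi> l (Z j \<alpha>)))"
    proof (rule K.finsum_cong')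
      fix \<alpha> assume \<alpha>: "\<alpha> \<in> ?B"
      have "\<theta> i (monom_series R (Z j \<alpha>) \<alpha>) = \<epsilon> (\<psi> i \<alpha> (Z j \<alpha>))" by (simp add: \<theta>_def \<psi>_def)
      also have "\<dots> = (\<Oplus>\<^bsub>K\<^esub>l\<in>{..<r}. \<epsilon> (\<psi> i \<alpha> (x l)) \<otimes>\<^bsub>K\<^esub> \<epsilon> (\<phi> l (Z j \<alpha>)))"
        by (rule M.maximal_dual_system_pairing[OF K \<epsilon> unit D[unfolded frobenius_dual_system_def]
              max[unfolded frobenius_dual_system_def] \<psi>[OF i \<alpha>]])
          (use Z[OF j] in \<open>auto simp: frobenius_pushforward_def\<close>)
      finally show "\<theta> i (monom_series R (Z j \<alpha>) \<alpha>) = \<dots>" .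
    next
      show "(\<lambda>\<alpha>. \<Oplus>\<^bsub>K\<^esub>l\<in>{..<r}. \<epsilon> (\<psi> i \<alpha> (x l)) \<otimes>\<^bsub>K\<^esub> \<epsilon> (\<phi> l (Z j \<alpha>))) \<in> ?B \<rightarrow> carrier K"
        using \<psi>[OF i] x lcl Z[OF j]
        by (auto simp: linear_functional_frobenius_iff Pi_iff intro!: K.finsum_closed)
    qed simp
    also have "\<dots> = (\<Oplus>\<^bsub>K\<^esub>t\<in>?B \<times> {..<r}. \<epsilon> (\<psi> i (fst t) (x (snd t))) \<otimes>\<^bsub>K\<^esub> \<epsilon> (\<phi> (snd t) (Z j (fst t))))"
      by (rule K.finsum_Sigma)
        (use \<psi>[OF i] x lcl Z[OF j] card_monomial_box[OF fin, of ?q] in \<open>auto simp: linear_functional_frobenius_iff Pi_iff\<close>)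
    finally show ?thesis .
  qed
  have finB: "finite ?B" "card ?B = ?q ^ card I" using card_monomial_box[OF fin, of ?q] by auto
  have "card {..<s} \<le> card (?B \<times> {..<r})"
  proof (rule K.identity_factor_card)
    fix i j assume ij: "i \<in> {..<s}" "j \<in> {..<s}"
    have "\<theta> i (Z j) = (if i = j then \<one>\<^bsub>K\<^esub> else \<zero>\<^bsub>K\<^esub>)"
      using ij d[of i j] by (auto simp: \<theta>_def ps_one ps_zero monom_series_def)
    then show "(\<Oplus>\<^bsub>K\<^esub>t\<in>?B \<times> {..<r}. \<epsilon> (\<psi> i (fst t) (x (snd t))) \<otimes>\<^bsub>K\<^esub> \<epsilon> (\<phi> (snd t) (Z j (fst t))))
        = (if i = j then \<one>\<^bsub>K\<^esub> else \<zero>\<^bsub>K\<^esub>)"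
      using expand[of i j] ij by simp
  qed (use finB \<psi> x lcl Z in \<open>auto simp: linear_functional_frobenius_iff Pi_iff\<close>)
  then show ?thesis using finB by (simp add: card_cartesian_product)
qed

text \<open>The hypothesis \<open>bound\<close> makes the \<open>GREATEST\<close> for R an attained
  maximum a. Then a system of length a exists, which can be lifted, and none of length a + 1 exists,
  which is what the upper bound asks for.\<close>

theorem frobenius_free_rank_power_series:
  assumes fin: "finite I" and K: "field K" and \<epsilon>: "\<epsilon> \<in> ring_hom R K"
    and unit: "\<And>a. a \<in> carrier R \<Longrightarrow> \<epsilon> a \<noteq> \<zero>\<^bsub>K\<^esub> \<Longrightarrow> a \<in> Units R"
    and bound: "\<And>r x \<phi>. frobenius_dual_system p e R r x \<phi> \<Longrightarrow> r \<le> b"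
  shows "frobenius_free_rank p PS e = (p ^ e) ^ card I * frobenius_free_rank p R e"
proof -
  define a where "a = (GREATEST r. \<exists>x \<phi>. frobenius_dual_system p e R r x \<phi>)"
  have 0: "\<exists>x \<phi>. frobenius_dual_system p e R 0 x \<phi>"
    by (simp add: frobenius_dual_system_def dual_system_def)
  have a: "\<exists>x \<phi>. frobenius_dual_system p e R a x \<phi>"
    unfolding a_def by (rule GreatestI_nat[of _ 0 b]) (use 0 bound in blast)+
  have max: "\<not> (\<exists>x \<phi>. frobenius_dual_system p e R (Suc a) x \<phi>)"
  proof
    assume "\<exists>x \<phi>. frobenius_dual_system p e R (Suc a) x \<phi>"
    then have "Suc a \<le> a" unfolding a_def by (rule Greatest_le_nat[of _ _ b]) (use bound in blast)
    then show False by simp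
  qed
  have "(GREATEST r. \<exists>x \<phi>. frobenius_dual_system p e PS r x \<phi>) = (p ^ e) ^ card I * a"
  proof (rule Greatest_equality)
    show "\<exists>x \<phi>. frobenius_dual_system p e PS ((p ^ e) ^ card I * a) x \<phi>"
      using a dual_system_lift[OF fin] by auto
    show "s \<le> (p ^ e) ^ card I * a" if "\<exists>x \<phi>. frobenius_dual_system p e PS s x \<phi>" for s
      using that a dual_system_bound[OF fin K \<epsilon> unit _ max] by blast
  qed
  then show ?thesis
    unfolding PS.frobenius_free_rank_eq frobenius_free_rank_eq a_def .
qed

end

section \<open>Generators over p-th powers and boundedness of the ranks\<close>

lemma (in ring) dimension_generators:
  assumes "dimension n F E" "F \<subseteq> carrier R"
  shows "\<exists>w. (\<forall>l<n. w l \<in> carrier R) \<and>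
    (\<forall>c\<in>E. \<exists>\<beta>. (\<forall>l<n. \<beta> l \<in> F) \<and> c = (\<Oplus>l\<in>{..<n}. \<beta> l \<otimes> w l))"
  using assms
proof (induction rule: dimension.induct)
  case (Suc_dim v E n F)
  then obtain w where w: "\<forall>l<n. w l \<in> carrier R"
    "\<forall>c\<in>E. \<exists>\<beta>. (\<forall>l<n. \<beta> l \<in> F) \<and> c = (\<Oplus>l\<in>{..<n}. \<beta> l \<otimes> w l)" by blast
  have "\<exists>\<beta>. (\<forall>l<Suc n. \<beta> l \<in> F) \<and> c = (\<Oplus>l\<in>{..<Suc n}. \<beta> l \<otimes> (w(n := v)) l)"
    if "c \<in> line_extension F v E" for c
  proof -
    obtain k u where k: "k \<in> F" "u \<in> E" "c = k \<otimes> v \<oplus> u"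
      using \<open>c \<in> _\<close> unfolding line_extension_mem_iff by blast
    obtain \<beta> where \<beta>: "\<forall>l<n. \<beta> l \<in> F" "u = (\<Oplus>l\<in>{..<n}. \<beta> l \<otimes> w l)" using w(2) k(2) by blast
    have "(\<Oplus>l\<in>{..<Suc n}. (\<beta>(n := k)) l \<otimes> (w(n := v)) l)
        = k \<otimes> v \<oplus> (\<Oplus>l\<in>{..<n}. (\<beta>(n := k)) l \<otimes> (w(n := v)) l)"
      unfolding lessThan_Suc
      by (subst finsum_insert) (use \<beta> w k Suc_dim in \<open>auto simp: Pi_iff subset_iff\<close>)
    also have "(\<Oplus>l\<in>{..<n}. (\<beta>(n := k)) l \<otimes> (w(n := v)) l) = u"
      unfolding \<beta>(2) by (rule finsum_cong') (use \<beta> w Suc_dim in \<open>auto simp: Pi_iff subset_iff\<close>)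
    finally have "c = (\<Oplus>l\<in>{..<Suc n}. (\<beta>(n := k)) l \<otimes> (w(n := v)) l)" using k by simp
    moreover have "\<forall>l<Suc n. (\<beta>(n := k)) l \<in> F" using \<beta> k by (simp add: less_Suc_eq)
    ultimately show ?thesis by blast
  qed
  then show ?case using w Suc_dim by (intro exI[of _ "w(n := v)"]) (simp add: less_Suc_eq)
qed auto

context cring_char_p
begin

text \<open>Generators over the p-th powers are iterated: an element is expanded over p-th powers,
  each coefficient base over p^e-th powers, and the inner expansion is raised to the power p. Words
  as indices let the induction lengthen the index without changing its type.\<close>

lemma frobenius_generators:
  assumes "finite_dimension (pth_powers p R) (carrier R)"
  shows "\<exists>(T :: nat list set) w. finite T \<and> w \<in> T \<rightarrow> carrier R \<and>
    (\<forall>c\<in>carrier R. \<exists>\<beta>\<in>T \<rightarrow> carrier R. c = (\<Oplus>t\<in>T. \<beta> t [^] (p ^ e) \<otimes> w t))"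
proof -
  have sub: "pth_powers p R \<subseteq> carrier R" by (auto simp: pth_powers_def)
  obtain n where n: "dimension n (pth_powers p R) (carrier R)"
    using assms unfolding finite_dimension_def by blast
  obtain w where w: "\<And>l. l < n \<Longrightarrow> w l \<in> carrier R"
    and wex: "\<And>c. c \<in> carrier R \<Longrightarrow> \<exists>\<beta>. (\<forall>l<n. \<beta> l \<in> pth_powers p R) \<and> c = (\<Oplus>l\<in>{..<n}. \<beta> l \<otimes> w l)"
    using dimension_generators[OF n sub] by blast
  have gen: "\<exists>\<beta>. (\<forall>l<n. \<beta> l \<in> carrier R) \<and> c = (\<Oplus>l\<in>{..<n}. \<beta> l [^] p \<otimes> w l)" if "c \<in> carrier R" for c
  proof -
    obtain \<gamma> where \<gamma>: "\<forall>l<n. \<gamma> l \<in> pth_powers p R" "c = (\<Oplus>l\<in>{..<n}. \<gamma> l \<otimes> w l)"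
      using wex \<open>c \<in> carrier R\<close> by blast
    then have "\<forall>l<n. \<exists>b. b \<in> carrier R \<and> \<gamma> l = b [^] p" by (auto simp: pth_powers_def)
    then obtain \<beta> where \<beta>: "\<And>l. l < n \<Longrightarrow> \<beta> l \<in> carrier R \<and> \<gamma> l = \<beta> l [^] p" by metis
    have "c = (\<Oplus>l\<in>{..<n}. \<beta> l [^] p \<otimes> w l)" unfolding \<gamma>(2)
      by (rule finsum_cong') (use \<beta> w in auto)
    then show ?thesis using \<beta> by blast
  qed
  show ?thesis
  proof (induction e)
    case 0
    show ?case
      by (rule exI[of _ "{[]}"], rule exI[of _ "\<lambda>_. \<one>"])
        (auto intro!: bexI[of _ "\<lambda>_. c" for c])
  next
    case (Suc e)
    then obtain T :: "nat list set" and v where T: "finite T" "v \<in> T \<rightarrow> carrier R"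
      and ex: "\<And>c. c \<in> carrier R \<Longrightarrow> \<exists>\<beta>\<in>T \<rightarrow> carrier R. c = (\<Oplus>t\<in>T. \<beta> t [^] (p ^ e) \<otimes> v t)"
      by blast
    \<comment> \<open>The word [l1, ..., le] indexes the product of w l1, the p-th power of w l2,
      and so on up to the p^(e-1)-th power of w le; the empty word indexes one.\<close>
    define T' where "T' = (\<lambda>(l, t). l # t) ` ({..<n} \<times> T)"
    define v' where "v' t = v (tl t) [^] p \<otimes> w (hd t)" for t
    have "\<exists>\<beta>\<in>T' \<rightarrow> carrier R. c = (\<Oplus>t\<in>T'. \<beta> t [^] (p ^ Suc e) \<otimes> v' t)" if c: "c \<in> carrier R" for c
    proof -
      obtain \<beta> where \<beta>: "\<And>l. l < n \<Longrightarrow> \<beta> l \<in> carrier R" "c = (\<Oplus>l\<in>{..<n}. \<beta> l [^] p \<otimes> w l)"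
        using gen[OF c] by blast
      have "\<forall>l<n. \<exists>\<gamma>\<in>T \<rightarrow> carrier R. \<beta> l = (\<Oplus>t\<in>T. \<gamma> t [^] (p ^ e) \<otimes> v t)" using ex \<beta>(1) by blast
      then obtain \<gamma> where \<gamma>: "\<And>l. l < n \<Longrightarrow> \<gamma> l \<in> T \<rightarrow> carrier R"
        "\<And>l. l < n \<Longrightarrow> \<beta> l = (\<Oplus>t\<in>T. \<gamma> l t [^] (p ^ e) \<otimes> v t)" by metis
      have cl: "\<gamma> l t \<in> carrier R" "v t \<in> carrier R" "w l \<in> carrier R" if "l < n" "t \<in> T" for l t
        using \<gamma>(1) T w that by auto
      have "c = (\<Oplus>l\<in>{..<n}. \<Oplus>t\<in>T. \<gamma> l t [^] (p ^ Suc e) \<otimes> (v t [^] p \<otimes> w l))"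
        unfolding \<beta>(2)
      proof (rule finsum_cong')
        fix l assume "l \<in> {..<n}"
        then have l: "l < n" by simp
        have "\<beta> l [^] p = (\<Oplus>t\<in>T. (\<gamma> l t [^] (p ^ e) \<otimes> v t) [^] p)"
          unfolding \<gamma>(2)[OF l] using frobenius_finsum[of "\<lambda>t. \<gamma> l t [^] (p ^ e) \<otimes> v t" T 1] cl[OF l] by simp
        also have "\<dots> = (\<Oplus>t\<in>T. \<gamma> l t [^] (p ^ Suc e) \<otimes> v t [^] p)"
          by (rule finsum_cong') (use cl[OF l] in \<open>auto simp: nat_pow_distrib nat_pow_pow mult.commute\<close>)
        finally have "\<beta> l [^] p \<otimes> w l = (\<Oplus>t\<in>T. \<gamma> l t [^] (p ^ Suc e) \<otimes> v t [^] p \<otimes> w l)"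
          using finsum_ldistr[OF T(1) w[OF l], of "\<lambda>t. \<gamma> l t [^] (p ^ Suc e) \<otimes> v t [^] p"] cl[OF l] by auto
        also have "\<dots> = (\<Oplus>t\<in>T. \<gamma> l t [^] (p ^ Suc e) \<otimes> (v t [^] p \<otimes> w l))"
          by (rule finsum_cong') (use cl[OF l] in \<open>auto simp: m_assoc\<close>)
        finally show "\<beta> l [^] p \<otimes> w l = \<dots>" .
      qed (use cl in \<open>auto intro!: finsum_closed\<close>)
      also have "\<dots> = (\<Oplus>z\<in>{..<n} \<times> T. \<gamma> (fst z) (snd z) [^] (p ^ Suc e) \<otimes> (v (snd z) [^] p \<otimes> w (fst z)))"
        by (rule finsum_Sigma) (use T cl in auto)
      also have "\<dots> = (\<Oplus>t\<in>T'. \<gamma> (hd t) (tl t) [^] (p ^ Suc e) \<otimes> v' t)"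
        by (rule finsum_reindex_bij[where h = "\<lambda>(l, t). l # t"])
          (use cl in \<open>auto simp: T'_def v'_def bij_betw_def inj_on_def\<close>)
      finally show ?thesis
        by (intro bexI[of _ "\<lambda>t. \<gamma> (hd t) (tl t)"]) (use cl in \<open>auto simp: T'_def\<close>)
    qed
    moreover have "finite T'" "v' \<in> T' \<rightarrow> carrier R" using T w by (auto simp: T'_def v'_def Pi_iff)
    ultimately show ?case by blast
  qed
qed

end

context power_series_char_p
begin

text \<open>A crude bound on the rank of the quotient A, for use as the hypothesis
  \<open>bound\<close> above. The identity matrix is factored as in
  \<open>dual_system_bound\<close>, with generators of the field over its q-th powers in place of a
  maximal dual system, after lifting the elements x j to power series.\<close>

lemma dual_system_quotient_bound:
  assumes K: "field R" and fin: "finite I" and A: "cring_char_p A p"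
    and \<pi>: "\<pi> \<in> ring_hom PS A" and surj: "\<pi> ` carrier PS = carrier A"
    and \<epsilon>: "\<epsilon> \<in> ring_hom A R" and \<epsilon>\<pi>: "\<And>f. f \<in> carrier PS \<Longrightarrow> \<epsilon> (\<pi> f) = f {#}"
    and T: "finite T" "w \<in> T \<rightarrow> carrier R"
    and gen: "\<And>c. c \<in> carrier R \<Longrightarrow> \<exists>\<beta>\<in>T \<rightarrow> carrier R. c = (\<Oplus>t\<in>T. \<beta> t [^] (p ^ e) \<otimes> w t)"
    and D: "frobenius_dual_system p e A r x \<phi>"
  shows "r \<le> (p ^ e) ^ card I * card T"
proof -
  let ?q = "p ^ e"
  let ?B = "monomial_box ?q I"
  interpret K: field R by (rule K)
  interpret A: cring_char_p A p by (rule A)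
  interpret \<pi>: ring_hom_cring PS A \<pi> by unfold_locales (rule \<pi>)
  interpret \<epsilon>: ring_hom_cring A R \<epsilon> by unfold_locales (rule \<epsilon>)
  have x: "\<And>i. i < r \<Longrightarrow> x i \<in> carrier A"
    and l: "\<And>i. i < r \<Longrightarrow> linear_functional A (frobenius_pushforward p e A) (\<phi> i)"
    and d: "\<And>i j. i < r \<Longrightarrow> j < r \<Longrightarrow> \<phi> i (x j) = (if i = j then \<one>\<^bsub>A\<^esub> else \<zero>\<^bsub>A\<^esub>)"
    using D by (auto simp: dual_system_def frobenius_dual_system_def frobenius_pushforward_def)
  have lcl: "\<phi> i z \<in> carrier A" if "i < r" "z \<in> carrier A" for i z
    using l[OF that(1)] that(2) by (auto simp: linear_functional_frobenius_iff)
  have ladd: "\<phi> i (z \<oplus>\<^bsub>A\<^esub> z') = \<phi> i z \<oplus>\<^bsub>A\<^esub> \<phi> i z'" if "i < r" "z \<in> carrier A" "z' \<in> carrier A" for i z z'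
    using l[OF that(1)] that(2,3) by (auto simp: linear_functional_frobenius_iff)
  have lsm: "\<phi> i (a [^]\<^bsub>A\<^esub> ?q \<otimes>\<^bsub>A\<^esub> z) = a \<otimes>\<^bsub>A\<^esub> \<phi> i z" if "i < r" "a \<in> carrier A" "z \<in> carrier A" for i a z
    using l[OF that(1)] that(2,3) by (auto simp: linear_functional_frobenius_iff)
  have "\<forall>j<r. \<exists>t. t \<in> carrier PS \<and> \<pi> t = x j" using x surj by (metis imageE)
  then obtain z where z: "\<And>j. j < r \<Longrightarrow> z j \<in> carrier PS" "\<And>j. j < r \<Longrightarrow> \<pi> (z j) = x j" by metis
  have "\<forall>c\<in>carrier R. \<exists>\<beta>. \<beta> \<in> T \<rightarrow> carrier R \<and> c = (\<Oplus>t\<in>T. \<beta> t [^] ?q \<otimes> w t)" using gen by blast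
  then obtain \<beta> where \<beta>: "\<And>c. c \<in> carrier R \<Longrightarrow> \<beta> c \<in> T \<rightarrow> carrier R"
    "\<And>c. c \<in> carrier R \<Longrightarrow> c = (\<Oplus>t\<in>T. \<beta> c t [^] ?q \<otimes> w t)" by metis
  have \<beta>c: "\<beta> c t \<in> carrier R" if "c \<in> carrier R" "t \<in> T" for c t using \<beta>(1) that by auto
  have wc: "w t \<in> carrier R" if "t \<in> T" for t using T that by auto
  \<comment> \<open>The functional is pulled back to the power series ring and reduced to the
    residue field. By \<open>\<theta>sm\<close> a q-th power f^q comes out as the constant term of
    f, so q-th powers of variables are killed and q-th powers of constants act as scalars.\<close>
  define \<theta> where "\<theta> i f = \<epsilon> (\<phi> i (\<pi> f))" for i f
  have \<theta>c: "\<theta> i f \<in> carrier R" if "i < r" "f \<in> carrier PS" for i f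
    using lcl that by (simp add: \<theta>_def)
  have \<theta>add: "\<theta> i (f \<oplus>\<^bsub>PS\<^esub> g) = \<theta> i f \<oplus> \<theta> i g" if "i < r" "f \<in> carrier PS" "g \<in> carrier PS" for i f g
    using lcl ladd that by (simp add: \<theta>_def)
  have \<theta>sm: "\<theta> i (f [^]\<^bsub>PS\<^esub> ?q \<otimes>\<^bsub>PS\<^esub> g) = f {#} \<otimes> \<theta> i g" if "i < r" "f \<in> carrier PS" "g \<in> carrier PS" for i f g
    using lcl lsm that by (simp add: \<theta>_def \<epsilon>\<pi> \<pi>.ring.hom_nat_pow)
  have expand: "\<theta> i (z j) = (\<Oplus>t\<in>?B \<times> T. \<theta> i (monom_series R (w (snd t)) (fst t)) \<otimes> \<beta> (z j (fst t)) (snd t))"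
    if i: "i < r" and j: "j < r" for i j
  proof -
    have "\<theta> i (z j) = (\<Oplus>\<alpha>\<in>?B. \<theta> i (monom_series R (z j \<alpha>) \<alpha>))"
    proof (rule vanishing_on_box[OF fin _ is_abelian_group])
      fix v g assume v: "v \<in> I" and g: "g \<in> carrier PS"
      show "\<theta> i (monom_series R \<one> (replicate_mset ?q v) \<otimes>\<^bsub>PS\<^esub> g) = \<zero>"
        unfolding variable_frobenius[OF v]
        by (subst \<theta>sm) (use i v g \<theta>c fun_cong[OF monom_series_def[of R \<one> "{#v#}"], of "{#}"] in auto)
    qed (use z[OF j] \<theta>c \<theta>add i in auto)
    also have "\<dots> = (\<Oplus>\<alpha>\<in>?B. \<Oplus>t\<in>T. \<theta> i (monom_series R (w t) \<alpha>) \<otimes> \<beta> (z j \<alpha>) t)"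
    proof (rule finsum_cong')
      fix \<alpha> assume "\<alpha> \<in> ?B"
      then have \<alpha>: "set_mset \<alpha> \<subseteq> I" by (simp add: monomial_box_def)
      let ?c = "z j \<alpha>"
      have c: "?c \<in> carrier R" using z(1)[OF j] by auto
      have h: "(\<lambda>c. \<theta> i (monom_series R c \<alpha>)) \<in> carrier R \<rightarrow> carrier R" using \<theta>c i \<alpha> by auto
      have hadd: "\<theta> i (monom_series R (a \<oplus> b) \<alpha>) = \<theta> i (monom_series R a \<alpha>) \<oplus> \<theta> i (monom_series R b \<alpha>)"
        if "a \<in> carrier R" "b \<in> carrier R" for a b
      proof -
        have "monom_series R (a \<oplus> b) \<alpha> = monom_series R a \<alpha> \<oplus>\<^bsub>PS\<^esub> monom_series R b \<alpha>"
          using that by (intro ext) (auto simp: monom_series_def ps_add)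
        then show ?thesis using \<theta>add[OF i monom_closed[OF that(1) \<alpha>] monom_closed[OF that(2) \<alpha>]] by simp
      qed
      have "\<theta> i (monom_series R ?c \<alpha>) = \<theta> i (monom_series R (\<Oplus>t\<in>T. \<beta> ?c t [^] ?q \<otimes> w t) \<alpha>)"
        using \<beta>(2)[OF c] by simp
      also have "\<dots> = (\<Oplus>t\<in>T. \<theta> i (monom_series R (\<beta> ?c t [^] ?q \<otimes> w t) \<alpha>))"
        by (rule additive_map_finsum[OF is_abelian_group is_abelian_group h hadd]) (use \<beta>c[OF c] wc in auto)
      also have "\<dots> = (\<Oplus>t\<in>T. \<theta> i (monom_series R (w t) \<alpha>) \<otimes> \<beta> ?c t)"
      proof (rule finsum_cong')
        fix t assume t: "t \<in> T"
        have cb: "const_series R (\<beta> ?c t) \<in> carrier PS"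
          using \<beta>c[OF c t] by (auto simp: const_series_eq_monom)
        show "\<theta> i (monom_series R (\<beta> ?c t [^] ?q \<otimes> w t) \<alpha>) = \<theta> i (monom_series R (w t) \<alpha>) \<otimes> \<beta> ?c t"
          unfolding monom_frobenius[OF \<beta>c[OF c t] wc[OF t] \<alpha>] \<theta>sm[OF i cb monom_closed[OF wc[OF t] \<alpha>]]
          using \<beta>c[OF c t] \<theta>c[OF i monom_closed[OF wc[OF t] \<alpha>]] by (simp add: const_series_def m_comm)
      qed (use \<theta>c[OF i] wc \<beta>c[OF c] \<alpha> in auto)
      finally show "\<theta> i (monom_series R ?c \<alpha>) = \<dots>" .
    next
      show "(\<lambda>\<alpha>. \<Oplus>t\<in>T. \<theta> i (monom_series R (w t) \<alpha>) \<otimes> \<beta> (z j \<alpha>) t) \<in> ?B \<rightarrow> carrier R"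
        using \<theta>c[OF i] wc \<beta>c z(1)[OF j] by (auto simp: monomial_box_def intro!: finsum_closed)
    qed simp
    also have "\<dots> = (\<Oplus>t\<in>?B \<times> T. \<theta> i (monom_series R (w (snd t)) (fst t)) \<otimes> \<beta> (z j (fst t)) (snd t))"
      by (rule finsum_Sigma)
        (use \<theta>c[OF i] wc \<beta>c z(1)[OF j] T card_monomial_box[OF fin, of ?q] in \<open>auto simp: monomial_box_def\<close>)
    finally show ?thesis .
  qed
  have finB: "finite ?B" "card ?B = ?q ^ card I" using card_monomial_box[OF fin, of ?q] by auto
  have "card {..<r} \<le> card (?B \<times> T)"
  proof (rule K.identity_factor_card)
    fix i j assume ij: "i \<in> {..<r}" "j \<in> {..<r}"
    have "\<theta> i (z j) = (if i = j then \<one> else \<zero>)"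
      using ij d[of i j] z(2)[of j] by (auto simp: \<theta>_def)
    then show "(\<Oplus>t\<in>?B \<times> T. \<theta> i (monom_series R (w (snd t)) (fst t)) \<otimes> \<beta> (z j (fst t)) (snd t))
        = (if i = j then \<one> else \<zero>)"
      using expand[of i j] ij by simp
  qed (use finB T \<theta>c wc \<beta>c z(1) in \<open>auto simp: monomial_box_def\<close>)
  then show ?thesis using finB by (simp add: card_cartesian_product)
qed

end

section \<open>Chains of prime ideals\<close>

text \<open>An ideal that is maximal among those containing J and missing the multiplicative set S,
  provided by Zorn's lemma, is prime.\<close>

lemma (in cring) primeideal_avoiding_exists:
  assumes J: "ideal J R" and S: "\<one> \<in> S" "S \<subseteq> carrier R"
    and mult: "\<And>s t. s \<in> S \<Longrightarrow> t \<in> S \<Longrightarrow> s \<otimes> t \<in> S" and disj: "J \<inter> S = {}"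
  shows "\<exists>P. primeideal P R \<and> J \<subseteq> P \<and> P \<inter> S = {}"
proof -
  define A where "A = {I. ideal I R \<and> J \<subseteq> I \<and> I \<inter> S = {}}"
  have "\<exists>P\<in>A. \<forall>Q\<in>A. P \<subseteq> Q \<longrightarrow> Q = P"
  proof (rule subset_Zorn_nonempty)
    show "A \<noteq> {}" using J disj by (auto simp: A_def)
    fix C assume C: "C \<noteq> {}" "subset.chain A C"
    then have CA: "C \<subseteq> A" by (auto simp: pred_on.chain_def)
    have "subset.chain {I. ideal I R} C" using C(2) by (auto simp: pred_on.chain_def A_def)
    then have "ideal (\<Union>C) R" using chain_Union_is_ideal[of C] C(1) by simp
    then show "\<Union>C \<in> A" using CA C(1) by (auto simp: A_def)
  qed
  then obtain P where P: "P \<in> A" and max: "\<And>Q. Q \<in> A \<Longrightarrow> P \<subseteq> Q \<Longrightarrow> Q = P" by blast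
  have PI: "ideal P R" "J \<subseteq> P" "P \<inter> S = {}" using P by (auto simp: A_def)
  interpret P: ideal P R by (rule PI(1))
  \<comment> \<open>By maximality, adjoining any a outside P produces an element of S.\<close>
  have meets: "\<exists>q\<in>P. \<exists>r\<in>carrier R. q \<oplus> r \<otimes> a \<in> S" if a: "a \<in> carrier R" "a \<notin> P" for a
  proof -
    let ?Q = "P <+>\<^bsub>R\<^esub> PIdl a"
    have Q: "ideal ?Q R" using add_ideals[OF PI(1) cgenideal_ideal[OF a(1)]] .
    have aQ: "a \<in> ?Q"
      unfolding set_add_def' using P.zero_closed cgenideal_self[OF a(1)] l_zero[OF a(1)] by blast
    have PQ: "P \<subseteq> ?Q"
    proof
      fix q assume q: "q \<in> P"
      have "\<zero> \<in> PIdl a" using cgenideal_ideal[OF a(1)] by (simp add: ideal_def additive_subgroup.zero_closed)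
      then show "q \<in> ?Q" unfolding set_add_def' using q r_zero[OF P.Icarr[OF q]] by blast
    qed
    have "?Q \<inter> S \<noteq> {}"
    proof
      assume "?Q \<inter> S = {}"
      then have "?Q \<in> A" using Q PQ PI(2) by (auto simp: A_def)
      then show False using max PQ aQ a(2) by blast
    qed
    then show ?thesis by (auto simp: set_add_def' cgenideal_def)
  qed
  have "primeideal P R"
  proof (rule primeidealI[OF PI(1) is_cring])
    show "carrier R \<noteq> P" using S PI(3) by blast
    fix a b assume a: "a \<in> carrier R" and b: "b \<in> carrier R" and ab: "a \<otimes> b \<in> P"
    show "a \<in> P \<or> b \<in> P"
    proof (rule ccontr)
      assume "\<not> (a \<in> P \<or> b \<in> P)"
      then obtain q r q' r' where q: "q \<in> P" "r \<in> carrier R" "q \<oplus> r \<otimes> a \<in> S"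
        "q' \<in> P" "r' \<in> carrier R" "q' \<oplus> r' \<otimes> b \<in> S" using meets[OF a] meets[OF b] by blast
      have qc: "q \<in> carrier R" "q' \<in> carrier R" using q P.Icarr by auto
      \<comment> \<open>If a b lies in P, the product of the two elements of S obtained from a and b
        lies both in P and in S.\<close>
      have "(q \<oplus> r \<otimes> a) \<otimes> (q' \<oplus> r' \<otimes> b) = q \<otimes> (q' \<oplus> r' \<otimes> b) \<oplus> (r \<otimes> a \<otimes> q' \<oplus> r \<otimes> r' \<otimes> (a \<otimes> b))"
        using q qc a b by (simp add: l_distr r_distr m_ac a_ac)
      also have "\<dots> \<in> P"
        using P.I_r_closed[OF q(1), of "q' \<oplus> r' \<otimes> b"] P.I_l_closed[OF q(4), of "r \<otimes> a"]
          P.I_l_closed[OF ab, of "r \<otimes> r'"] q qc a b by (simp add: P.a_closed)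
      finally show False using mult[OF q(3,6)] PI(3) by blast
    qed
  qed
  then show ?thesis using PI by blast
qed

definition prime_chain :: "('a, 'r) ring_scheme \<Rightarrow> nat \<Rightarrow> (nat \<Rightarrow> 'a set) \<Rightarrow> bool" where
  "prime_chain R n P \<longleftrightarrow> (\<forall>i\<le>n. primeideal (P i) R) \<and> (\<forall>i<n. P i \<subset> P (Suc i))"

lemma krull_dim_eq_prime_chain: "krull_dim R = Sup {enat n | n. \<exists>P. prime_chain R n P}"
  by (simp add: krull_dim_def prime_chain_def)

lemma prime_chain_mono:
  assumes "prime_chain R n P" "i \<le> j" "j \<le> n"
  shows "P i \<subseteq> P j"
  using assms(2,3)
proof (induction j rule: dec_induct)
  case (step k)
  then have "P k \<subset> P (Suc k)" using assms(1) by (auto simp: prime_chain_def)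
  then show ?case using step by auto
qed simp

lemma prime_chain_extend_below:
  assumes "prime_chain R n P" "primeideal Q R" "Q \<subset> P 0"
  shows "prime_chain R (Suc n) (\<lambda>i. case i of 0 \<Rightarrow> Q | Suc j \<Rightarrow> P j)"
  using assms by (auto simp: prime_chain_def split: nat.splits)

locale surjective_ring_hom = ring_hom_cring +
  assumes surj: "h ` carrier R = carrier S"
begin

lemma surjD: "x \<in> carrier S \<Longrightarrow> \<exists>r\<in>carrier R. x = h r"
  unfolding surj[symmetric] by blast

lemma primeideal_vimage:
  assumes "primeideal P S"
  shows "primeideal {r \<in> carrier R. h r \<in> P} R"
proof -
  interpret P: primeideal P S by fact
  show ?thesis
  proof (rule primeidealI[OF ring.ideal_vimage[OF P.is_ideal] R.is_cring])
    show "carrier R \<noteq> {r \<in> carrier R. h r \<in> P}"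
    proof
      assume "carrier R = {r \<in> carrier R. h r \<in> P}"
      then have "\<And>r. r \<in> carrier R \<Longrightarrow> h r \<in> P" by blast
      then have "carrier S \<subseteq> P" unfolding surj[symmetric] by blast
      then show False using P.I_notcarr P.a_subset by blast
    qed
  qed (use P.I_prime in auto)
qed

lemma prime_chain_vimage:
  assumes "prime_chain S n P"
  shows "prime_chain R n (\<lambda>i. {r \<in> carrier R. h r \<in> P i})"
  unfolding prime_chain_def
proof (intro conjI allI impI)
  show "primeideal {r \<in> carrier R. h r \<in> P i} R" if "i \<le> n" for i
    using assms that by (intro primeideal_vimage) (simp add: prime_chain_def)
  fix i assume i: "i < n"
  then have lt: "P i \<subset> P (Suc i)" "primeideal (P (Suc i)) S" using assms by (auto simp: prime_chain_def)
  then obtain s where s: "s \<in> P (Suc i)" "s \<notin> P i" by blast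
  then have "s \<in> carrier S" using ideal.Icarr[OF primeideal.axioms(1)[OF lt(2)]] by blast
  then obtain r where "r \<in> carrier R" "h r = s" using surjD by metis
  then show "{r \<in> carrier R. h r \<in> P i} \<subset> {r \<in> carrier R. h r \<in> P (Suc i)}"
    using lt s by blast
qed

text \<open>The kernel lies in the smallest prime, hence in all of them, so membership in each P i
  can be read off from the image; this is \<open>ker'\<close>. Properness, primality and strict
  inclusions then descend along h.\<close>

lemma prime_chain_image:
  assumes P: "prime_chain R n P" and ker: "a_kernel R S h \<subseteq> P 0"
  shows "prime_chain S n (\<lambda>i. h ` P i)"
proof -
  have ker': "r \<in> P i" if rr: "r \<in> carrier R" "h r \<in> h ` P i" "i \<le> n" for r i
  proof -
    have pr: "primeideal (P i) R" using P rr by (auto simp: prime_chain_def)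
    interpret Pi: primeideal "P i" R by (rule pr)
    obtain r' where r': "r' \<in> P i" "h r = h r'" using rr by blast
    have c: "r' \<in> carrier R" using r' Pi.Icarr by blast
    have "h (r \<ominus> r') = \<zero>\<^bsub>S\<^esub>" using r'(2) c rr by (simp add: R.minus_eq S.r_neg)
    then have "r \<ominus> r' \<in> a_kernel R S h"
      unfolding a_kernel_def' using rr(1) c by blast
    then have "r \<ominus> r' \<in> P i"
      using ker prime_chain_mono[OF P le0 rr(3)] by blast
    then have "(r \<ominus> r') \<oplus> r' \<in> P i" using r' by (intro Pi.a_closed)
    then show ?thesis using rr c by (simp add: R.minus_eq R.a_assoc R.l_neg)
  qed
  have prime: "primeideal (h ` P i) S" if i: "i \<le> n" for i
  proof -
    have pr: "primeideal (P i) R" using P i by (auto simp: prime_chain_def)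
    interpret Pi: primeideal "P i" R by (rule pr)
    have id: "ideal (h ` P i) S"
    proof (rule idealI[OF S.ring_axioms])
      show "subgroup (h ` P i) (add_monoid S)"
      proof
        show "h ` P i \<subseteq> carrier (add_monoid S)" using Pi.Icarr by auto
        show "\<one>\<^bsub>add_monoid S\<^esub> \<in> h ` P i" using Pi.zero_closed by (auto intro!: image_eqI[of _ h \<zero>])
        fix x y assume "x \<in> h ` P i" "y \<in> h ` P i"
        then obtain a b where ab: "a \<in> P i" "b \<in> P i" "x = h a" "y = h b" by blast
        have "x \<otimes>\<^bsub>add_monoid S\<^esub> y = h (a \<oplus> b)" using ab Pi.Icarr by simp
        then show "x \<otimes>\<^bsub>add_monoid S\<^esub> y \<in> h ` P i" using ab Pi.a_closed by blast
        have "inv\<^bsub>add_monoid S\<^esub> x = h (\<ominus> a)" using ab Pi.Icarr by (simp add: a_inv_def[symmetric])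
        then show "inv\<^bsub>add_monoid S\<^esub> x \<in> h ` P i" using ab Pi.a_inv_closed by blast
      qed
      fix a x assume "a \<in> h ` P i" "x \<in> carrier S"
      then obtain b r where br: "b \<in> P i" "a = h b" "r \<in> carrier R" "x = h r" using surjD by blast
      have "x \<otimes>\<^bsub>S\<^esub> a = h (r \<otimes> b)" "a \<otimes>\<^bsub>S\<^esub> x = h (b \<otimes> r)" using br Pi.Icarr by auto
      then show "x \<otimes>\<^bsub>S\<^esub> a \<in> h ` P i" "a \<otimes>\<^bsub>S\<^esub> x \<in> h ` P i"
        using Pi.I_l_closed[OF br(1,3)] Pi.I_r_closed[OF br(1,3)] by blast+
    qed
    show ?thesis
    proof (rule primeidealI[OF id S.is_cring])
      have "\<one> \<notin> P i" using Pi.one_imp_carrier Pi.I_notcarr by blast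
      then have "h \<one> \<notin> h ` P i" using ker'[OF R.one_closed _ i] by blast
      then show "carrier S \<noteq> h ` P i" by auto
      fix x y assume "x \<in> carrier S" "y \<in> carrier S" and xy: "x \<otimes>\<^bsub>S\<^esub> y \<in> h ` P i"
      then obtain a b where ab: "a \<in> carrier R" "b \<in> carrier R" "x = h a" "y = h b"
        using surjD by metis
      then have "h (a \<otimes> b) \<in> h ` P i" using xy by simp
      then have "a \<otimes> b \<in> P i" using ker'[OF _ _ i] ab by blast
      then show "x \<in> h ` P i \<or> y \<in> h ` P i" using Pi.I_prime[OF ab(1,2)] ab by blast
    qed
  qed
  have strict: "h ` P i \<subset> h ` P (Suc i)" if i: "i < n" for i
  proof -
    have lt: "P i \<subset> P (Suc i)" using P i by (auto simp: prime_chain_def)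
    then obtain s where s: "s \<in> P (Suc i)" "s \<notin> P i" by blast
    have "primeideal (P (Suc i)) R" using P i by (auto simp: prime_chain_def)
    then have "ideal (P (Suc i)) R" by (rule primeideal.axioms(1))
    then have "s \<in> carrier R" using s(1) by (rule ideal.Icarr)
    then have "h s \<notin> h ` P i" using ker'[of s i] s i by auto
    then show ?thesis using lt s by blast
  qed
  show ?thesis using prime strict by (auto simp: prime_chain_def)
qed

end

section \<open>Monomial orders and leading monomials\<close>

text \<open>The order refines the total degree: \<open>lt_size\<close> leaves only finitely many
  monomials over I below a given one and lets division preserve the order of vanishing. Totality is
  demanded only for monomials in the variables I.\<close>

locale monomial_order =
  fixes I :: "'v set" and lt :: "'v multiset \<Rightarrow> 'v multiset \<Rightarrow> bool"
  assumes fin: "finite I"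
    and wf_lt: "wf {(a, b). lt a b}"
    and lt_size: "lt a b \<Longrightarrow> size a \<le> size b"
    and lt_trans: "lt a b \<Longrightarrow> lt b c \<Longrightarrow> lt a c"
    and lt_add: "lt a b \<Longrightarrow> lt (a + c) (b + c)"
    and lt_total: "set_mset a \<subseteq> I \<Longrightarrow> set_mset b \<subseteq> I \<Longrightarrow> a \<noteq> b \<Longrightarrow> lt a b \<or> lt b a"
begin

lemma lt_irrefl [simp]: "\<not> lt a a"
  using wf_lt wf_not_refl by fastforce

end

lemma image_mset_inj_on:
  assumes "inj_on g I" "set_mset a \<subseteq> I" "set_mset b \<subseteq> I" "image_mset g a = image_mset g b"
  shows "a = b"
proof -
  have "image_mset (inv_into I g) (image_mset g c) = c" if "set_mset c \<subseteq> I" for c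
  proof -
    have "image_mset (inv_into I g \<circ> g) c = image_mset id c"
      by (rule image_mset_cong) (use that assms(1) in auto)
    then show ?thesis by (simp add: multiset.map_comp)
  qed
  then show ?thesis using assms by metis
qed

text \<open>Monomials are compared by size first; ties are broken by numbering the variables and
  using the multiset order on natural numbers. The numbering g is injective on I only, which is why
  distinct monomials need be comparable only there.\<close>

lemma monomial_order_exists:
  assumes "finite (I :: 'v set)"
  shows "\<exists>lt. monomial_order I lt"
proof -
  obtain g :: "'v \<Rightarrow> nat" where g: "inj_on g I"
    using finite_imp_inj_to_nat_seg[OF assms] by blast
  define lt where "lt a b \<longleftrightarrow> size a < size b \<or> size a = size b \<and> image_mset g a < image_mset g b" for a b
  have "monomial_order I lt"
  proof
    have "{(a, b). lt a b} = inv_image (less_than <*lex*> {(M, N). M < N}) (\<lambda>m. (size m, image_mset g m))"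
      by (auto simp: lt_def inv_image_def)
    then show "wf {(a, b). lt a b}"
      by (simp only:) (intro wf_inv_image wf_lex_prod wf_less_than wf_less_multiset)
    show "lt a b \<or> lt b a" if "set_mset a \<subseteq> I" "set_mset b \<subseteq> I" "a \<noteq> b" for a b
      using image_mset_inj_on[OF g that(1,2)] that(3) by (auto simp: lt_def not_less_iff_gr_or_eq)
    show "lt (a + c) (b + c)" if "lt a b" for a b c
      using that add_strict_right_mono[of "image_mset g a" "image_mset g b" "image_mset g c"]
      unfolding lt_def by auto
    show "lt a c" if "lt a b" "lt b c" for a b c
      using that less_trans[of "image_mset g a" "image_mset g b" "image_mset g c"]
      unfolding lt_def by linarith
    show "size a \<le> size b" if "lt a b" for a b using that unfolding lt_def by linarith
  qed (rule assms)
  then show ?thesis by blast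
qed

locale ordered_power_series = power_series R I + monomial_order I lt
  for R (structure) and I :: "'v set" and lt
begin

text \<open>For power series the leading monomial is the smallest one in the support: a largest one
  need not exist, while well-foundedness provides a smallest.\<close>

definition leading :: "('v multiset \<Rightarrow> 'a) \<Rightarrow> 'v multiset \<Rightarrow> bool" where
  "leading f m \<longleftrightarrow> f m \<noteq> \<zero> \<and> (\<forall>m'. f m' \<noteq> \<zero> \<longrightarrow> m' = m \<or> lt m m')"

lemma leading_exists:
  assumes "f \<in> carrier PS" "f \<noteq> \<zero>\<^bsub>PS\<^esub>"
  shows "\<exists>m. leading f m"
proof -
  have "\<exists>m. f m \<noteq> \<zero>" using assms(2) by (auto simp: ps_zero fun_eq_iff)
  then have ne: "{m. f m \<noteq> \<zero>} \<noteq> {}" by blast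
  obtain m where m: "m \<in> {m. f m \<noteq> \<zero>}"
    and "\<And>m'. (m', m) \<in> {(a, b). lt a b} \<Longrightarrow> m' \<notin> {m. f m \<noteq> \<zero>}"
    by (rule wfE_min'[OF wf_lt ne], rule that, assumption, blast)
  then have min: "\<And>m'. lt m' m \<Longrightarrow> f m' = \<zero>" by simp
  have "m' = m \<or> lt m m'" if "f m' \<noteq> \<zero>" for m'
  proof -
    have "set_mset m \<subseteq> I" "set_mset m' \<subseteq> I" using ps_coeff_outside[OF assms(1)] m that by blast+
    then show ?thesis using lt_total[of m m'] min[of m'] that by blast
  qed
  then show ?thesis using m by (auto simp: leading_def)
qed

lemma leading_supp: "f \<in> carrier PS \<Longrightarrow> leading f m \<Longrightarrow> set_mset m \<subseteq> I"
  using ps_coeff_outside[of f m] by (auto simp: leading_def)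

text \<open>In any other splitting c + d = a + b with nonzero coefficients, c is strictly above a
  and d is not below b, so the sum would be strictly above a + b.\<close>

lemma leading_mult_coeff:
  assumes f: "f \<in> carrier PS" "leading f a" and g: "g \<in> carrier PS" "leading g b"
  shows "(f \<otimes>\<^bsub>PS\<^esub> g) (a + b) = f a \<otimes> g b"
proof -
  have "(f \<otimes>\<^bsub>PS\<^esub> g) (a + b) = f (fst (a, b)) \<otimes> g (snd (a, b))"
    unfolding ps_mult_splittings[OF f(1) g(1)]
  proof (rule finsum_single[where i = "(a, b)"])
    fix z assume z: "z \<in> {(a', b'). a' + b' = a + b}" "z \<noteq> (a, b)"
    obtain c d where cd: "z = (c, d)" "c + d = a + b" using z by auto
    show "f (fst z) \<otimes> g (snd z) = \<zero>"
    proof (rule ccontr)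
      assume "f (fst z) \<otimes> g (snd z) \<noteq> \<zero>"
      then have "f c \<noteq> \<zero>" "g d \<noteq> \<zero>" using f g cd by auto
      then have c: "c = a \<or> lt a c" and d: "d = b \<or> lt b d" using f g by (auto simp: leading_def)
      have "c \<noteq> a" using cd z by auto
      then have "lt a c" using c by simp
      then have "lt (a + b) (c + b)" by (rule lt_add)
      moreover have "c + b = c + d \<or> lt (c + b) (c + d)" using d lt_add[of b d c] by (auto simp: add.commute)
      ultimately have "lt (a + b) (c + d)" using lt_trans by metis
      then show False using cd by simp
    qed
  qed (use f g finite_splittings in auto)
  then show ?thesis by simp
qed

end

lemma (in power_series) ps_domain:
  assumes "domain R" "finite I"
  shows "domain PS"
proof -
  interpret R: domain R by fact
  obtain lt where "monomial_order I lt" using monomial_order_exists[OF assms(2)] by blast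
  then interpret ordered_power_series R I lt
    by (intro ordered_power_series.intro power_series_axioms)
  show ?thesis
  proof
    show "\<one>\<^bsub>PS\<^esub> \<noteq> \<zero>\<^bsub>PS\<^esub>"
      by (auto simp: ps_one ps_zero monom_series_def fun_eq_iff)
    fix f g assume fg: "f \<otimes>\<^bsub>PS\<^esub> g = \<zero>\<^bsub>PS\<^esub>" "f \<in> carrier PS" "g \<in> carrier PS"
    show "f = \<zero>\<^bsub>PS\<^esub> \<or> g = \<zero>\<^bsub>PS\<^esub>"
    proof (rule ccontr)
      assume "\<not> (f = \<zero>\<^bsub>PS\<^esub> \<or> g = \<zero>\<^bsub>PS\<^esub>)"
      then obtain a b where ab: "leading f a" "leading g b" using leading_exists fg by metis
      have "f a \<otimes> g b = \<zero>" using leading_mult_coeff[OF fg(2) ab(1) fg(3) ab(2)] fg(1) by (simp add: ps_zero)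
      then show False using R.integral_iff[of "f a" "g b"] fg ab by (auto simp: leading_def)
    qed
  qed
qed

section \<open>Setting variables to zero, and long chains of primes\<close>

definition restrict_series :: "('a, 'r) ring_scheme \<Rightarrow> 'v set \<Rightarrow> ('v multiset \<Rightarrow> 'a) \<Rightarrow> 'v multiset \<Rightarrow> 'a" where
  "restrict_series R J f m = (if set_mset m \<subseteq> J then f m else \<zero>\<^bsub>R\<^esub>)"

context power_series
begin

lemma restriction_hom:
  assumes "J \<subseteq> I"
  shows "surjective_ring_hom PS (power_series_ring R J) (restrict_series R J)"
    (is "surjective_ring_hom _ _ ?h")
proof -
  interpret J: power_series R J by unfold_locales
  have c: "?h f \<in> carrier J.PS" if "f \<in> carrier PS" for f
    using that by (intro J.ps_carrierI) (auto simp: restrict_series_def)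
  have hom: "?h \<in> ring_hom PS J.PS"
  proof (rule ring_hom_memI)
    fix f g assume fg: "f \<in> carrier PS" "g \<in> carrier PS"
    show "?h (f \<otimes>\<^bsub>PS\<^esub> g) = ?h f \<otimes>\<^bsub>J.PS\<^esub> ?h g"
    proof
      fix m
      show "?h (f \<otimes>\<^bsub>PS\<^esub> g) m = (?h f \<otimes>\<^bsub>J.PS\<^esub> ?h g) m"
      proof (cases "set_mset m \<subseteq> J")
        case True
        have "set_mset d \<subseteq> J" "set_mset (m - d) \<subseteq> J" if "d \<subseteq># m" for d
          using True that by (meson set_mset_mono order_trans diff_subset_eq_self)+
        then have "(?h f \<otimes>\<^bsub>J.PS\<^esub> ?h g) m = (\<Oplus>d\<in>{d. d \<subseteq># m}. f d \<otimes> g (m - d))"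
          unfolding J.ps_mult using fg by (intro finsum_cong') (auto simp: restrict_series_def)
        then show ?thesis using True by (simp only: restrict_series_def ps_mult if_True)
      next
        case False
        have "(?h f \<otimes>\<^bsub>J.PS\<^esub> ?h g) m = \<zero>"
          by (rule J.ps_coeff_outside[OF J.ps_mult_closed[OF c[OF fg(1)] c[OF fg(2)]] False])
        then show ?thesis using False by (simp only: restrict_series_def if_False)
      qed
    qed
    show "?h (f \<oplus>\<^bsub>PS\<^esub> g) = ?h f \<oplus>\<^bsub>J.PS\<^esub> ?h g"
      by (intro ext) (simp add: restrict_series_def ps_add J.ps_add)
  qed (use c in \<open>auto simp: restrict_series_def ps_one J.ps_one monom_series_def\<close>)
  have "?h ` carrier PS = carrier J.PS"
  proof
    show "?h ` carrier PS \<subseteq> carrier J.PS" using c by auto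
    show "carrier J.PS \<subseteq> ?h ` carrier PS"
    proof
      fix f assume f: "f \<in> carrier J.PS"
      have "f \<in> carrier PS"
      proof (rule ps_carrierI)
        fix m assume "\<not> set_mset m \<subseteq> I"
        then have "\<not> set_mset m \<subseteq> J" using assms by blast
        then show "f m = \<zero>" by (rule J.ps_coeff_outside[OF f])
      qed (rule J.ps_coeff_closed[OF f])
      moreover have "f = ?h f"
      proof
        fix m show "f m = ?h f m"
          using J.ps_coeff_outside[OF f, of m] by (cases "set_mset m \<subseteq> J") (simp_all only: restrict_series_def if_True if_False not_False_eq_True)
      qed
      ultimately show "f \<in> ?h ` carrier PS" using image_eqI[of f ?h f "carrier PS"] by blast
    qed
  qed
  then show ?thesis
    using hom ps_cring J.ps_cring
    by (intro surjective_ring_hom.intro ring_hom_cring.intro ring_hom_cring_axioms.intro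
        surjective_ring_hom_axioms.intro)
qed

lemma variable_dvd:
  assumes f: "f \<in> carrier PS" and v: "v \<in> I" and z: "\<And>m. v \<notin># m \<Longrightarrow> f m = \<zero>"
  shows "\<exists>g\<in>carrier PS. f = monom_series R \<one> {#v#} \<otimes>\<^bsub>PS\<^esub> g"
proof
  define g where "g m = f (add_mset v m)" for m
  show g: "g \<in> carrier PS"
  proof (rule ps_carrierI)
    fix m assume "\<not> set_mset m \<subseteq> I"
    then have "\<not> set_mset (add_mset v m) \<subseteq> I" by auto
    then show "g m = \<zero>" unfolding g_def by (rule ps_coeff_outside[OF f])
  qed (use f in \<open>auto simp: g_def\<close>)
  show "f = monom_series R \<one> {#v#} \<otimes>\<^bsub>PS\<^esub> g"
  proof
    fix m show "f m = (monom_series R \<one> {#v#} \<otimes>\<^bsub>PS\<^esub> g) m"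
      using f g z[of m] by (subst monom_mult_coeff) (auto simp: g_def)
  qed
qed

end

text \<open>Here h is reduction modulo x. The multiplicative set T consists of the products of a
  power of x with an element outside the preimage Q' of Q. A prime that contains f and misses T lies
  inside Q', because T contains the complement of Q', and strictly so, because x lies in both T and
  Q'. It remains to see that T misses the ideal of f.\<close>

lemma (in domain) variable_power_avoids_prime:
  assumes h: "surjective_ring_hom R S h" and S: "domain S" and Q: "primeideal Q S"
    and x: "x \<in> carrier R" "x \<noteq> \<zero>" "h x = \<zero>\<^bsub>S\<^esub>"
    and ker: "\<And>r. r \<in> carrier R \<Longrightarrow> h r = \<zero>\<^bsub>S\<^esub> \<Longrightarrow> \<exists>g\<in>carrier R. r = x \<otimes> g"
    and f: "f \<in> carrier R" "h f \<noteq> \<zero>\<^bsub>S\<^esub>" "h f \<in> Q"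
  shows "\<exists>P. primeideal P R \<and> f \<in> P \<and> P \<subset> {r \<in> carrier R. h r \<in> Q}"
proof -
  interpret h: surjective_ring_hom R S h by (rule h)
  interpret S: domain S by (rule S)
  define Q' where "Q' = {r \<in> carrier R. h r \<in> Q}"
  have pr: "primeideal Q' R" unfolding Q'_def by (rule h.primeideal_vimage[OF Q])
  interpret Q': primeideal Q' R by (rule pr)
  have fQ: "f \<in> Q'" unfolding Q'_def using f(1,3) by (intro CollectI conjI)
  have one: "\<one> \<notin> Q'"
  proof
    assume "\<one> \<in> Q'"
    then have "Q' = carrier R" by (rule Q'.one_imp_carrier)
    then show False using Q'.I_notcarr by simp
  qed
  define T where "T = {x [^] i \<otimes> s | (i::nat) s. s \<in> carrier R \<and> s \<notin> Q'}"
  have TI: "x [^] i \<otimes> s \<in> T" if "s \<in> carrier R" "s \<notin> Q'" for i :: nat and s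
    using that by (auto simp: T_def)
  \<comment> \<open>If a power of x times s equals t f, reduction modulo x gives h t h f = 0, hence
    h t = 0 because h f is nonzero in a domain. So x divides t and one factor x cancels. Descent
    reaches s = t f, which lies in Q'.\<close>
  have key: "s \<in> Q'" if "s \<in> carrier R" "t \<in> carrier R" "x [^] i \<otimes> s = t \<otimes> f" for i :: nat and s t
    using that
  proof (induction i arbitrary: t)
    case 0
    then have "s = t \<otimes> f" by simp
    then show ?case using Q'.I_l_closed[OF fQ 0(2)] by simp
  next
    case (Suc i)
    have eq: "x \<otimes> (x [^] i \<otimes> s) = t \<otimes> f"
      using Suc.prems x by (simp add: m_assoc m_lcomm[of x "x [^] i" s])
    have "h t \<otimes>\<^bsub>S\<^esub> h f = h (x \<otimes> (x [^] i \<otimes> s))" unfolding eq using Suc.prems f by simp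
    also have "\<dots> = \<zero>\<^bsub>S\<^esub>" using Suc.prems x by simp
    finally have "h t = \<zero>\<^bsub>S\<^esub>" using S.integral[of "h t" "h f"] Suc.prems f by auto
    then obtain g where g: "g \<in> carrier R" "t = x \<otimes> g" using ker Suc.prems by blast
    have "x \<otimes> (x [^] i \<otimes> s) = x \<otimes> (g \<otimes> f)" using eq g x f by (simp add: m_assoc)
    then have "x [^] i \<otimes> s = g \<otimes> f" using m_lcancel[OF x(2,1)] Suc.prems x f g by simp
    then show ?case using Suc g by blast
  qed
  have "\<exists>P. primeideal P R \<and> PIdl f \<subseteq> P \<and> P \<inter> T = {}"
  proof (rule primeideal_avoiding_exists[OF cgenideal_ideal[OF f(1)]])
    show "\<one> \<in> T" using TI[OF one_closed one, of 0] by simp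
    show "T \<subseteq> carrier R" using x by (auto simp: T_def)
    fix s t assume "s \<in> T" "t \<in> T"
    then obtain i j :: nat and a b where ab: "s = x [^] i \<otimes> a" "t = x [^] j \<otimes> b"
      "a \<in> carrier R" "a \<notin> Q'" "b \<in> carrier R" "b \<notin> Q'" unfolding T_def by blast
    have "s \<otimes> t = x [^] (i + j) \<otimes> (a \<otimes> b)" using ab x by (simp add: nat_pow_mult[symmetric] m_ac)
    moreover have "a \<otimes> b \<notin> Q'" using ab Q'.I_prime by blast
    ultimately show "s \<otimes> t \<in> T" using TI[of "a \<otimes> b" "i + j"] ab by simp
  next
    show "PIdl f \<inter> T = {}"
    proof (rule ccontr)
      assume "PIdl f \<inter> T \<noteq> {}"
      then obtain t i s where "t \<in> carrier R" "s \<in> carrier R" "s \<notin> Q'" "x [^] (i::nat) \<otimes> s = t \<otimes> f"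
        unfolding T_def cgenideal_def by fastforce
      then show False using key by blast
    qed
  qed
  then obtain P where P: "primeideal P R" "PIdl f \<subseteq> P" "P \<inter> T = {}" by blast
  have PR: "P \<subseteq> carrier R" using ideal.Icarr[OF primeideal.axioms(1)[OF P(1)]] by blast
  have sub: "P \<subseteq> Q'"
  proof
    fix a assume a: "a \<in> P"
    then have aR: "a \<in> carrier R" using PR by blast
    show "a \<in> Q'"
    proof (rule ccontr)
      assume "a \<notin> Q'"
      then have "a \<in> T" using TI[OF aR, of 0] aR by simp
      then show False using a P(3) by blast
    qed
  qed
  have "x \<in> T" using TI[OF one_closed one, of 1] x by simp
  then have "x \<notin> P" using P(3) by blast
  moreover have "x \<in> Q'"
  proof -
    have "\<zero>\<^bsub>S\<^esub> \<in> Q" using additive_subgroup.zero_closed[OF ideal.axioms(1)[OF primeideal.axioms(1)[OF Q]]] .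
    then show ?thesis unfolding Q'_def by (intro CollectI conjI) (simp_all only: x)
  qed
  ultimately have "P \<subset> Q'" using sub by blast
  moreover have "f \<in> P" using P(2) cgenideal_self[OF f(1)] by blast
  ultimately show ?thesis using P(1) unfolding Q'_def by blast
qed

text \<open>The requirement that the smallest prime contain f makes the chain descend to the
  quotient by f and also carries the induction. A new variable v must lengthen the chain by one,
  with two ways to do it according to whether f survives v = 0. For one variable the maximal ideal
  alone suffices.\<close>

lemma (in field) power_series_prime_chain_exists:
  assumes "finite (I :: 'v set)" "I \<noteq> {}" "f \<in> carrier (power_series_ring R I)" "f {#} = \<zero>"
  shows "\<exists>P. prime_chain (power_series_ring R I) (card I - 1) P \<and> f \<in> P 0"
  using assms
proof (induction I arbitrary: f rule: finite_ne_induct)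
  case (singleton v)
  interpret power_series R "{v}" by unfold_locales
  interpret h: surjective_ring_hom PS R "\<lambda>f. f {#}"
  proof (intro surjective_ring_hom.intro ring_hom_cring.intro ring_hom_cring_axioms.intro
        surjective_ring_hom_axioms.intro coeff0_hom ps_cring is_cring)
    show "(\<lambda>f. f {#}) ` carrier PS = carrier R"
    proof
      show "carrier R \<subseteq> (\<lambda>f. f {#}) ` carrier PS"
      proof
        fix a assume "a \<in> carrier R"
        then show "a \<in> (\<lambda>f. f {#}) ` carrier PS"
          by (intro image_eqI[of _ _ "monom_series R a {#}"]) (simp_all add: monom_series_def[of R a] monom_closed[unfolded monom_series_def])
      qed
    qed auto
  qed
  have "primeideal {f \<in> carrier PS. f {#} \<in> {\<zero>}} PS"
    by (rule h.primeideal_vimage[OF zeroprimeideal])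
  then have "prime_chain PS (card {v} - 1) (\<lambda>_. {f \<in> carrier PS. f {#} \<in> {\<zero>}})"
    by (simp add: prime_chain_def)
  moreover have "f \<in> {f \<in> carrier PS. f {#} \<in> {\<zero>}}" using singleton by simp
  ultimately show ?case by blast
next
  case (insert v F)
  interpret power_series R "insert v F" by unfold_locales
  interpret F: power_series R F by unfold_locales
  have dom: "domain PS" "domain F.PS"
    using ps_domain[OF domain_axioms] F.ps_domain[OF domain_axioms] insert.hyps by auto
  interpret D: domain PS by (rule dom)
  interpret FD: domain F.PS by (rule dom)
  let ?h = "restrict_series R F"
  have h: "surjective_ring_hom PS F.PS ?h" by (rule restriction_hom) auto
  then interpret h: surjective_ring_hom PS F.PS ?h .
  have card: "card (insert v F) - 1 = Suc (card F - 1)"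
    using insert.hyps by (simp add: card_gt_0_iff)
  show ?case
  proof (cases "?h f = \<zero>\<^bsub>F.PS\<^esub>")
    case True
    obtain w where w: "w \<in> F" using insert.hyps by blast
    \<comment> \<open>With f zero modulo v, the preimage of the zero ideal contains f and can be put
      below the lifted chain. Another variable w serves as the g of the induction hypothesis only to
      make the smallest prime of that chain nonzero.\<close>
    define g where "g = monom_series R \<one> {#w#}"
    have g: "g \<in> carrier F.PS" "g {#} = \<zero>" "g \<noteq> \<zero>\<^bsub>F.PS\<^esub>"
    proof -
      show "g \<in> carrier F.PS" unfolding g_def using w by auto
      show "g {#} = \<zero>" by (simp add: g_def monom_series_def)
      have "g {#w#} \<noteq> \<zero>\<^bsub>F.PS\<^esub> {#w#}" by (simp add: g_def monom_series_def F.ps_zero)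
      then show "g \<noteq> \<zero>\<^bsub>F.PS\<^esub>" by metis
    qed
    obtain P where P: "prime_chain F.PS (card F - 1) P" "g \<in> P 0"
      using insert.IH[OF g(1,2)] by blast
    have "ideal (P 0) F.PS" using P(1) by (auto simp: prime_chain_def intro: primeideal.axioms(1))
    then have "\<zero>\<^bsub>F.PS\<^esub> \<in> P 0" using additive_subgroup.zero_closed ideal.axioms(1) by blast
    then have "{\<zero>\<^bsub>F.PS\<^esub>} \<subset> P 0" using P(2) g(3) by blast
    note chain = prime_chain_extend_below[OF P(1) FD.zeroprimeideal this]
    let ?P = "\<lambda>i. case i of 0 \<Rightarrow> {\<zero>\<^bsub>F.PS\<^esub>} | Suc j \<Rightarrow> P j"
    have "prime_chain PS (card (insert v F) - 1) (\<lambda>i. {r \<in> carrier PS. ?h r \<in> ?P i})"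
      unfolding card by (rule h.prime_chain_vimage[OF chain])
    moreover have "f \<in> {r \<in> carrier PS. ?h r \<in> ?P 0}" using True insert.prems by simp
    ultimately show ?thesis by blast
  next
    case False
    define x where "x = monom_series R \<one> {#v#}"
    have hf: "?h f \<in> carrier F.PS" "?h f {#} = \<zero>"
      using insert.prems h.hom_closed by (auto simp: restrict_series_def)
    obtain Q where Q: "prime_chain F.PS (card F - 1) Q" "?h f \<in> Q 0"
      using insert.IH[OF hf] by blast
    have Q0: "primeideal (Q 0) F.PS" using Q(1) by (auto simp: prime_chain_def)
    \<comment> \<open>With f nonzero modulo v, the new bottom prime is not a preimage: it contains f
      but not v.\<close>
    have "\<exists>P. primeideal P PS \<and> f \<in> P \<and> P \<subset> {r \<in> carrier PS. ?h r \<in> Q 0}"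
    proof (rule D.variable_power_avoids_prime[OF h dom(2) Q0, of x])
      show "x \<in> carrier PS" unfolding x_def by auto
      have "x {#v#} \<noteq> \<zero>\<^bsub>PS\<^esub> {#v#}" by (simp add: x_def monom_series_def ps_zero)
      then show "x \<noteq> \<zero>\<^bsub>PS\<^esub>" by metis
      show "?h x = \<zero>\<^bsub>F.PS\<^esub>" using insert.hyps by (intro ext) (auto simp: restrict_series_def x_def monom_series_def F.ps_zero)
      show "\<exists>g\<in>carrier PS. r = x \<otimes>\<^bsub>PS\<^esub> g" if r: "r \<in> carrier PS" "?h r = \<zero>\<^bsub>F.PS\<^esub>" for r
        unfolding x_def
      proof (rule variable_dvd[OF r(1)])
        fix m assume m: "v \<notin># m"
        show "r m = \<zero>"
        proof (cases "set_mset m \<subseteq> F")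
          case True
          then show ?thesis using fun_cong[OF r(2), of m] by (simp add: restrict_series_def F.ps_zero)
        next
          case False
          then have "\<not> set_mset m \<subseteq> insert v F" using m by blast
          then show ?thesis by (rule ps_coeff_outside[OF r(1)])
        qed
      qed simp
    qed (use insert.prems False Q in auto)
    then obtain P where P: "primeideal P PS" "f \<in> P" "P \<subset> {r \<in> carrier PS. ?h r \<in> Q 0}" by blast
    have "prime_chain PS (card (insert v F) - 1)
        (\<lambda>i. case i of 0 \<Rightarrow> P | Suc j \<Rightarrow> {r \<in> carrier PS. ?h r \<in> Q j})"
      unfolding card by (rule prime_chain_extend_below[OF h.prime_chain_vimage[OF Q(1)] P(1,3)])
    moreover have "f \<in> (case 0 of 0 \<Rightarrow> P | Suc j \<Rightarrow> {r \<in> carrier PS. ?h r \<in> Q j})" using P by simp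
    ultimately show ?thesis by (intro exI conjI)
  qed
qed

section \<open>Division by standard bases\<close>

lemma nat_seq_incseq_subseq:
  fixes s :: "nat \<Rightarrow> nat"
  shows "\<exists>f. strict_mono f \<and> incseq (\<lambda>n. s (f n))"
proof -
  obtain f :: "nat \<Rightarrow> nat" where f: "strict_mono f" "monoseq (\<lambda>n. s (f n))"
    using seq_monosub[of s] by blast
  then consider "incseq (\<lambda>n. s (f n))" | "decseq (\<lambda>n. s (f n))" by (auto simp: monoseq_iff)
  then show ?thesis
  proof cases
    case 2
    \<comment> \<open>A decreasing sequence of natural numbers is constant from the index N of its
      minimum on, so its tail is also increasing.\<close>
    obtain N where N: "\<And>n. s (f N) \<le> s (f n)"
      using ex_has_least_nat[of "\<lambda>_. True" 0 "\<lambda>n. s (f n)"] by blast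
    have "s (f (N + n)) = s (f N)" for n
      using N[of "N + n"] decseqD[OF 2, of N "N + n"] by simp
    then have "incseq (\<lambda>n. s (f (N + n)))" by (simp add: incseq_def)
    moreover have "strict_mono (\<lambda>n. f (N + n))" using f(1) by (simp add: strict_mono_def)
    ultimately show ?thesis by blast
  qed (use f in blast)
qed

lemma multiset_seq_incseq_subseq:
  fixes s :: "nat \<Rightarrow> 'v multiset"
  assumes "finite I"
  shows "\<exists>f. strict_mono f \<and> (\<forall>v\<in>I. incseq (\<lambda>n. count (s (f n)) v))"
  using assms
proof (induction I rule: finite_induct)
  case empty
  show ?case by (intro exI[of _ id]) (simp add: strict_mono_def)
next
  case (insert v I)
  then obtain f where f: "strict_mono f" "\<forall>v\<in>I. incseq (\<lambda>n. count (s (f n)) v)" by blast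
  obtain g where g: "strict_mono g" "incseq (\<lambda>n. count (s (f (g n))) v)"
    using nat_seq_incseq_subseq[of "\<lambda>n. count (s (f n)) v"] by blast
  have "g m \<le> g n" if "m \<le> n" for m n
    using g(1) that by (simp add: strict_mono_less_eq)
  then have "\<forall>w\<in>insert v I. incseq (\<lambda>n. count (s (f (g n))) w)"
    using f(2) g(2) by (auto simp: incseq_def)
  moreover have "strict_mono (\<lambda>n. f (g n))" using f(1) g(1) by (simp add: strict_mono_def)
  ultimately show ?case by blast
qed

text \<open>B is the set of minimal elements of A under divisibility. If B were infinite, a sequence
  of distinct members would have a subsequence with increasing exponents in every variable, and the
  first of its terms would divide the second, against minimality.\<close>

lemma dickson:
  assumes "finite I" "A \<subseteq> {m. set_mset m \<subseteq> I}"
  shows "\<exists>B. finite B \<and> B \<subseteq> A \<and> (\<forall>a\<in>A. \<exists>b\<in>B. b \<subseteq># a)"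
proof -
  define B where "B = {b \<in> A. \<forall>a\<in>A. a \<subseteq># b \<longrightarrow> a = b}"
  have "\<exists>b\<in>B. b \<subseteq># a" if "a \<in> A" for a
    using that
  proof (induction a rule: measure_induct_rule[where f = size])
    case (less a)
    show ?case
    proof (cases "a \<in> B")
      case False
      then obtain a' where a': "a' \<in> A" "a' \<subseteq># a" "a' \<noteq> a" using less.prems by (auto simp: B_def)
      then have "size a' < size a" by (simp add: mset_subset_size subset_mset.less_le)
      then obtain b where "b \<in> B" "b \<subseteq># a'" using less.IH a'(1) by blast
      then show ?thesis using a'(2) subset_mset.order_trans by blast
    qed auto
  qed
  moreover have "finite B"
  proof (rule ccontr)
    assume "infinite B"
    then obtain s :: "nat \<Rightarrow> _" where s: "inj s" "range s \<subseteq> B"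
      using infinite_countable_subset by blast
    obtain f where f: "strict_mono f" "\<forall>v\<in>I. incseq (\<lambda>n. count (s (f n)) v)"
      using multiset_seq_incseq_subseq[OF assms(1)] by blast
    have sB: "s n \<in> B" for n using s(2) by blast
    have "s (f 0) \<subseteq># s (f 1)"
      unfolding subseteq_mset_def
    proof
      fix v show "count (s (f 0)) v \<le> count (s (f 1)) v"
      proof (cases "v \<in> I")
        case True
        then have "incseq (\<lambda>n. count (s (f n)) v)" using f(2) by blast
        then show ?thesis by (rule incseqD) simp
      next
        case False
        then have "v \<notin># s (f 0)" using sB[of "f 0"] assms(2) by (auto simp: B_def)
        then show ?thesis by (simp add: not_in_iff)
      qed
    qed
    then have "s (f 0) = s (f 1)" using sB[of "f 0"] sB[of "f 1"] by (simp add: B_def)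
    then have "f 0 = f 1" using s(1) by (simp add: inj_eq)
    then show False using f(1) by (simp add: strict_mono_eq)
  qed
  ultimately show ?thesis by (intro exI[of _ B]) (auto simp: B_def)
qed

text \<open>Size below k forces every exponent below k. The resulting count has the correct degree
  |I| in k, and only this degree matters for the dimension.\<close>

lemma finite_bounded_size:
  assumes "finite I"
  shows "finite {m. set_mset m \<subseteq> I \<and> size m < k}"
    "k > 0 \<Longrightarrow> card {m. set_mset m \<subseteq> I \<and> size m < k} \<le> k ^ card I"
proof -
  have sub: "{m. set_mset m \<subseteq> I \<and> size m < k'} \<subseteq> monomial_box k' I" for k'
    by (auto simp: monomial_box_def intro: le_less_trans[OF count_le_size])
  have "{m. set_mset m \<subseteq> I \<and> size m < k} \<subseteq> {m. set_mset m \<subseteq> I \<and> size m < Suc k}" by auto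
  then show "finite {m. set_mset m \<subseteq> I \<and> size m < k}"
    by (rule finite_subset[OF subset_trans[OF _ sub[of "Suc k"]] card_monomial_box(1)[OF assms zero_less_Suc]])
  assume "k > 0"
  then show "card {m. set_mset m \<subseteq> I \<and> size m < k} \<le> k ^ card I"
    using card_mono[OF card_monomial_box(1)[OF assms] sub, of k] card_monomial_box(2)[OF assms, of k]
    by (simp del: One_nat_def)
qed

locale field_power_series = ordered_power_series R I lt + field R
  for R (structure) and I :: "'v set" and lt
begin

definition initial_monomials :: "('v multiset \<Rightarrow> 'a) set \<Rightarrow> 'v multiset set" where
  "initial_monomials L = {a. \<exists>f\<in>L. leading f a}"

lemma finite_smaller: "finite {a. set_mset a \<subseteq> I \<and> lt a m}"
proof (rule finite_subset)
  show "{a. set_mset a \<subseteq> I \<and> lt a m} \<subseteq> {a. set_mset a \<subseteq> I \<and> size a < Suc (size m)}"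
    using lt_size by (auto simp: less_Suc_eq_le)
qed (rule finite_bounded_size(1)[OF fin])

lemma normalized_leading:
  assumes L: "ideal L PS" and a: "a \<in> initial_monomials L"
  shows "\<exists>f\<in>L. leading f a \<and> f a = \<one>"
proof -
  interpret L: ideal L PS by (rule L)
  obtain f where f: "f \<in> L" "leading f a" using a by (auto simp: initial_monomials_def)
  have fc: "f \<in> carrier PS" using f(1) by (rule L.Icarr)
  have u: "f a \<in> Units R" using f(2) fc field_Units by (auto simp: leading_def)
  define g where "g = monom_series R (inv (f a)) {#} \<otimes>\<^bsub>PS\<^esub> f"
  have g: "g m = inv (f a) \<otimes> f m" for m
    unfolding g_def using u fc by (subst monom_mult_coeff) auto
  have "g \<in> L" unfolding g_def using u f(1) by (intro L.I_l_closed) auto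
  moreover have ga: "g a = \<one>" unfolding g using u by (rule Units_l_inv)
  moreover have "leading g a"
  proof -
    have "f m \<noteq> \<zero>" if "g m \<noteq> \<zero>" for m using that u by (auto simp: g)
    then show ?thesis using f(2) ga by (auto simp: leading_def)
  qed
  ultimately show ?thesis by blast
qed

text \<open>By Dickson's lemma finitely many l b have leading monomials b that divide every initial
  monomial of L. Division determines all quotient coefficients together: each initial monomial a is
  charged to one divisor \<beta> a, and the equations at initial monomials form a unitriangular
  system along the order. As the order refines the size, quotients of a series of high order have
  high order, up to the loss c.\<close>

lemma division_by_standard_basis:
  assumes L: "ideal L PS"
  shows "\<exists>(B :: 'v multiset set) l c. finite B \<and> (\<forall>b\<in>B. l b \<in> L) \<and>
    (\<forall>\<mu>\<in>L. \<forall>k. (\<forall>m. size m < k \<longrightarrow> \<mu> m = \<zero>) \<longrightarrow>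
      (\<exists>h. (\<forall>b\<in>B. h b \<in> carrier PS \<and> (\<forall>m. size m + c < k \<longrightarrow> h b m = \<zero>)) \<and>
        \<mu> = (\<Oplus>\<^bsub>PS\<^esub>b\<in>B. h b \<otimes>\<^bsub>PS\<^esub> l b)))"
proof -
  interpret L: ideal L PS by (rule L)
  let ?in = "initial_monomials L"
  have inI: "?in \<subseteq> {m. set_mset m \<subseteq> I}"
    using leading_supp L.Icarr unfolding initial_monomials_def by blast
  obtain B where B: "finite B" "B \<subseteq> ?in" "\<And>a. a \<in> ?in \<Longrightarrow> \<exists>b\<in>B. b \<subseteq># a"
    using dickson[OF fin inI] by blast
  have "\<forall>b\<in>B. \<exists>f. f \<in> L \<and> leading f b \<and> f b = \<one>"
    using normalized_leading[OF L] B(2) by blast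
  then obtain l where l: "\<And>b. b \<in> B \<Longrightarrow> l b \<in> L" "\<And>b. b \<in> B \<Longrightarrow> leading (l b) b" "\<And>b. b \<in> B \<Longrightarrow> l b b = \<one>"
    by metis
  have lc: "l b \<in> carrier PS" if "b \<in> B" for b using l(1)[OF that] by (rule L.Icarr)
  have "\<forall>a\<in>?in. \<exists>b. b \<in> B \<and> b \<subseteq># a" using B(3) by blast
  then obtain \<beta> where \<beta>: "\<And>a. a \<in> ?in \<Longrightarrow> \<beta> a \<in> B" "\<And>a. a \<in> ?in \<Longrightarrow> \<beta> a \<subseteq># a" by metis
  \<comment> \<open>\<open>E a\<close> is l (\<beta> a) multiplied by the monomial a - \<beta> a:
    its leading monomial is a, with coefficient one.\<close>
  define E where "E a m = (if a - \<beta> a \<subseteq># m then l (\<beta> a) (m - (a - \<beta> a)) else \<zero>)" for a m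
  have Ec: "E a m \<in> carrier R" if "a \<in> ?in" for a m
    using lc[OF \<beta>(1)[OF that]] by (auto simp: E_def)
  have Elead: "m = a \<or> lt a m" if a: "a \<in> ?in" and E: "E a m \<noteq> \<zero>" for a m
  proof -
    have sub: "a - \<beta> a \<subseteq># m" and "l (\<beta> a) (m - (a - \<beta> a)) \<noteq> \<zero>" using E by (auto simp: E_def split: if_splits)
    then have "m - (a - \<beta> a) = \<beta> a \<or> lt (\<beta> a) (m - (a - \<beta> a))"
      using l(2)[OF \<beta>(1)[OF a]] by (auto simp: leading_def)
    moreover have "m - (a - \<beta> a) + (a - \<beta> a) = m" using sub by (rule subset_mset.diff_add)
    moreover have "\<beta> a + (a - \<beta> a) = a" using \<beta>(2)[OF a] by (rule subset_mset.add_diff_inverse)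
    ultimately show ?thesis using lt_add[of "\<beta> a" "m - (a - \<beta> a)" "a - \<beta> a"] by metis
  qed
  have Ediag: "E a a = \<one>" if "a \<in> ?in" for a
    using l(3)[OF \<beta>(1)[OF that]] \<beta>(2)[OF that] by (simp add: E_def double_diff_mset)
  \<comment> \<open>Any bound for the sizes of the members of B serves; their sum is one.\<close>
  define c where "c = sum size B"
  have c: "size b \<le> c" if "b \<in> B" for b unfolding c_def using B(1) that by (intro member_le_sum) auto
  have "\<exists>h. (\<forall>b\<in>B. h b \<in> carrier PS \<and> (\<forall>m. size m + c < k \<longrightarrow> h b m = \<zero>)) \<and>
        \<mu> = (\<Oplus>\<^bsub>PS\<^esub>b\<in>B. h b \<otimes>\<^bsub>PS\<^esub> l b)"
    if \<mu>: "\<mu> \<in> L" and k: "\<forall>m. size m < k \<longrightarrow> \<mu> m = \<zero>" for \<mu> k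
  proof -
    have \<mu>c: "\<mu> \<in> carrier PS" using \<mu> by (rule L.Icarr)
    let ?lo = "\<lambda>m. {a \<in> ?in. lt a m}"
    have finlo: "finite (?lo m)" for m
      by (rule finite_subset[OF _ finite_smaller[of m]]) (use inI in auto)
    \<comment> \<open>Solves, for initial monomials m, the equation that the sum of the
      \<open>C a \<otimes> E a m\<close> equals \<open>\<mu> m\<close>, where only a = m and smaller
      a contribute. The test for membership in the carrier permits congruence of sums before C is
      known to take values there.\<close>
    define F where "F C m = (if m \<in> ?in then \<mu> m \<ominus> (\<Oplus>a\<in>?lo m. (if C a \<in> carrier R then C a else \<zero>) \<otimes> E a m) else \<zero>)"
      for C :: "'v multiset \<Rightarrow> 'a" and m
    have "\<exists>C. \<forall>m. C m = F C m"
    proof (rule wf_fixpoint_exists[OF wf_lt])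
      fix C C' :: "'v multiset \<Rightarrow> 'a" and m assume eq: "\<And>m'. (m', m) \<in> {(a, b). lt a b} \<Longrightarrow> C m' = C' m'"
      have "(\<Oplus>a\<in>?lo m. (if C a \<in> carrier R then C a else \<zero>) \<otimes> E a m)
          = (\<Oplus>a\<in>?lo m. (if C' a \<in> carrier R then C' a else \<zero>) \<otimes> E a m)"
        by (rule finsum_cong') (use Ec eq in auto)
      then show "F C m = F C' m" unfolding F_def by simp
    qed
    then obtain C where C: "\<And>m. C m = F C m" by blast
    have sumc: "(\<Oplus>a\<in>?lo m. (if C a \<in> carrier R then C a else \<zero>) \<otimes> E a m) \<in> carrier R" for m
      by (rule finsum_closed) (use Ec in auto)
    have Cc: "C m \<in> carrier R" for m
      unfolding C[of m] F_def using sumc[of m] \<mu>c by auto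
    have Cin: "C m = \<mu> m \<ominus> (\<Oplus>a\<in>?lo m. C a \<otimes> E a m)" if "m \<in> ?in" for m
      using C[of m] that Cc by (simp add: F_def)
    have Cout: "C m = \<zero>" if "m \<notin> ?in" for m using C[of m] that by (simp add: F_def)
    \<comment> \<open>Every monomial preceding m has at most the size of m, so vanishing of
      \<open>\<mu>\<close> below k passes to C by induction along the order.\<close>
    have C0: "C m = \<zero>" if "size m < k" for m
      using that
    proof (induction m rule: wf_induct_rule[OF wf_lt])
      case (1 m)
      show ?case
      proof (cases "m \<in> ?in")
        case True
        have "(\<Oplus>a\<in>?lo m. C a \<otimes> E a m) = \<zero>"
        proof (rule add.finprod_one_eqI)
          fix a assume a: "a \<in> ?lo m"
          then have "size a < k" using lt_size[of a m] 1(2) by simp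
          then have "C a = \<zero>" using 1(1)[of a] a by simp
          then show "C a \<otimes> E a m = \<zero>" using Ec a by simp
        qed
        then show ?thesis using Cin[OF True] k 1(2) by (simp add: minus_eq)
      qed (rule Cout)
    qed
    \<comment> \<open>The quotient for b collects the coefficients of all initial monomials charged
      to b. Its index is shifted down by b, which costs at most c in size.\<close>
    define h where "h b d = (if set_mset d \<subseteq> I \<and> d + b \<in> ?in \<and> \<beta> (d + b) = b then C (d + b) else \<zero>)" for b d
    have h: "h b \<in> carrier PS" for b by (rule ps_carrierI) (simp_all only: h_def Cc zero_closed split: if_split, auto)
    have h0: "h b m = \<zero>" if "b \<in> B" "size m + c < k" for b m
      using that c[OF that(1)] C0[of "m + b"] by (simp add: h_def)
    define T where "T = (\<Oplus>\<^bsub>PS\<^esub>b\<in>B. h b \<otimes>\<^bsub>PS\<^esub> l b)"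
    have TL: "T \<in> L" unfolding T_def
    proof -
      have "(\<Oplus>\<^bsub>PS\<^esub>b\<in>B'. h b \<otimes>\<^bsub>PS\<^esub> l b) \<in> L" if "B' \<subseteq> B" "finite B'" for B'
        using that(2,1)
      proof (induction B' rule: finite_induct)
        case (insert b B')
        then show ?case
          by (subst PS.finsum_insert) (use h lc l(1) in \<open>auto intro!: L.a_closed L.I_l_closed\<close>)
      qed simp
      then show "(\<Oplus>\<^bsub>PS\<^esub>b\<in>B. h b \<otimes>\<^bsub>PS\<^esub> l b) \<in> L" using B(1) by blast
    qed
    have Tm: "T m = \<mu> m" if m: "m \<in> ?in" for m
    proof -
      let ?D = "{d. d \<subseteq># m}"
      let ?good = "{z \<in> B \<times> ?D. set_mset (snd z) \<subseteq> I \<and> snd z + fst z \<in> ?in \<and> \<beta> (snd z + fst z) = fst z}"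
      let ?A = "{a \<in> ?in. a - \<beta> a \<subseteq># m}"
      have "T m = (\<Oplus>b\<in>B. (h b \<otimes>\<^bsub>PS\<^esub> l b) m)"
        unfolding T_def by (rule ps_finsum) (use h lc in auto)
      also have "\<dots> = (\<Oplus>b\<in>B. \<Oplus>d\<in>?D. h b d \<otimes> l b (m - d))" unfolding ps_mult ..
      also have "\<dots> = (\<Oplus>z\<in>B \<times> ?D. h (fst z) (snd z) \<otimes> l (fst z) (m - snd z))"
        by (rule finsum_Sigma) (use B h lc in auto)
      also have "\<dots> = (\<Oplus>z\<in>?good. C (snd z + fst z) \<otimes> E (snd z + fst z) m)"
      proof (rule add.finprod_mono_neutral_cong_right)
        fix z assume z: "z \<in> B \<times> ?D - ?good"
        then have "h (fst z) (snd z) = \<zero>" unfolding h_def by (intro if_not_P) blast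
        then show "h (fst z) (snd z) \<otimes> l (fst z) (m - snd z) = \<zero>" using z lc by auto
      next
        fix z assume z: "z \<in> ?good"
        then have "h (fst z) (snd z) = C (snd z + fst z)" unfolding h_def by (intro if_P) blast
        moreover have "E (snd z + fst z) m = l (fst z) (m - snd z)" using z by (simp add: E_def mem_Times_iff)
        ultimately show "h (fst z) (snd z) \<otimes> l (fst z) (m - snd z) = C (snd z + fst z) \<otimes> E (snd z + fst z) m"
          by simp
      qed (use B h lc in auto)
      also have "\<dots> = (\<Oplus>a\<in>?A. C a \<otimes> E a m)"
      proof (rule finsum_reindex_bij[where h = "\<lambda>z. snd z + fst z"])
        show "bij_betw (\<lambda>z. snd z + fst z) ?good ?A"
        proof (rule bij_betw_byWitness[where f' = "\<lambda>a. (\<beta> a, a - \<beta> a)"])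
          show "\<forall>z\<in>?good. (\<beta> (snd z + fst z), snd z + fst z - \<beta> (snd z + fst z)) = z" by auto
          show "\<forall>a\<in>?A. snd (\<beta> a, a - \<beta> a) + fst (\<beta> a, a - \<beta> a) = a"
            using \<beta>(2) by (simp add: subset_mset.diff_add)
          show "(\<lambda>z. snd z + fst z) ` ?good \<subseteq> ?A" by auto
          have "x \<in> I" if "a \<in> ?in" "x \<in># a - \<beta> a" for a x
            using inI that(1) in_diffD[OF that(2)] by blast
          then show "(\<lambda>a. (\<beta> a, a - \<beta> a)) ` ?A \<subseteq> ?good"
            using \<beta> by (auto simp: subset_mset.diff_add)
        qed
      qed (use Cc Ec in auto)
      \<comment> \<open>The two index sets differ only at monomials a where \<open>E a m\<close> is
        zero: either a - \<beta> a does not divide m, or m precedes the leading monomial a.\<close>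
      also have "\<dots> = (\<Oplus>a\<in>insert m (?lo m). C a \<otimes> E a m)"
      proof (rule add.finprod_mono_neutral_cong)
        have "?A \<subseteq> (\<lambda>z. snd z + fst z) ` (B \<times> ?D)"
        proof
          fix a assume "a \<in> ?A"
          then show "a \<in> (\<lambda>z. snd z + fst z) ` (B \<times> ?D)"
            using \<beta> by (intro image_eqI[of _ _ "(\<beta> a, a - \<beta> a)"]) (auto simp: subset_mset.diff_add)
        qed
        then show "finite ?A" by (rule finite_subset) (use B in auto)
        show "C a \<otimes> E a m = \<zero>" if a: "a \<in> insert m (?lo m) - ?A" for a
        proof -
          have "a \<in> ?in" using a m by auto
          moreover have "E a m = \<zero>" using a m by (auto simp: E_def)
          ultimately show ?thesis using Cc by simp
        qed
        show "C a \<otimes> E a m = \<zero>" if a: "a \<in> ?A - insert m (?lo m)" for a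
        proof -
          have "E a m = \<zero>" using Elead[of a m] a by auto
          then show ?thesis using Cc by simp
        qed
      qed (use finlo Cc Ec m in auto)
      also have "\<dots> = C m \<otimes> E m m \<oplus> (\<Oplus>a\<in>?lo m. C a \<otimes> E a m)"
        by (rule finsum_insert) (use finlo Cc Ec m in auto)
      also have "\<dots> = \<mu> m"
      proof -
        have s: "(\<Oplus>a\<in>?lo m. C a \<otimes> E a m) \<in> carrier R" by (rule finsum_closed) (use Cc Ec in auto)
        then show ?thesis using Cin[OF m] Ediag[OF m] Cc \<mu>c by (simp add: minus_eq a_assoc l_neg)
      qed
      finally show ?thesis .
    qed
    have Tc: "T \<in> carrier PS" using TL by (rule L.Icarr)
    \<comment> \<open>No remainder is left: the difference lies in L and vanishes at all initial
      monomials of L, so it can have no leading monomial.\<close>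
    have "\<mu> \<ominus>\<^bsub>PS\<^esub> T = \<zero>\<^bsub>PS\<^esub>"
    proof (rule ccontr)
      assume "\<mu> \<ominus>\<^bsub>PS\<^esub> T \<noteq> \<zero>\<^bsub>PS\<^esub>"
      then obtain a where a: "leading (\<mu> \<ominus>\<^bsub>PS\<^esub> T) a" using leading_exists \<mu>c Tc PS.minus_closed by blast
      have "\<mu> \<ominus>\<^bsub>PS\<^esub> T \<in> L" unfolding PS.minus_eq using \<mu> TL by (intro L.a_closed L.a_inv_closed)
      then have "a \<in> ?in" using a unfolding initial_monomials_def by blast
      then have "(\<mu> \<ominus>\<^bsub>PS\<^esub> T) a = \<zero>" using Tm \<mu>c Tc by (simp add: ps_diff minus_eq r_neg)
      then show False using a by (simp add: leading_def)
    qed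
    then have "\<mu> = T" using \<mu>c Tc by simp
    then show ?thesis using h h0 unfolding T_def by blast
  qed
  note division = this
  have "finite B \<and> (\<forall>b\<in>B. l b \<in> L) \<and>
    (\<forall>\<mu>\<in>L. \<forall>k. (\<forall>m. size m < k \<longrightarrow> \<mu> m = \<zero>) \<longrightarrow>
      (\<exists>h. (\<forall>b\<in>B. h b \<in> carrier PS \<and> (\<forall>m. size m + c < k \<longrightarrow> h b m = \<zero>)) \<and>
        \<mu> = (\<Oplus>\<^bsub>PS\<^esub>b\<in>B. h b \<otimes>\<^bsub>PS\<^esub> l b)))"
  proof (intro conjI)
    show "finite B" by (rule B(1))
    show "\<forall>b\<in>B. l b \<in> L" by (rule ballI) (rule l(1))
    show "\<forall>\<mu>\<in>L. \<forall>k. (\<forall>m. size m < k \<longrightarrow> \<mu> m = \<zero>) \<longrightarrow>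
      (\<exists>h. (\<forall>b\<in>B. h b \<in> carrier PS \<and> (\<forall>m. size m + c < k \<longrightarrow> h b m = \<zero>)) \<and>
        \<mu> = (\<Oplus>\<^bsub>PS\<^esub>b\<in>B. h b \<otimes>\<^bsub>PS\<^esub> l b))"
      by (rule ballI, rule allI, rule impI) (rule division)
  qed
  then show ?thesis by (intro exI)
qed

end

section \<open>Growth of quotients and the upper bound for chains of primes\<close>

context field_power_series
begin

text \<open>The constant \<^term>\<open>c\<close> bounds the sizes of the initial monomials in a standard basis of the
  ideal generated by \<^term>\<open>P\<close> and \<^term>\<open>x\<close>.\<close>

lemma artin_rees_prime:
  assumes P: "primeideal P PS" and x: "x \<in> carrier PS" "x \<notin> P"
  shows "\<exists>c. \<forall>k. \<forall>g\<in>carrier PS. (\<exists>u\<in>P. \<forall>m. size m < k \<longrightarrow> (x \<otimes>\<^bsub>PS\<^esub> g) m = u m) \<longrightarrow>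
    (\<exists>u\<in>P. \<forall>m. size m + c < k \<longrightarrow> g m = u m)"
proof -
  interpret P: primeideal P PS by (rule P)
  let ?L = "P <+>\<^bsub>PS\<^esub> PIdl\<^bsub>PS\<^esub> x"
  have L: "ideal ?L PS" by (rule PS.add_ideals[OF P.is_ideal PS.cgenideal_ideal[OF x(1)]])
  have LI: "u \<oplus>\<^bsub>PS\<^esub> r \<otimes>\<^bsub>PS\<^esub> x \<in> ?L" if "u \<in> P" "r \<in> carrier PS" for u r
    unfolding set_add_def' cgenideal_def using that by blast
  have LE: "\<exists>u r. u \<in> P \<and> r \<in> carrier PS \<and> y = u \<oplus>\<^bsub>PS\<^esub> r \<otimes>\<^bsub>PS\<^esub> x" if "y \<in> ?L" for y
    using that unfolding set_add_def' cgenideal_def by blast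
  obtain B :: "'v multiset set" and l c where std: "finite B \<and> (\<forall>b\<in>B. l b \<in> ?L) \<and>
    (\<forall>\<mu>\<in>?L. \<forall>k. (\<forall>m. size m < k \<longrightarrow> \<mu> m = \<zero>) \<longrightarrow>
      (\<exists>h. (\<forall>b\<in>B. h b \<in> carrier PS \<and> (\<forall>m. size m + c < k \<longrightarrow> h b m = \<zero>)) \<and>
        \<mu> = (\<Oplus>\<^bsub>PS\<^esub>b\<in>B. h b \<otimes>\<^bsub>PS\<^esub> l b)))"
    using division_by_standard_basis[OF L] by (elim exE) (rule that)
  note B = std[THEN conjunct1] std[THEN conjunct2, THEN conjunct1, rule_format]
    and div = std[THEN conjunct2, THEN conjunct2, rule_format]
  \<comment> \<open>Each basis element is split into a part in P and a multiple of x; expansions in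
    the basis then become expansions of the same kind.\<close>
  have "\<forall>b\<in>B. \<exists>u r. u \<in> P \<and> r \<in> carrier PS \<and> l b = u \<oplus>\<^bsub>PS\<^esub> r \<otimes>\<^bsub>PS\<^esub> x" using LE B(2) by blast
  then obtain U V where UV: "\<And>b. b \<in> B \<Longrightarrow> U b \<in> P" "\<And>b. b \<in> B \<Longrightarrow> V b \<in> carrier PS"
    "\<And>b. b \<in> B \<Longrightarrow> l b = U b \<oplus>\<^bsub>PS\<^esub> V b \<otimes>\<^bsub>PS\<^esub> x" by metis
  have Uc: "U b \<in> carrier PS" if "b \<in> B" for b using UV(1)[OF that] by (rule P.Icarr)
  have main: "\<exists>u\<in>P. \<forall>m. size m + c < k \<longrightarrow> g m = u m"
    if g: "g \<in> carrier PS" and u: "u \<in> P" and eq: "\<forall>m. size m < k \<longrightarrow> (x \<otimes>\<^bsub>PS\<^esub> g) m = u m" for k g u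
  proof -
    have uc: "u \<in> carrier PS" using u by (rule P.Icarr)
    \<comment> \<open>This element g x - u has order at least k and lies in the ideal of P and x, so
      division gives \<open>\<mu>\<close> = p + g' x with p in P and g' of order at least k - c.
      Comparing, (g - g') x lies in P, and since P is prime and x is not in P, g - g' lies in P; it
      agrees with g below order k - c.\<close>
    define \<mu> where "\<mu> = (\<ominus>\<^bsub>PS\<^esub> u) \<oplus>\<^bsub>PS\<^esub> g \<otimes>\<^bsub>PS\<^esub> x"
    have \<mu>L: "\<mu> \<in> ?L" unfolding \<mu>_def using LI g P.a_inv_closed[OF u] by blast
    have \<mu>0: "\<forall>m. size m < k \<longrightarrow> \<mu> m = \<zero>"
      using eq uc by (simp add: \<mu>_def ps_add ps_minus PS.m_comm[OF g x(1)] l_neg)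
    obtain h where h: "\<And>b. b \<in> B \<Longrightarrow> h b \<in> carrier PS"
      "\<And>b m. b \<in> B \<Longrightarrow> size m + c < k \<Longrightarrow> h b m = \<zero>"
      "\<mu> = (\<Oplus>\<^bsub>PS\<^esub>b\<in>B. h b \<otimes>\<^bsub>PS\<^esub> l b)"
      using div[OF \<mu>L, of k] \<mu>0 by blast
    define p where "p = (\<Oplus>\<^bsub>PS\<^esub>b\<in>B. h b \<otimes>\<^bsub>PS\<^esub> U b)"
    define g' where "g' = (\<Oplus>\<^bsub>PS\<^esub>b\<in>B. h b \<otimes>\<^bsub>PS\<^esub> V b)"
    have g'c: "g' \<in> carrier PS" unfolding g'_def using h UV by (intro PS.finsum_closed) auto
    have pP: "p \<in> P"
    proof -
      have "(\<Oplus>\<^bsub>PS\<^esub>b\<in>B'. h b \<otimes>\<^bsub>PS\<^esub> U b) \<in> P" if "finite B'" "B' \<subseteq> B" for B'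
        using that
      proof (induction B' rule: finite_induct)
        case (insert b B')
        then show ?case
          by (subst PS.finsum_insert) (use h Uc UV in \<open>auto intro!: P.a_closed P.I_l_closed\<close>)
      qed simp
      then show ?thesis unfolding p_def using B(1) by blast
    qed
    have pc: "p \<in> carrier PS" using pP by (rule P.Icarr)
    have "\<mu> = (\<Oplus>\<^bsub>PS\<^esub>b\<in>B. h b \<otimes>\<^bsub>PS\<^esub> U b \<oplus>\<^bsub>PS\<^esub> h b \<otimes>\<^bsub>PS\<^esub> V b \<otimes>\<^bsub>PS\<^esub> x)"
      unfolding h(3)
      by (rule PS.finsum_cong') (use h Uc UV x in \<open>auto simp: PS.r_distr PS.m_assoc\<close>)
    also have "\<dots> = p \<oplus>\<^bsub>PS\<^esub> (\<Oplus>\<^bsub>PS\<^esub>b\<in>B. h b \<otimes>\<^bsub>PS\<^esub> V b \<otimes>\<^bsub>PS\<^esub> x)"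
      unfolding p_def by (rule PS.finsum_addf) (use h Uc UV x in auto)
    also have "(\<Oplus>\<^bsub>PS\<^esub>b\<in>B. h b \<otimes>\<^bsub>PS\<^esub> V b \<otimes>\<^bsub>PS\<^esub> x) = g' \<otimes>\<^bsub>PS\<^esub> x"
      unfolding g'_def by (rule PS.finsum_ldistr[symmetric]) (use B h UV x in auto)
    finally have e: "(\<ominus>\<^bsub>PS\<^esub> u) \<oplus>\<^bsub>PS\<^esub> g \<otimes>\<^bsub>PS\<^esub> x = p \<oplus>\<^bsub>PS\<^esub> g' \<otimes>\<^bsub>PS\<^esub> x" unfolding \<mu>_def .
    have "g \<otimes>\<^bsub>PS\<^esub> x \<ominus>\<^bsub>PS\<^esub> g' \<otimes>\<^bsub>PS\<^esub> x = p \<ominus>\<^bsub>PS\<^esub> (\<ominus>\<^bsub>PS\<^esub> u)"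
      by (rule PS.add_eq_imp_minus_eq) (use e uc pc g g'c x in \<open>simp_all add: PS.a_comm\<close>)
    also have "\<dots> \<in> P" unfolding PS.minus_eq using pP u P.a_inv_closed by (intro P.a_closed) auto
    also have "g \<otimes>\<^bsub>PS\<^esub> x \<ominus>\<^bsub>PS\<^esub> g' \<otimes>\<^bsub>PS\<^esub> x = (g \<ominus>\<^bsub>PS\<^esub> g') \<otimes>\<^bsub>PS\<^esub> x"
      using g g'c x by (simp add: PS.minus_eq PS.l_distr PS.l_minus)
    finally have "g \<ominus>\<^bsub>PS\<^esub> g' \<in> P" using P.I_prime[of "g \<ominus>\<^bsub>PS\<^esub> g'" x] g g'c x by auto
    moreover have "g m = (g \<ominus>\<^bsub>PS\<^esub> g') m" if "size m + c < k" for m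
    proof -
      have "g' m = (\<Oplus>b\<in>B. (h b \<otimes>\<^bsub>PS\<^esub> V b) m)"
        unfolding g'_def by (rule ps_finsum) (use h UV in auto)
      also have "\<dots> = \<zero>"
      proof (rule add.finprod_one_eqI)
        fix b assume b: "b \<in> B"
        show "(h b \<otimes>\<^bsub>PS\<^esub> V b) m = \<zero>"
          unfolding ps_mult
        proof (rule add.finprod_one_eqI)
          fix d assume "d \<in> {d. d \<subseteq># m}"
          then have "size d \<le> size m" by (simp add: size_mset_mono)
          then have "h b d = \<zero>" using h(2)[OF b] that by simp
          then show "h b d \<otimes> V b (m - d) = \<zero>" using UV(2)[OF b] by auto
        qed
      qed
      finally have "g' m = \<zero>" .
      then show ?thesis using g g'c by (simp add: ps_diff minus_eq)
    qed
    ultimately show ?thesis by blast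
  qed
  have "\<forall>k. \<forall>g\<in>carrier PS. (\<exists>u\<in>P. \<forall>m. size m < k \<longrightarrow> (x \<otimes>\<^bsub>PS\<^esub> g) m = u m) \<longrightarrow>
    (\<exists>u\<in>P. \<forall>m. size m + c < k \<longrightarrow> g m = u m)"
  proof (intro allI ballI impI)
    fix k g assume g: "g \<in> carrier PS" and "\<exists>u\<in>P. \<forall>m. size m < k \<longrightarrow> (x \<otimes>\<^bsub>PS\<^esub> g) m = u m"
    then obtain u where "u \<in> P" "\<forall>m. size m < k \<longrightarrow> (x \<otimes>\<^bsub>PS\<^esub> g) m = u m" by blast
    then show "\<exists>u\<in>P. \<forall>m. size m + c < k \<longrightarrow> g m = u m" by (rule main[OF g])
  qed
  then show ?thesis by (rule exI[of _ c])
qed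

text \<open>Agreement with an element of \<^term>\<open>P\<close> at all monomials of size below \<^term>\<open>k\<close> encodes membership
  in the sum of \<^term>\<open>P\<close> and the \<^term>\<open>k\<close>-th power of the maximal ideal.\<close>

definition independent_mod :: "nat \<Rightarrow> ('v multiset \<Rightarrow> 'a) set \<Rightarrow> nat \<Rightarrow> bool" where
  "independent_mod r P k \<longleftrightarrow> (\<exists>g. (\<forall>i<r. g i \<in> carrier PS) \<and>
    (\<forall>c. (\<forall>i<r. c i \<in> carrier R) \<longrightarrow>
      (\<exists>u\<in>P. \<forall>m. size m < k \<longrightarrow> (\<Oplus>i\<in>{..<r}. c i \<otimes> g i m) = u m) \<longrightarrow> (\<forall>i<r. c i = \<zero>)))"

text \<open>With h_P(k) for the dimension modulo P and order k, this is h_P(k) \<ge> h_P(k') +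
  h_Q(k). The elements are the x a_i, which vanish modulo Q, and the b_j. A relation modulo P and
  order k, read modulo Q, kills the coefficients of the b_j; what remains is divisible by x, and
  \<open>AR\<close> cancels x at the price of lowering k to k'.\<close>

lemma independent_mod_step:
  assumes P: "ideal P PS" and Q: "ideal Q PS" "P \<subseteq> Q" and x: "x \<in> Q"
    and AR: "\<And>g. g \<in> carrier PS \<Longrightarrow> (\<exists>u\<in>P. \<forall>m. size m < k \<longrightarrow> (x \<otimes>\<^bsub>PS\<^esub> g) m = u m) \<Longrightarrow>
      (\<exists>u\<in>P. \<forall>m. size m < k' \<longrightarrow> g m = u m)"
    and r: "independent_mod r P k'" and s: "independent_mod s Q k"
  shows "independent_mod (r + s) P k"
proof -
  interpret P: ideal P PS by (rule P)
  interpret Q: ideal Q PS by (rule Q(1))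
  have xc: "x \<in> carrier PS" using x by (rule Q.Icarr)
  obtain a where a: "\<And>i. i < r \<Longrightarrow> a i \<in> carrier PS"
    and ai: "\<And>c. (\<forall>i<r. c i \<in> carrier R) \<Longrightarrow> (\<exists>u\<in>P. \<forall>m. size m < k' \<longrightarrow> (\<Oplus>i\<in>{..<r}. c i \<otimes> a i m) = u m)
      \<Longrightarrow> (\<forall>i<r. c i = \<zero>)"
    using r unfolding independent_mod_def by blast
  obtain b where b: "\<And>i. i < s \<Longrightarrow> b i \<in> carrier PS"
    and bi: "\<And>c. (\<forall>i<s. c i \<in> carrier R) \<Longrightarrow> (\<exists>u\<in>Q. \<forall>m. size m < k \<longrightarrow> (\<Oplus>i\<in>{..<s}. c i \<otimes> b i m) = u m)
      \<Longrightarrow> (\<forall>i<s. c i = \<zero>)"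
    using s unfolding independent_mod_def by blast
  define g where "g i = (if i < r then x \<otimes>\<^bsub>PS\<^esub> a i else b (i - r))" for i
  have g: "g i \<in> carrier PS" if "i < r + s" for i using that a b xc by (auto simp: g_def)
  have "\<forall>i<r + s. c i = \<zero>" if c: "\<forall>i<r + s. c i \<in> carrier R"
    and u: "u \<in> P" "\<forall>m. size m < k \<longrightarrow> (\<Oplus>i\<in>{..<r + s}. c i \<otimes> g i m) = u m" for c u
  proof -
    have uc: "u \<in> carrier PS" using u(1) by (rule P.Icarr)
    define A where "A = (\<Oplus>\<^bsub>PS\<^esub>i\<in>{..<r}. monom_series R (c i) {#} \<otimes>\<^bsub>PS\<^esub> a i)"
    have Ac: "A \<in> carrier PS" unfolding A_def using a c by (intro PS.finsum_closed) auto
    have Am: "A m = (\<Oplus>i\<in>{..<r}. c i \<otimes> a i m)" for m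
    proof -
      have "A m = (\<Oplus>i\<in>{..<r}. (monom_series R (c i) {#} \<otimes>\<^bsub>PS\<^esub> a i) m)"
        unfolding A_def by (rule ps_finsum) (use a c in auto)
      also have "\<dots> = (\<Oplus>i\<in>{..<r}. c i \<otimes> a i m)"
        by (rule finsum_cong') (use a c in \<open>auto simp: monom_mult_coeff\<close>)
      finally show ?thesis .
    qed
    have xA: "(x \<otimes>\<^bsub>PS\<^esub> A) m = (\<Oplus>i\<in>{..<r}. c i \<otimes> (x \<otimes>\<^bsub>PS\<^esub> a i) m)" for m
    proof -
      have "x \<otimes>\<^bsub>PS\<^esub> A = (\<Oplus>\<^bsub>PS\<^esub>i\<in>{..<r}. monom_series R (c i) {#} \<otimes>\<^bsub>PS\<^esub> (x \<otimes>\<^bsub>PS\<^esub> a i))"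
        unfolding A_def
        by (subst PS.finsum_rdistr) (use a c xc in \<open>auto intro!: PS.finsum_cong' PS.m_lcomm\<close>)
      then have "(x \<otimes>\<^bsub>PS\<^esub> A) m = (\<Oplus>\<^bsub>PS\<^esub>i\<in>{..<r}. monom_series R (c i) {#} \<otimes>\<^bsub>PS\<^esub> (x \<otimes>\<^bsub>PS\<^esub> a i)) m"
        by (rule fun_cong)
      also have "\<dots> = (\<Oplus>i\<in>{..<r}. (monom_series R (c i) {#} \<otimes>\<^bsub>PS\<^esub> (x \<otimes>\<^bsub>PS\<^esub> a i)) m)"
        by (rule ps_finsum) (use a c xc in auto)
      also have "\<dots> = (\<Oplus>i\<in>{..<r}. c i \<otimes> (x \<otimes>\<^bsub>PS\<^esub> a i) m)"
        by (rule finsum_cong') (use a c xc in \<open>auto simp: monom_mult_coeff\<close>)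
      finally show ?thesis .
    qed
    have split: "(\<Oplus>i\<in>{..<r + s}. c i \<otimes> g i m) = (x \<otimes>\<^bsub>PS\<^esub> A) m \<oplus> (\<Oplus>i\<in>{..<s}. c (r + i) \<otimes> b i m)" for m
    proof -
      have un: "{..<r + s} = {..<r} \<union> (\<lambda>i. r + i) ` {..<s}"
        by (auto simp: image_iff) (metis add.commute le_add_diff_inverse2 less_diff_conv2 not_le lessThan_iff)
      have cg: "c i \<otimes> g i m \<in> carrier R" if "i < r + s" for i using that c g by auto
      have "(\<Oplus>i\<in>{..<r + s}. c i \<otimes> g i m) = (\<Oplus>i\<in>{..<r}. c i \<otimes> g i m) \<oplus> (\<Oplus>i\<in>(\<lambda>i. r + i) ` {..<s}. c i \<otimes> g i m)"
        unfolding un by (rule finsum_Un_disjoint) (use cg in auto)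
      also have "(\<Oplus>i\<in>{..<r}. c i \<otimes> g i m) = (x \<otimes>\<^bsub>PS\<^esub> A) m"
        unfolding xA by (rule finsum_cong') (use a c xc in \<open>auto simp: g_def\<close>)
      also have "(\<Oplus>i\<in>(\<lambda>i. r + i) ` {..<s}. c i \<otimes> g i m) = (\<Oplus>i\<in>{..<s}. c (r + i) \<otimes> g (r + i) m)"
        by (rule finsum_reindex) (use cg in auto)
      also have "\<dots> = (\<Oplus>i\<in>{..<s}. c (r + i) \<otimes> b i m)"
        by (rule finsum_cong') (use b c in \<open>auto simp: g_def\<close>)
      finally show ?thesis .
    qed
    have bc: "(\<Oplus>i\<in>{..<s}. c (r + i) \<otimes> b i m) \<in> carrier R" for m
      by (rule finsum_closed) (use b c in auto)
    have zs: "\<forall>i<s. c (r + i) = \<zero>"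
    proof (rule bi)
      show "\<forall>i<s. c (r + i) \<in> carrier R" using c by simp
      have "u \<ominus>\<^bsub>PS\<^esub> x \<otimes>\<^bsub>PS\<^esub> A \<in> Q"
        unfolding PS.minus_eq using u(1) Q(2) x Ac by (intro Q.a_closed Q.a_inv_closed Q.I_r_closed) auto
      moreover have "(\<Oplus>i\<in>{..<s}. c (r + i) \<otimes> b i m) = (u \<ominus>\<^bsub>PS\<^esub> x \<otimes>\<^bsub>PS\<^esub> A) m" if "size m < k" for m
      proof -
        have xAc: "(x \<otimes>\<^bsub>PS\<^esub> A) m \<in> carrier R" using xc Ac by auto
        have "u m = (x \<otimes>\<^bsub>PS\<^esub> A) m \<oplus> (\<Oplus>i\<in>{..<s}. c (r + i) \<otimes> b i m)"
          using u(2) that split[of m] by simp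
        then have "u m \<ominus> (x \<otimes>\<^bsub>PS\<^esub> A) m = (\<Oplus>i\<in>{..<s}. c (r + i) \<otimes> b i m)"
          using bc[of m] xAc by (simp add: a_comm[OF xAc] minus_eq a_assoc r_neg)
        then show ?thesis using uc xc Ac by (simp add: ps_diff)
      qed
      ultimately show "\<exists>u\<in>Q. \<forall>m. size m < k \<longrightarrow> (\<Oplus>i\<in>{..<s}. c (r + i) \<otimes> b i m) = u m" by blast
    qed
    have "(\<Oplus>i\<in>{..<s}. c (r + i) \<otimes> b i m) = \<zero>" for m
      by (rule add.finprod_one_eqI) (use zs b in auto)
    then have "\<forall>m. size m < k \<longrightarrow> (x \<otimes>\<^bsub>PS\<^esub> A) m = u m" using u(2) split xc Ac by simp
    then have "\<exists>u\<in>P. \<forall>m. size m < k' \<longrightarrow> A m = u m" using AR[OF Ac] u(1) by blast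
    then have "\<forall>i<r. c i = \<zero>" unfolding Am by (intro ai) (use c in auto)
    moreover have "c i = \<zero>" if "r \<le> i" "i < r + s" for i
      using zs that by (metis add_diff_inverse_nat less_diff_conv2 add.commute not_le)
    ultimately show ?thesis by (metis not_le)
  qed
  then show ?thesis unfolding independent_mod_def using g by (intro exI[of _ g]) blast
qed

text \<open>Truncation below size k maps to a space with one coordinate per monomial of size below
  k. More vectors than monomials would have a combination with zero truncation, and zero belongs to
  P.\<close>

lemma independent_mod_bound:
  assumes "independent_mod r P k" "ideal P PS" "k > 0"
  shows "r \<le> k ^ card I"
proof (rule ccontr)
  interpret P: ideal P PS by fact
  let ?B = "{m. set_mset m \<subseteq> I \<and> size m < k}"
  assume "\<not> r \<le> k ^ card I"
  then have lt: "card ?B < card {..<r}" using finite_bounded_size(2)[OF fin assms(3)] by simp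
  obtain g where g: "\<And>i. i < r \<Longrightarrow> g i \<in> carrier PS"
    and gi: "\<And>c. (\<forall>i<r. c i \<in> carrier R) \<Longrightarrow> (\<exists>u\<in>P. \<forall>m. size m < k \<longrightarrow> (\<Oplus>i\<in>{..<r}. c i \<otimes> g i m) = u m)
      \<Longrightarrow> (\<forall>i<r. c i = \<zero>)"
    using assms(1) unfolding independent_mod_def by blast
  obtain c where c: "\<forall>i\<in>{..<r}. c i \<in> carrier R" "\<exists>i\<in>{..<r}. c i \<noteq> \<zero>" "\<forall>m\<in>?B. (\<Oplus>i\<in>{..<r}. c i \<otimes> g i m) = \<zero>"
    using dependent_family[OF finite_bounded_size(1)[OF fin] lt, of "\<lambda>i m. g i m"] g by auto
  have "(\<Oplus>i\<in>{..<r}. c i \<otimes> g i m) = \<zero>\<^bsub>PS\<^esub> m" if "size m < k" for m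
  proof (cases "set_mset m \<subseteq> I")
    case True
    then show ?thesis using c(3) that by (simp add: ps_zero)
  next
    case False
    have "(\<Oplus>i\<in>{..<r}. c i \<otimes> g i m) = \<zero>"
      by (rule add.finprod_one_eqI) (use ps_coeff_outside[OF g False] c(1) in auto)
    then show ?thesis by (simp add: ps_zero)
  qed
  then have "\<exists>u\<in>P. \<forall>m. size m < k \<longrightarrow> (\<Oplus>i\<in>{..<r}. c i \<otimes> g i m) = u m" using P.zero_closed by blast
  then have "\<forall>i<r. c i = \<zero>" using c(1) by (intro gi) auto
  then show False using c(2) by auto
qed

text \<open>A nonzero constant that agrees with an element u of P below order k > 0 would give u an
  invertible constant term, making it a unit in a prime ideal.\<close>

lemma independent_mod_one:
  assumes "primeideal P PS" "k > 0"
  shows "independent_mod 1 P k"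
  unfolding independent_mod_def
proof (intro exI[of _ "\<lambda>_. \<one>\<^bsub>PS\<^esub>"] conjI allI impI)
  interpret P: primeideal P PS by fact
  fix c :: "nat \<Rightarrow> 'a" and i :: nat
  assume c: "\<forall>i<1. c i \<in> carrier R"
    and ex: "\<exists>u\<in>P. \<forall>m. size m < k \<longrightarrow> (\<Oplus>i\<in>{..<1}. c i \<otimes> \<one>\<^bsub>PS\<^esub> m) = u m" and i: "i < 1"
  then obtain u where u: "u \<in> P" "\<forall>m. size m < k \<longrightarrow> (\<Oplus>i\<in>{..<1}. c i \<otimes> \<one>\<^bsub>PS\<^esub> m) = u m" by blast
  have uc: "u \<in> carrier PS" using u(1) by (rule P.Icarr)
  have "{..<1} = {0::nat}" by auto
  then have u0: "u {#} = c 0" using u(2)[rule_format, of "{#}"] assms(2) c by (simp add: ps_one monom_series_def)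
  have "c 0 = \<zero>"
  proof (rule ccontr)
    assume "c 0 \<noteq> \<zero>"
    then have "u {#} \<in> Units R" using u0 c field_Units by simp
    then have U: "u \<in> Units PS" using ps_unit_iff[OF uc] by simp
    then have "inv\<^bsub>PS\<^esub> u \<otimes>\<^bsub>PS\<^esub> u \<in> P" using u(1) by (intro P.I_l_closed) auto
    then have "\<one>\<^bsub>PS\<^esub> \<in> P" using U by simp
    then show False using P.one_imp_carrier P.I_notcarr by simp
  qed
  then show "c i = \<zero>" using i by simp
qed simp

text \<open>Repeated use of \<open>independent_mod_step\<close> along the chain is Pascal's rule:
  the prime t steps below the top acquires dimension at least (j + t - 1 choose t) at an order
  linear in j. At the bottom this has degree n in j, while \<open>independent_mod_bound\<close>
  allows only degree |I|.\<close>

lemma prime_chain_length_le: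
  assumes chain: "prime_chain PS n P"
  shows "n \<le> card I"
proof -
  have pr: "primeideal (P i) PS" if "i \<le> n" for i using chain that by (simp add: prime_chain_def)
  have "\<forall>i<n. \<exists>x. x \<in> P (Suc i) \<and> x \<notin> P i" using chain by (auto simp: prime_chain_def)
  then obtain x where x: "\<And>i. i < n \<Longrightarrow> x i \<in> P (Suc i)" "\<And>i. i < n \<Longrightarrow> x i \<notin> P i" by metis
  have xc: "x i \<in> carrier PS" if i: "i < n" for i
  proof -
    have "ideal (P (Suc i)) PS" using pr[of "Suc i"] i by (auto intro: primeideal.axioms(1))
    then show ?thesis using x(1)[OF i] by (rule ideal.Icarr)
  qed
  have "\<forall>i<n. \<exists>c. \<forall>k. \<forall>g\<in>carrier PS. (\<exists>u\<in>P i. \<forall>m. size m < k \<longrightarrow> (x i \<otimes>\<^bsub>PS\<^esub> g) m = u m) \<longrightarrow>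
    (\<exists>u\<in>P i. \<forall>m. size m + c < k \<longrightarrow> g m = u m)"
    using artin_rees_prime[OF pr xc x(2)] by simp
  then obtain c where c: "\<And>i k g. i < n \<Longrightarrow> g \<in> carrier PS \<Longrightarrow>
    (\<exists>u\<in>P i. \<forall>m. size m < k \<longrightarrow> (x i \<otimes>\<^bsub>PS\<^esub> g) m = u m) \<Longrightarrow> (\<exists>u\<in>P i. \<forall>m. size m + c i < k \<longrightarrow> g m = u m)"
    by metis
  \<comment> \<open>A common step width: the sum is at least every Artin-Rees constant c i.\<close>
  define C where "C = (\<Sum>i<n. c i)"
  have cC: "c i \<le> C" if "i < n" for i unfolding C_def using that by (intro member_le_sum) auto
  \<comment> \<open>Raising j by one raises the order by C, enough to pay for one cancellation. The
    summand 1 keeps the order positive, as \<open>independent_mod_one\<close> demands for t = 0. For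
    j = 0 and t > 0 the binomial coefficient is zero and the claim is vacuous.\<close>
  have indep: "independent_mod (j + t - 1 choose t) (P (n - t)) (j * C + 1)" if "t \<le> n" for t j
    using that
  proof (induction t arbitrary: j)
    case 0
    show ?case using independent_mod_one[OF pr[of n]] by simp
  next
    case (Suc t)
    have st: "Suc t \<le> n" by (rule Suc.prems)
    have IHt: "independent_mod (j + t - 1 choose t) (P (n - t)) (j * C + 1)" for j
      using Suc.IH st by simp
    show ?case
    proof (induction j)
      case 0
      show ?case by (simp add: independent_mod_def binomial_eq_0)
    next
      case (Suc j)
      define i where "i = n - Suc t"
      have i: "i < n" "Suc i = n - t" "n - Suc t = i" using st by (auto simp: i_def)
      have "independent_mod ((j + t choose Suc t) + (j + t choose t)) (P i) (Suc j * C + 1)"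
      proof (rule independent_mod_step[where Q = "P (Suc i)" and x = "x i" and k' = "j * C + 1"])
        show "ideal (P i) PS" "ideal (P (Suc i)) PS"
          using pr[of i] pr[of "Suc i"] i(1) by (auto intro: primeideal.axioms(1))
        show "P i \<subseteq> P (Suc i)" using chain i(1) by (auto simp: prime_chain_def)
        show "x i \<in> P (Suc i)" using x(1) i(1) by blast
        show "independent_mod (j + t choose Suc t) (P i) (j * C + 1)" using Suc.IH i(3) by simp
        show "independent_mod (j + t choose t) (P (Suc i)) (Suc j * C + 1)"
          using IHt[of "Suc j"] i(2) by simp
        fix g assume g: "g \<in> carrier PS"
          and "\<exists>u\<in>P i. \<forall>m. size m < Suc j * C + 1 \<longrightarrow> (x i \<otimes>\<^bsub>PS\<^esub> g) m = u m"
        then obtain u where u: "u \<in> P i" "\<forall>m. size m + c i < Suc j * C + 1 \<longrightarrow> g m = u m"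
          using c[OF i(1) g] by blast
        have "size m + c i < Suc j * C + 1" if "size m < j * C + 1" for m :: "'v multiset"
          using that cC[OF i(1)] by simp
        then show "\<exists>u\<in>P i. \<forall>m. size m < j * C + 1 \<longrightarrow> g m = u m" using u by blast
      qed
      moreover have "(j + t choose Suc t) + (j + t choose t) = (Suc j + Suc t - 1 choose Suc t)" by simp
      ultimately show ?case using i(3) by simp
    qed
  qed
  have bound: "(j + n - 1 choose n) \<le> (j * C + 1) ^ card I" for j
    using independent_mod_bound[OF indep[of n j]] pr[of 0] by (auto intro: primeideal.axioms(1))
  show "n \<le> card I"
  proof (rule ccontr)
    assume "\<not> n \<le> card I"
    then have n: "card I < n" "n > 0" by auto
    \<comment> \<open>The estimates below have constants n^n, from bounding the binomial coefficient
      below, and (C + 1)^|I|, from j C + 1 \<le> j (C + 1). With j one more than their product, j^n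
      would be less than j^(|I| + 1), contrary to |I| < n.\<close>
    define j where "j = n ^ n * (C + 1) ^ card I + 1"
    have "real j ^ n / real n ^ n \<le> (real (j + n - 1) / real n) ^ n"
      unfolding power_divide[symmetric] using n by (intro power_mono divide_right_mono) auto
    also have "\<dots> \<le> real (j + n - 1 choose n)"
      using binomial_ge_n_over_k_pow_k[of n "j + n - 1", where 'a = real] by (simp add: j_def)
    also have "\<dots> \<le> real ((j * C + 1) ^ card I)" using bound[of j] by (simp only: of_nat_le_iff)
    also have "\<dots> \<le> real ((j * (C + 1)) ^ card I)"
      unfolding of_nat_le_iff by (rule power_mono) (simp_all add: j_def)
    finally have "real j ^ n \<le> real n ^ n * real ((j * (C + 1)) ^ card I)"
      using n by (simp add: divide_le_eq mult.commute)
    then have "real (j ^ n) \<le> real (n ^ n * (j * (C + 1)) ^ card I)" by simp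
    then have "j ^ n \<le> n ^ n * (j * (C + 1)) ^ card I" by (simp only: of_nat_le_iff)
    also have "\<dots> = j ^ card I * (n ^ n * (C + 1) ^ card I)"
      by (simp only: power_mult_distrib ac_simps)
    also have "\<dots> < j ^ card I * j" by (simp add: j_def)
    also have "\<dots> = j ^ Suc (card I)" by simp
    also have "\<dots> \<le> j ^ n" using n by (intro power_increasing) (auto simp: j_def)
    finally show False by simp
  qed
qed

end

section \<open>Hypersurfaces in power series rings\<close>

text \<open>The chain through f has its smallest prime above the kernel and maps to A. Conversely,
  the preimage of a chain in A has f in its smallest prime, so the zero ideal of the domain fits
  strictly below it; this extra prime accounts for the subtraction of one.\<close>

theorem (in field) krull_dim_power_series_hypersurface:
  assumes fin: "finite (I :: 'v set)" and \<pi>: "surjective_ring_hom (power_series_ring R I) A \<pi>"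
    and ker: "a_kernel (power_series_ring R I) A \<pi> = PIdl\<^bsub>power_series_ring R I\<^esub> f"
    and f: "f \<in> carrier (power_series_ring R I)" "f \<noteq> \<zero>\<^bsub>power_series_ring R I\<^esub>" "f {#} = \<zero>"
  shows "krull_dim A = enat (card I - 1)"
proof -
  interpret power_series R I by unfold_locales
  obtain lt where lt: "monomial_order I lt" using monomial_order_exists[OF fin] by blast
  interpret field_power_series R I lt
    by (intro field_power_series.intro ordered_power_series.intro power_series_axioms lt field_axioms)
  interpret D: domain PS by (rule ps_domain[OF domain_axioms fin])
  interpret \<pi>: surjective_ring_hom PS A \<pi> by (rule \<pi>)
  have "I \<noteq> {}"
  proof
    assume I: "I = {}"
    have "f m = \<zero>" for m
    proof (cases "m = {#}")
      case False
      then have "\<not> set_mset m \<subseteq> I" using I by auto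
      then show ?thesis by (rule ps_coeff_outside[OF f(1)])
    qed (use f(3) in simp)
    then have "f = \<zero>\<^bsub>PS\<^esub>" by (intro ext) (simp only: ps_zero)
    then show False using f(2) by simp
  qed
  then obtain P where P: "prime_chain PS (card I - 1) P" "f \<in> P 0"
    using power_series_prime_chain_exists[OF fin _ f(1,3)] by blast
  have "ideal (P 0) PS" using P(1) by (auto simp: prime_chain_def intro: primeideal.axioms(1))
  then have "a_kernel PS A \<pi> \<subseteq> P 0" unfolding ker using P(2) by (rule PS.cgenideal_minimal)
  from \<pi>.prime_chain_image[OF P(1) this]
  have "enat (card I - 1) \<in> {enat n | n. \<exists>P. prime_chain A n P}" by blast
  then have "enat (card I - 1) \<le> krull_dim A" unfolding krull_dim_eq_prime_chain by (rule Sup_upper)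
  moreover have "krull_dim A \<le> enat (card I - 1)"
    unfolding krull_dim_eq_prime_chain
  proof (rule Sup_least)
    fix d assume "d \<in> {enat n | n. \<exists>P. prime_chain A n P}"
    then obtain n Q where n: "d = enat n" "prime_chain A n Q" by blast
    note V = \<pi>.prime_chain_vimage[OF n(2)]
    have "ideal (Q 0) A" using n(2) by (auto simp: prime_chain_def intro: primeideal.axioms(1))
    then have z: "\<zero>\<^bsub>A\<^esub> \<in> Q 0" by (rule additive_subgroup.zero_closed[OF ideal.axioms(1)])
    have "f \<in> a_kernel PS A \<pi>" unfolding ker by (rule PS.cgenideal_self[OF f(1)])
    then have "\<pi> f = \<zero>\<^bsub>A\<^esub>" unfolding a_kernel_def' by blast
    then have "f \<in> {r \<in> carrier PS. \<pi> r \<in> Q 0}"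
      by (intro CollectI conjI) (simp_all only: f(1) z)
    moreover have "\<zero>\<^bsub>PS\<^esub> \<in> {r \<in> carrier PS. \<pi> r \<in> Q 0}"
      by (intro CollectI conjI) (simp_all only: \<pi>.hom_zero z PS.zero_closed)
    ultimately have "{\<zero>\<^bsub>PS\<^esub>} \<subset> {r \<in> carrier PS. \<pi> r \<in> Q 0}" using f(2) by blast
    from prime_chain_extend_below[OF V D.zeroprimeideal this]
    have "Suc n \<le> card I" by (rule prime_chain_length_le)
    then show "d \<le> enat (card I - 1)" using n(1) by simp
  qed
  ultimately show ?thesis by (rule antisym[rotated])
qed

text \<open>Packages that A is local with residue field R: the constant term is well defined on A
  because it vanishes on the kernel, and an element with nonzero constant term lifts to a
  unit.\<close>

lemma (in power_series) augmentation_exists: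
  assumes K: "field R" and \<pi>: "surjective_ring_hom PS A \<pi>"
    and ker: "\<forall>f\<in>a_kernel PS A \<pi>. f {#} = \<zero>"
  shows "\<exists>\<epsilon>. \<epsilon> \<in> ring_hom A R \<and> \<epsilon> ` carrier A = carrier R \<and>
    (\<forall>f\<in>carrier PS. \<epsilon> (\<pi> f) = f {#}) \<and> (\<forall>a\<in>carrier A. \<epsilon> a \<noteq> \<zero> \<longrightarrow> a \<in> Units A)"
proof -
  interpret K: field R by (rule K)
  interpret \<pi>: surjective_ring_hom PS A \<pi> by (rule \<pi>)
  \<comment> \<open>An arbitrary set-theoretic section; by \<open>\<epsilon>\<pi>\<close> the
    constant term of a lift is independent of the choice.\<close>
  define s where "s = inv_into (carrier PS) \<pi>"
  have s: "s a \<in> carrier PS" "\<pi> (s a) = a" if "a \<in> carrier A" for a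
  proof -
    have "a \<in> \<pi> ` carrier PS" using that \<pi>.surj by simp
    then show "s a \<in> carrier PS" "\<pi> (s a) = a"
      unfolding s_def by (rule inv_into_into, rule f_inv_into_f)
  qed
  define \<epsilon> where "\<epsilon> a = s a {#}" for a
  have \<epsilon>\<pi>: "\<epsilon> (\<pi> f) = f {#}" if f: "f \<in> carrier PS" for f
  proof -
    have g: "s (\<pi> f) \<in> carrier PS" "\<pi> (s (\<pi> f)) = \<pi> f" using s \<pi>.hom_closed[OF f] by auto
    have z: "\<pi> (s (\<pi> f) \<ominus>\<^bsub>PS\<^esub> f) = \<zero>\<^bsub>A\<^esub>" using f g by (simp add: PS.minus_eq \<pi>.S.r_neg)
    have "s (\<pi> f) \<ominus>\<^bsub>PS\<^esub> f \<in> a_kernel PS A \<pi>"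
      unfolding a_kernel_def' by (intro CollectI conjI PS.minus_closed g(1) f z)
    then have "(s (\<pi> f) \<ominus>\<^bsub>PS\<^esub> f) {#} = \<zero>" by (rule ker[rule_format])
    then have "s (\<pi> f) {#} \<ominus> f {#} = \<zero>" using ps_diff[OF g(1) f] by simp
    then show ?thesis unfolding \<epsilon>_def using f g(1) by simp
  qed
  have ex: "\<exists>f\<in>carrier PS. a = \<pi> f" if "a \<in> carrier A" for a using \<pi>.surjD[OF that] .
  have hom: "\<epsilon> \<in> ring_hom A R"
  proof (rule ring_hom_memI)
    fix a assume "a \<in> carrier A"
    then show "\<epsilon> a \<in> carrier R" unfolding \<epsilon>_def using s(1) by blast
  next
    fix a b assume "a \<in> carrier A" "b \<in> carrier A"
    then obtain f g where f: "f \<in> carrier PS" "a = \<pi> f" and g: "g \<in> carrier PS" "b = \<pi> g" using ex by metis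
    have "\<epsilon> (a \<otimes>\<^bsub>A\<^esub> b) = \<epsilon> (\<pi> (f \<otimes>\<^bsub>PS\<^esub> g))" using f g by simp
    also have "\<dots> = f {#} \<otimes> g {#}"
      using \<epsilon>\<pi>[OF PS.m_closed[OF f(1) g(1)]] ring_hom_mult[OF coeff0_hom f(1) g(1)] by simp
    finally show "\<epsilon> (a \<otimes>\<^bsub>A\<^esub> b) = \<epsilon> a \<otimes> \<epsilon> b" using f g by (simp add: \<epsilon>\<pi>)
    have "\<epsilon> (a \<oplus>\<^bsub>A\<^esub> b) = \<epsilon> (\<pi> (f \<oplus>\<^bsub>PS\<^esub> g))" using f g by simp
    also have "\<dots> = f {#} \<oplus> g {#}"
      using \<epsilon>\<pi>[OF PS.a_closed[OF f(1) g(1)]] by (simp add: ps_add)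
    finally show "\<epsilon> (a \<oplus>\<^bsub>A\<^esub> b) = \<epsilon> a \<oplus> \<epsilon> b" using f g by (simp add: \<epsilon>\<pi>)
  next
    have "\<epsilon> \<one>\<^bsub>A\<^esub> = \<epsilon> (\<pi> \<one>\<^bsub>PS\<^esub>)" by simp
    also have "\<dots> = \<one>" using \<epsilon>\<pi>[OF PS.one_closed] by (simp add: ps_one monom_series_def)
    finally show "\<epsilon> \<one>\<^bsub>A\<^esub> = \<one>" .
  qed
  have surj: "\<epsilon> ` carrier A = carrier R"
  proof
    show "\<epsilon> ` carrier A \<subseteq> carrier R" using ring_hom_closed[OF hom] by blast
    show "carrier R \<subseteq> \<epsilon> ` carrier A"
    proof
      fix a assume a: "a \<in> carrier R"
      have m: "monom_series R a {#} \<in> carrier PS" using a by auto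
      have "\<epsilon> (\<pi> (monom_series R a {#})) = a" using \<epsilon>\<pi>[OF m] by (simp add: monom_series_def)
      then show "a \<in> \<epsilon> ` carrier A" using \<pi>.hom_closed[OF m] by (metis imageI)
    qed
  qed
  have unit: "a \<in> Units A" if a: "a \<in> carrier A" "\<epsilon> a \<noteq> \<zero>" for a
  proof -
    obtain f where f: "f \<in> carrier PS" "a = \<pi> f" using ex[OF a(1)] by blast
    have "f {#} \<in> Units R" using f a(2) K.field_Units by (auto simp: \<epsilon>\<pi>)
    then have U: "f \<in> Units PS" by (rule ps_unitI[OF f(1)])
    have "a \<otimes>\<^bsub>A\<^esub> \<pi> (inv\<^bsub>PS\<^esub> f) = \<pi> (f \<otimes>\<^bsub>PS\<^esub> inv\<^bsub>PS\<^esub> f)"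
      using U f \<pi>.hom_mult[of f "inv\<^bsub>PS\<^esub> f"] by simp
    also have "\<dots> = \<one>\<^bsub>A\<^esub>" using U by simp
    finally show ?thesis using U a(1) by (intro \<pi>.S.Units_of_comm_mult) auto
  qed
  show ?thesis using hom surj \<epsilon>\<pi> unit by blast
qed

lemma (in ring) dimension_carrier: "dimension n F E \<Longrightarrow> F \<subseteq> carrier R \<Longrightarrow> E \<subseteq> carrier R"
proof (induction rule: dimension.induct)
  case (Suc_dim v E n F)
  show ?case
    by (rule line_extension_in_carrier[OF Suc_dim.prems Suc_dim.hyps(1) Suc_dim.IH[OF Suc_dim.prems]])
qed simp

lemma dimension_ring_iso_image:
  assumes R: "ring R" and S: "ring S" and h: "h \<in> ring_iso R S"
    and dim: "ring.dimension R n F E" and F: "F \<subseteq> carrier R"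
  shows "ring.dimension S n (h ` F) (h ` E)"
proof -
  have hom: "h \<in> ring_hom R S" and inj: "inj_on h (carrier R)"
    using h by (auto simp: ring_iso_def bij_betw_def)
  interpret h: ring_hom_ring R S h by (intro ring_hom_ringI2 R S hom)
  show ?thesis using dim F
  proof (induction rule: h.R.dimension.induct)
    case (zero_dim F)
    then show ?case using h.S.dimension.zero_dim[of "h ` F"] by simp
  next
    case (Suc_dim v E n F)
    have E: "E \<subseteq> carrier R" using h.R.dimension_carrier Suc_dim by blast
    have "h v \<notin> h ` E" using inj_on_image_mem_iff[OF inj Suc_dim(1) E] Suc_dim(2) by simp
    then show ?case
      using h.S.dimension.Suc_dim[of "h v" "h ` E" n "h ` F"] Suc_dim E by (simp add: h.line_extension_hom)
  qed
qed

lemma dim_pth_powers_ring_iso: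
  assumes R: "ring R" and S: "ring S" and h: "h \<in> ring_iso R S"
  shows "ring.dim R (pth_powers p R) (carrier R) = ring.dim S (pth_powers p S) (carrier S)"
proof -
  have subR: "pth_powers p R \<subseteq> carrier R" and subS: "pth_powers p S \<subseteq> carrier S"
  proof -
    interpret R: ring R by fact
    interpret S: ring S by fact
    show "pth_powers p R \<subseteq> carrier R" "pth_powers p S \<subseteq> carrier S" by (auto simp: pth_powers_def)
  qed
  have hom: "h \<in> ring_hom R S" and s: "h ` carrier R = carrier S"
    using h by (auto simp: ring_iso_def bij_betw_def)
  interpret h: ring_hom_ring R S h by (intro ring_hom_ringI2 R S hom)
  have "h ` pth_powers p R = (\<lambda>x. h x [^]\<^bsub>S\<^esub> p) ` carrier R"
    unfolding pth_powers_def image_image by (rule image_cong) (auto simp: h.hom_nat_pow)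
  also have "\<dots> = pth_powers p S" unfolding pth_powers_def s[symmetric] image_image ..
  finally have hp: "h ` pth_powers p R = pth_powers p S" .
  let ?g = "inv_into (carrier R) h"
  have g: "?g \<in> ring_iso S R" by (rule ring_iso_set_sym[OF R h])
  have inj: "inj_on h (carrier R)" using h by (auto simp: ring_iso_def bij_betw_def)
  have gp: "?g ` pth_powers p S = pth_powers p R" "?g ` carrier S = carrier R"
    unfolding hp[symmetric] s[symmetric] using inv_into_image_cancel[OF inj] subR by auto
  have "ring.dimension R n (pth_powers p R) (carrier R) \<longleftrightarrow> ring.dimension S n (pth_powers p S) (carrier S)" for n
    using dimension_ring_iso_image[OF R S h _ subR, of n "carrier R"]
      dimension_ring_iso_image[OF S R g _ subS, of n "carrier S"] unfolding hp s gp by blast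
  then show ?thesis unfolding h.R.dim_def h.S.dim_def by simp
qed

text \<open>Everything outside the kernel of \<open>\<epsilon>\<close> is a unit, so the kernel is
  the only maximal ideal and the definite description in \<open>residue_field\<close> denotes it.
  The first isomorphism theorem identifies the residue field with K, and the degree over p-th powers
  is invariant under isomorphism.\<close>

lemma residue_log_degree_eq:
  assumes K: "field K" and A: "cring A" and \<epsilon>: "\<epsilon> \<in> ring_hom A K" and surj: "\<epsilon> ` carrier A = carrier K"
    and unit: "\<And>a. a \<in> carrier A \<Longrightarrow> \<epsilon> a \<noteq> \<zero>\<^bsub>K\<^esub> \<Longrightarrow> a \<in> Units A"
  shows "residue_log_degree p A = log p (real (ring.dim K (pth_powers p K) (carrier K)))"
proof -
  interpret K: field K by (rule K)
  interpret A: cring A by (rule A)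
  interpret \<epsilon>: ring_hom_ring A K \<epsilon> by (intro ring_hom_ringI2 A.ring_axioms K.ring_axioms \<epsilon>)
  let ?M = "a_kernel A K \<epsilon>"
  have ideal: "ideal ?M A" by (rule \<epsilon>.kernel_is_ideal)
  have whole: "J = carrier A" if J: "ideal J A" and a: "a \<in> J" "a \<notin> ?M" for J a
  proof -
    interpret J: ideal J A by (rule J)
    have aA: "a \<in> carrier A" using a(1) by (rule J.Icarr)
    then have "\<epsilon> a \<noteq> \<zero>\<^bsub>K\<^esub>" using a(2) unfolding a_kernel_def' by blast
    with aA have U: "a \<in> Units A" by (rule unit)
    then have "inv\<^bsub>A\<^esub> a \<otimes>\<^bsub>A\<^esub> a \<in> J" using a(1) by (intro J.I_l_closed) auto
    then show ?thesis using U J.one_imp_carrier by simp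
  qed
  have notc: "carrier A \<noteq> ?M"
  proof
    assume "carrier A = ?M"
    then have "\<one>\<^bsub>A\<^esub> \<in> ?M" using A.one_closed by blast
    then have "\<epsilon> \<one>\<^bsub>A\<^esub> = \<zero>\<^bsub>K\<^esub>" unfolding a_kernel_def' by blast
    then show False by simp
  qed
  have max: "maximalideal ?M A"
  proof (rule maximalidealI[OF ideal notc])
    fix J assume J: "ideal J A" "?M \<subseteq> J" "J \<subseteq> carrier A"
    then show "J = ?M \<or> J = carrier A" using whole[OF J(1)] by blast
  qed
  have "(THE M. maximalideal M A) = ?M"
  proof (rule the_equality[where P = "\<lambda>M. maximalideal M A", OF max])
    fix M assume M: "maximalideal M A"
    interpret M: maximalideal M A by (rule M)
    have "M \<subseteq> ?M" using whole[OF M.is_ideal] M.I_notcarr by blast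
    moreover have "?M \<subseteq> carrier A" unfolding a_kernel_def' by blast
    ultimately show "M = ?M" using M.I_maximal[OF ideal] notc by blast
  qed
  then have k: "residue_field A = A Quot ?M" by (simp add: residue_field_def)
  have iso: "(\<lambda>Y. the_elem (\<epsilon> ` Y)) \<in> ring_iso (A Quot ?M) K" by (rule \<epsilon>.FactRing_iso_set[OF surj])
  have "ring (A Quot ?M)" by (rule ideal.quotient_is_ring[OF ideal])
  from dim_pth_powers_ring_iso[OF this K.ring_axioms iso]
  show ?thesis unfolding residue_log_degree_def k Let_def by simp
qed

section \<open>Transfer along ring homomorphisms and isomorphisms\<close>

lemma cring_char_p_image:
  assumes R: "cring_char_p R p" and S: "cring S" and h: "h \<in> ring_hom R S"
  shows "cring_char_p S p"
proof -
  interpret R: cring_char_p R p by (rule R)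
  interpret S: cring S by (rule S)
  interpret h: ring_hom_cring R S h by unfold_locales (rule h)
  have "h (add_pow R n \<one>\<^bsub>R\<^esub>) = add_pow S n \<one>\<^bsub>S\<^esub>" for n :: nat
    by (induction n) simp_all
  from this[of p] have "add_pow S p \<one>\<^bsub>S\<^esub> = \<zero>\<^bsub>S\<^esub>" by (simp add: R.char_p)
  then show ?thesis using R.prime_p by unfold_locales
qed

lemma frobenius_dual_system_ring_iso:
  assumes R: "ring R" and S: "ring S" and h: "h \<in> ring_iso R S"
    and D: "frobenius_dual_system p e R r x \<phi>"
  shows "\<exists>x \<phi>. frobenius_dual_system p e S r x \<phi>"
proof -
  have hom: "h \<in> ring_hom R S" and s: "h ` carrier R = carrier S" and inj: "inj_on h (carrier R)"
    using h by (auto simp: ring_iso_def bij_betw_def)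
  interpret h: ring_hom_ring R S h by (intro ring_hom_ringI2 R S hom)
  let ?g = "inv_into (carrier R) h"
  have "?g \<in> ring_iso S R" by (rule ring_iso_set_sym[OF R h])
  then have g: "?g \<in> ring_hom S R" by (auto simp: ring_iso_def)
  interpret g: ring_hom_ring S R ?g by (intro ring_hom_ringI2 R S g)
  have gh: "?g (h a) = a" if "a \<in> carrier R" for a using inv_into_f_f[OF inj that] .
  have hg: "h (?g b) = b" if "b \<in> carrier S" for b using that s by (auto intro: f_inv_into_f)
  have "frobenius_dual_system p e S r (\<lambda>i. h (x i)) (\<lambda>i z. h (\<phi> i (?g z)))"
    using D unfolding frobenius_dual_system_def dual_system_def linear_functional_frobenius_iff
    by (auto simp: frobenius_pushforward_def gh hg Pi_iff g.hom_nat_pow)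
  then show ?thesis by blast
qed

lemma frobenius_free_rank_ring_iso:
  assumes R: "cring_char_p R p" and S: "cring_char_p S p" and h: "h \<in> ring_iso R S"
  shows "frobenius_free_rank p R e = frobenius_free_rank p S e"
proof -
  interpret R: cring_char_p R p by (rule R)
  interpret S: cring_char_p S p by (rule S)
  have "(\<exists>x \<phi>. frobenius_dual_system p e R r x \<phi>) \<longleftrightarrow> (\<exists>x \<phi>. frobenius_dual_system p e S r x \<phi>)" for r
    using frobenius_dual_system_ring_iso[OF R.ring_axioms S.ring_axioms h]
      frobenius_dual_system_ring_iso[OF S.ring_axioms R.ring_axioms ring_iso_set_sym[OF R.ring_axioms h]] by blast
  then show ?thesis unfolding R.frobenius_free_rank_eq S.frobenius_free_rank_eq by simp
qed

section \<open>Iterated power series\<close>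

definition join_mset :: "'u multiset \<Rightarrow> 'v multiset \<Rightarrow> ('u + 'v) multiset" where
  "join_mset x y = image_mset Inl x + image_mset Inr y"

definition left_mset :: "('u + 'v) multiset \<Rightarrow> 'u multiset" where
  "left_mset m = image_mset projl (filter_mset isl m)"

definition right_mset :: "('u + 'v) multiset \<Rightarrow> 'v multiset" where
  "right_mset m = image_mset projr (filter_mset (\<lambda>z. \<not> isl z) m)"

lemma left_join [simp]:
  fixes x :: "'u multiset" and y :: "'v multiset"
  shows "left_mset (join_mset x y) = x"
proof -
  have "filter_mset isl (image_mset (Inr :: 'v \<Rightarrow> 'u + 'v) y) = {#}" by (induction y) auto
  moreover have "filter_mset isl (image_mset (Inl :: 'u \<Rightarrow> 'u + 'v) x) = image_mset Inl x" by (induction x) auto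
  ultimately show ?thesis by (simp add: left_mset_def join_mset_def multiset.map_comp comp_def)
qed

lemma right_join [simp]:
  fixes x :: "'u multiset" and y :: "'v multiset"
  shows "right_mset (join_mset x y) = y"
proof -
  have "filter_mset (\<lambda>z. \<not> isl z) (image_mset (Inl :: 'u \<Rightarrow> 'u + 'v) x) = {#}" by (induction x) auto
  moreover have "filter_mset (\<lambda>z. \<not> isl z) (image_mset (Inr :: 'v \<Rightarrow> 'u + 'v) y) = image_mset Inr y"
    by (induction y) auto
  ultimately show ?thesis by (simp add: right_mset_def join_mset_def multiset.map_comp comp_def)
qed

lemma join_left_right [simp]: "join_mset (left_mset m) (right_mset m) = m"
proof (induction m)
  case (add z m)
  then show ?case by (cases z) (auto simp: join_mset_def left_mset_def right_mset_def)
qed (simp add: join_mset_def left_mset_def right_mset_def)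

lemma left_mono: "e \<subseteq># m \<Longrightarrow> left_mset e \<subseteq># left_mset m"
  by (simp add: left_mset_def image_mset_subseteq_mono multiset_filter_mono)

lemma right_mono: "e \<subseteq># m \<Longrightarrow> right_mset e \<subseteq># right_mset m"
  by (simp add: right_mset_def image_mset_subseteq_mono multiset_filter_mono)

lemma join_mono: "c \<subseteq># x \<Longrightarrow> d \<subseteq># y \<Longrightarrow> join_mset c d \<subseteq># join_mset x y"
  by (simp add: join_mset_def image_mset_subseteq_mono subset_mset.add_mono)

lemma join_diff:
  assumes "c \<subseteq># x" "d \<subseteq># y"
  shows "join_mset x y - join_mset c d = join_mset (x - c) (y - d)"
proof -
  have "join_mset x y = join_mset (c + (x - c)) (d + (y - d))" using assms by simp
  also have "\<dots> = join_mset c d + join_mset (x - c) (y - d)"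
    unfolding join_mset_def image_mset_union by (simp only: ac_simps)
  finally show ?thesis by simp
qed

lemma set_join: "set_mset (join_mset x y) \<subseteq> U <+> Y \<longleftrightarrow> set_mset x \<subseteq> U \<and> set_mset y \<subseteq> Y"
  by (auto simp: join_mset_def)

definition curry_series :: "(('u + 'v) multiset \<Rightarrow> 'a) \<Rightarrow> ('v multiset \<Rightarrow> 'u multiset \<Rightarrow> 'a)" where
  "curry_series F y x = F (join_mset x y)"

text \<open>A monomial in a disjoint union of variables is a pair of monomials, and its divisors are
  the pairs of divisors, so the double convolution is the single one. This presents a quotient of
  S[[J]] as a quotient of a power series ring over K, where the dimension theorem applies.\<close>

lemma (in cring) curry_series_iso:
  fixes U :: "'u set" and Y :: "'v set"
  defines "S \<equiv> power_series_ring R U"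
  shows "curry_series \<in> ring_iso (power_series_ring R (U <+> Y)) (power_series_ring S Y)"
proof -
  interpret T: power_series R "U <+> Y" by unfold_locales
  interpret U: power_series R U by unfold_locales
  interpret S: cring S unfolding S_def by (rule U.ps_cring)
  interpret Y: power_series S Y by unfold_locales
  have c: "curry_series F \<in> carrier Y.PS" if F: "F \<in> carrier T.PS" for F
  proof (rule Y.ps_carrierI)
    fix y
    show "curry_series F y \<in> carrier S" unfolding S_def
    proof (rule U.ps_carrierI)
      fix x assume "\<not> set_mset x \<subseteq> U"
      then have "\<not> set_mset (join_mset x y) \<subseteq> U <+> Y" unfolding set_join by blast
      then show "curry_series F y x = \<zero>" unfolding curry_series_def by (rule T.ps_coeff_outside[OF F])
    qed (use F in \<open>auto simp: curry_series_def\<close>)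
    assume y: "\<not> set_mset y \<subseteq> Y"
    have "curry_series F y x = \<zero>" for x
    proof -
      have "\<not> set_mset (join_mset x y) \<subseteq> U <+> Y" unfolding set_join using y by blast
      then show ?thesis unfolding curry_series_def by (rule T.ps_coeff_outside[OF F])
    qed
    then show "curry_series F y = \<zero>\<^bsub>S\<^esub>" unfolding S_def by (intro ext) (simp only: U.ps_zero)
  qed
  have hom: "curry_series \<in> ring_hom T.PS Y.PS"
  proof (rule ring_hom_memI)
    fix F G assume FG: "F \<in> carrier T.PS" "G \<in> carrier T.PS"
    show "curry_series (F \<otimes>\<^bsub>T.PS\<^esub> G) = curry_series F \<otimes>\<^bsub>Y.PS\<^esub> curry_series G"
    proof (intro ext)
      fix y x
      have cF: "curry_series F d \<in> carrier U.PS" "curry_series G d \<in> carrier U.PS" for d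
        using Y.ps_coeff_closed[OF c[OF FG(1)], of d] Y.ps_coeff_closed[OF c[OF FG(2)], of d]
        unfolding S_def by auto
      have "(curry_series F \<otimes>\<^bsub>Y.PS\<^esub> curry_series G) y x
          = (\<Oplus>\<^bsub>U.PS\<^esub>d\<in>{d. d \<subseteq># y}. curry_series F d \<otimes>\<^bsub>U.PS\<^esub> curry_series G (y - d)) x"
        unfolding Y.ps_mult unfolding S_def ..
      also have "\<dots> = (\<Oplus>d\<in>{d. d \<subseteq># y}. (curry_series F d \<otimes>\<^bsub>U.PS\<^esub> curry_series G (y - d)) x)"
        by (rule U.ps_finsum) (use cF in auto)
      also have "\<dots> = (\<Oplus>d\<in>{d. d \<subseteq># y}. \<Oplus>e\<in>{e. e \<subseteq># x}. F (join_mset e d) \<otimes> G (join_mset (x - e) (y - d)))"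
        unfolding U.ps_mult curry_series_def ..
      also have "\<dots> = (\<Oplus>z\<in>{d. d \<subseteq># y} \<times> {e. e \<subseteq># x}.
          F (join_mset (snd z) (fst z)) \<otimes> G (join_mset (x - snd z) (y - fst z)))"
        by (rule finsum_Sigma) (use FG in auto)
      also have "\<dots> = (\<Oplus>m\<in>{m. m \<subseteq># join_mset x y}. F m \<otimes> G (join_mset x y - m))"
      proof (rule finsum_reindex_bij[where h = "\<lambda>z. join_mset (snd z) (fst z)"])
        show "bij_betw (\<lambda>z. join_mset (snd z) (fst z)) ({d. d \<subseteq># y} \<times> {e. e \<subseteq># x}) {m. m \<subseteq># join_mset x y}"
        proof (rule bij_betw_byWitness[where f' = "\<lambda>m. (right_mset m, left_mset m)"])
          show "(\<lambda>m. (right_mset m, left_mset m)) ` {m. m \<subseteq># join_mset x y} \<subseteq> {d. d \<subseteq># y} \<times> {e. e \<subseteq># x}"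
            using left_mono[of _ "join_mset x y"] right_mono[of _ "join_mset x y"] by auto
        qed (auto intro: join_mono)
      qed (use FG in \<open>auto simp: join_diff\<close>)
      also have "\<dots> = curry_series (F \<otimes>\<^bsub>T.PS\<^esub> G) y x" unfolding curry_series_def T.ps_mult ..
      finally show "curry_series (F \<otimes>\<^bsub>T.PS\<^esub> G) y x = (curry_series F \<otimes>\<^bsub>Y.PS\<^esub> curry_series G) y x" by simp
    qed
    show "curry_series (F \<oplus>\<^bsub>T.PS\<^esub> G) = curry_series F \<oplus>\<^bsub>Y.PS\<^esub> curry_series G"
      by (intro ext) (simp add: curry_series_def T.ps_add Y.ps_add, simp add: S_def U.ps_add curry_series_def)
  next
    have e: "join_mset x y = {#} \<longleftrightarrow> x = {#} \<and> y = {#}" for x :: "'u multiset" and y :: "'v multiset"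
      by (simp add: join_mset_def)
    show "curry_series \<one>\<^bsub>T.PS\<^esub> = \<one>\<^bsub>Y.PS\<^esub>"
      by (intro ext) (simp add: curry_series_def T.ps_one Y.ps_one monom_series_def e,
          simp add: S_def U.ps_one U.ps_zero monom_series_def)
  qed (rule c)
  have "inj_on curry_series (carrier T.PS)"
  proof (rule inj_onI)
    fix F G :: "('u + 'v) multiset \<Rightarrow> 'a" assume eq: "curry_series F = curry_series G"
    show "F = G"
    proof
      fix m show "F m = G m"
        using fun_cong[OF fun_cong[OF eq, of "right_mset m"], of "left_mset m"] by (simp add: curry_series_def)
    qed
  qed
  moreover have "curry_series ` carrier T.PS = carrier Y.PS"
  proof
    show "curry_series ` carrier T.PS \<subseteq> carrier Y.PS" using c by blast
    show "carrier Y.PS \<subseteq> curry_series ` carrier T.PS"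
    proof
      fix G assume G: "G \<in> carrier Y.PS"
      have Gy: "G y \<in> carrier U.PS" for y using Y.ps_coeff_closed[OF G, of y] unfolding S_def .
      define F where "F m = G (right_mset m) (left_mset m)" for m
      have "F \<in> carrier T.PS"
      proof (rule T.ps_carrierI)
        fix m :: "('u + 'v) multiset" assume m: "\<not> set_mset m \<subseteq> U <+> Y"
        show "F m = \<zero>"
        proof (cases "set_mset (right_mset m) \<subseteq> Y")
          case True
          then have "\<not> set_mset (left_mset m) \<subseteq> U" using m set_join[of "left_mset m" "right_mset m" U Y] by simp
          then show ?thesis unfolding F_def by (rule U.ps_coeff_outside[OF Gy])
        next
          case False
          then have "G (right_mset m) = \<zero>\<^bsub>U.PS\<^esub>" using Y.ps_coeff_outside[OF G False] unfolding S_def by simp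
          then show ?thesis unfolding F_def by (simp only: U.ps_zero)
        qed
      qed (use Gy in \<open>auto simp: F_def\<close>)
      moreover have "curry_series F = G" by (intro ext) (simp add: curry_series_def F_def)
      ultimately show "G \<in> curry_series ` carrier T.PS" by blast
    qed
  qed
  ultimately show ?thesis using hom by (simp add: ring_iso_def bij_betw_def)
qed

section \<open>Power series over a quotient ring\<close>

lemma coefficientwise_hom:
  assumes "surjective_ring_hom R S h"
  shows "surjective_ring_hom (power_series_ring R J) (power_series_ring S J) (\<lambda>f m. h (f m))"
proof -
  interpret h: surjective_ring_hom R S h by fact
  interpret P: power_series R J by unfold_locales
  interpret Q: power_series S J by unfold_locales
  let ?H = "\<lambda>f m. h (f m)"
  have c: "?H f \<in> carrier Q.PS" if f: "f \<in> carrier P.PS" for f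
  proof (rule Q.ps_carrierI)
    fix m show "h (f m) \<in> carrier S" using f by auto
    assume "\<not> set_mset m \<subseteq> J"
    then have "f m = \<zero>\<^bsub>R\<^esub>" by (rule P.ps_coeff_outside[OF f])
    then show "h (f m) = \<zero>\<^bsub>S\<^esub>" by simp
  qed
  have hom: "?H \<in> ring_hom P.PS Q.PS"
  proof (rule ring_hom_memI)
    fix f g assume fg: "f \<in> carrier P.PS" "g \<in> carrier P.PS"
    show "?H (f \<otimes>\<^bsub>P.PS\<^esub> g) = ?H f \<otimes>\<^bsub>Q.PS\<^esub> ?H g"
    proof
      fix m
      have "h ((f \<otimes>\<^bsub>P.PS\<^esub> g) m) = (\<Oplus>\<^bsub>S\<^esub>d\<in>{d. d \<subseteq># m}. h (f d \<otimes>\<^bsub>R\<^esub> g (m - d)))"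
        unfolding P.ps_mult
        by (rule additive_map_finsum[OF h.R.is_abelian_group h.S.is_abelian_group]) (use fg in auto)
      also have "\<dots> = (?H f \<otimes>\<^bsub>Q.PS\<^esub> ?H g) m"
        unfolding Q.ps_mult by (rule h.S.finsum_cong') (use fg in auto)
      finally show "h ((f \<otimes>\<^bsub>P.PS\<^esub> g) m) = (?H f \<otimes>\<^bsub>Q.PS\<^esub> ?H g) m" .
    qed
    show "?H (f \<oplus>\<^bsub>P.PS\<^esub> g) = ?H f \<oplus>\<^bsub>Q.PS\<^esub> ?H g"
      using fg by (intro ext) (simp add: P.ps_add Q.ps_add)
  next
    show "?H \<one>\<^bsub>P.PS\<^esub> = \<one>\<^bsub>Q.PS\<^esub>"
      by (intro ext) (simp add: P.ps_one Q.ps_one monom_series_def)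
  qed (rule c)
  have "?H ` carrier P.PS = carrier Q.PS"
  proof
    show "?H ` carrier P.PS \<subseteq> carrier Q.PS" using c by blast
    show "carrier Q.PS \<subseteq> ?H ` carrier P.PS"
    proof
      fix g assume g: "g \<in> carrier Q.PS"
      have "\<forall>m. \<exists>r. r \<in> carrier R \<and> g m = h r" using h.surjD Q.ps_coeff_closed[OF g] by blast
      then obtain s where s: "\<And>m. s m \<in> carrier R" "\<And>m. g m = h (s m)" by metis
      define f where "f m = (if set_mset m \<subseteq> J then s m else \<zero>\<^bsub>R\<^esub>)" for m
      have "f \<in> carrier P.PS" by (rule P.ps_carrierI) (simp_all only: f_def s h.R.zero_closed if_False split: if_split, simp)
      moreover have "g = ?H f"
      proof
        fix m show "g m = h (f m)"
        proof (cases "set_mset m \<subseteq> J")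
          case True
          then show ?thesis by (simp only: f_def if_True s(2))
        next
          case False
          then show ?thesis using Q.ps_coeff_outside[OF g False] by (simp only: f_def if_False h.hom_zero)
        qed
      qed
      ultimately show "g \<in> ?H ` carrier P.PS" using image_eqI[of g ?H f "carrier P.PS"] by blast
    qed
  qed
  then show ?thesis
    using hom P.ps_cring Q.ps_cring
    by (intro surjective_ring_hom.intro ring_hom_cring.intro ring_hom_cring_axioms.intro
        surjective_ring_hom_axioms.intro)
qed

text \<open>As the kernel of h is generated by the single element f, a cofactor can be chosen for
  each coefficient separately, and these cofactors form one series.\<close>

lemma coefficientwise_kernel:
  assumes h: "surjective_ring_hom R S h" and f: "f \<in> carrier R" and ker: "a_kernel R S h = PIdl\<^bsub>R\<^esub> f"
  shows "a_kernel (power_series_ring R J) (power_series_ring S J) (\<lambda>g m. h (g m))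
    = PIdl\<^bsub>power_series_ring R J\<^esub> (const_series R f)"
proof -
  interpret h: surjective_ring_hom R S h by fact
  interpret P: power_series R J by unfold_locales
  interpret Q: power_series S J by unfold_locales
  have k: "r \<in> carrier R \<Longrightarrow> h r = \<zero>\<^bsub>S\<^esub> \<longleftrightarrow> (\<exists>t\<in>carrier R. r = t \<otimes>\<^bsub>R\<^esub> f)" for r
    using ker unfolding a_kernel_def' cgenideal_def by blast
  have cf: "const_series R f \<in> carrier P.PS" using f by (simp add: const_series_eq_monom P.monom_closed)
  have mult: "(g \<otimes>\<^bsub>P.PS\<^esub> const_series R f) m = g m \<otimes>\<^bsub>R\<^esub> f" if g: "g \<in> carrier P.PS" for g m
    unfolding P.PS.m_comm[OF g cf] unfolding const_series_eq_monom
    using P.monom_mult_coeff[OF f g, of "{#}" m] P.ps_coeff_closed[OF g, of m] f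
    by (simp add: h.R.m_comm)
  show ?thesis
  proof
    show "a_kernel P.PS Q.PS (\<lambda>g m. h (g m)) \<subseteq> PIdl\<^bsub>P.PS\<^esub> (const_series R f)"
    proof
      fix g assume "g \<in> a_kernel P.PS Q.PS (\<lambda>g m. h (g m))"
      then have g: "g \<in> carrier P.PS" and "(\<lambda>m. h (g m)) = \<zero>\<^bsub>Q.PS\<^esub>" unfolding a_kernel_def' by blast+
      then have "h (g m) = \<zero>\<^bsub>S\<^esub>" for m using fun_cong[of "\<lambda>m. h (g m)" "\<zero>\<^bsub>Q.PS\<^esub>" m] by (simp add: Q.ps_zero)
      then have "\<forall>m. \<exists>t. t \<in> carrier R \<and> g m = t \<otimes>\<^bsub>R\<^esub> f" using k P.ps_coeff_closed[OF g] by blast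
      then obtain t where t: "\<And>m. t m \<in> carrier R" "\<And>m. g m = t m \<otimes>\<^bsub>R\<^esub> f" by metis
      \<comment> \<open>The chosen cofactors are reset to zero outside the variables J, where the
        coefficients of g vanish, to obtain a member of the power series ring.\<close>
      define t' where "t' m = (if set_mset m \<subseteq> J then t m else \<zero>\<^bsub>R\<^esub>)" for m
      have t': "t' \<in> carrier P.PS" by (rule P.ps_carrierI) (simp_all only: t'_def t h.R.zero_closed if_False split: if_split, simp)
      have "g = t' \<otimes>\<^bsub>P.PS\<^esub> const_series R f"
      proof
        fix m show "g m = (t' \<otimes>\<^bsub>P.PS\<^esub> const_series R f) m"
          unfolding mult[OF t']
        proof (cases "set_mset m \<subseteq> J")
          case True
          then show "g m = t' m \<otimes>\<^bsub>R\<^esub> f" by (simp only: t'_def if_True t(2))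
        next
          case False
          then show "g m = t' m \<otimes>\<^bsub>R\<^esub> f"
            using P.ps_coeff_outside[OF g False] f by (simp only: t'_def if_False h.R.l_null)
        qed
      qed
      then show "g \<in> PIdl\<^bsub>P.PS\<^esub> (const_series R f)" using t' unfolding cgenideal_def by blast
    qed
    show "PIdl\<^bsub>P.PS\<^esub> (const_series R f) \<subseteq> a_kernel P.PS Q.PS (\<lambda>g m. h (g m))"
    proof
      fix g assume "g \<in> PIdl\<^bsub>P.PS\<^esub> (const_series R f)"
      then obtain t where t: "t \<in> carrier P.PS" "g = t \<otimes>\<^bsub>P.PS\<^esub> const_series R f" unfolding cgenideal_def by blast
      have "h (g m) = \<zero>\<^bsub>Q.PS\<^esub> m" for m
      proof -
        have "t m \<in> carrier R" using t(1) by (rule P.ps_coeff_closed)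
        then have "h (t m \<otimes>\<^bsub>R\<^esub> f) = \<zero>\<^bsub>S\<^esub>" using k[of "t m \<otimes>\<^bsub>R\<^esub> f"] f by blast
        then show ?thesis unfolding t(2) mult[OF t(1)] Q.ps_zero .
      qed
      then have "(\<lambda>m. h (g m)) = \<zero>\<^bsub>Q.PS\<^esub>" by (rule ext)
      moreover have "g \<in> carrier P.PS" using t cf by simp
      ultimately show "g \<in> a_kernel P.PS Q.PS (\<lambda>g m. h (g m))" unfolding a_kernel_def' by blast
    qed
  qed
qed

lemma (in cring) quotient_surjective_ring_hom:
  assumes I: "ideal I R"
  shows "surjective_ring_hom R (R Quot I) ((+>) I)" "a_kernel R (R Quot I) ((+>) I) = I"
proof -
  interpret I: ideal I R by (rule I)
  have "cring (R Quot I)" by (rule I.quotient_is_cring[OF is_cring])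
  moreover have "(+>) I ` carrier R = carrier (R Quot I)" by (auto simp: FactRing_def A_RCOSETS_def')
  ultimately show "surjective_ring_hom R (R Quot I) ((+>) I)"
    using I.rcos_ring_hom is_cring
    by (intro surjective_ring_hom.intro ring_hom_cring.intro ring_hom_cring_axioms.intro
        surjective_ring_hom_axioms.intro)
  have "a \<in> I \<longleftrightarrow> I +> a = I" if "a \<in> carrier R" for a
    using I.rcos_const_imp_mem[OF that] a_rcos_zero[OF I] that by blast
  then show "a_kernel R (R Quot I) ((+>) I) = I"
    using I.a_subset unfolding a_kernel_def' FactRing_def by auto
qed

section \<open>F-signature under adjunction of variables\<close>

text \<open>Covers one and several new variables at once, through J = \<open>{y}\<close> and J =
  \<open>{1..m}\<close>.\<close>

theorem F_signature_power_series_extension: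
  fixes K :: "('a, 'k) ring_scheme" and U :: "'u set" and J :: "'v set"
  defines "S \<equiv> power_series_ring K U"
  assumes K: "field K" and p: "Factorial_Ring.prime p" and char: "ring_characteristic K = p"
    and fin_dim: "ring.finite_dimension K (pth_powers p K) (carrier K)"
    and f: "f \<in> carrier S" "f \<noteq> \<zero>\<^bsub>S\<^esub>" "f \<notin> Units S"
    and U: "finite U" and J: "finite J"
  shows "F_signature p (S Quot (PIdl\<^bsub>S\<^esub> f)) =
    F_signature p (power_series_ring S J Quot (PIdl\<^bsub>power_series_ring S J\<^esub> (const_series S f)))"
proof -
  interpret K: field K by (rule K)
  have "add_pow K p \<one>\<^bsub>K\<^esub> = \<zero>\<^bsub>K\<^esub>"
    using K.add.pow_ord_eq_1[OF K.one_closed] unfolding char[unfolded ring_characteristic_def] .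
  then have Kp: "cring_char_p K p" using p by unfold_locales
  then interpret K: cring_char_p K p .
  interpret S: power_series_char_p K U p by unfold_locales
  have f0: "f {#} = \<zero>\<^bsub>K\<^esub>"
    using S.ps_unit_iff[of f] f K.field_Units unfolding S_def by blast
  let ?I = "PIdl\<^bsub>S\<^esub> f"
  define A where "A = S Quot ?I"
  have I: "ideal ?I S.PS" unfolding S_def by (rule S.PS.cgenideal_ideal) (use f(1) in \<open>simp add: S_def\<close>)
  define \<pi> where "\<pi> = (+>\<^bsub>S\<^esub>) ?I"
  have \<pi>: "surjective_ring_hom S.PS A \<pi>" and ker\<pi>: "a_kernel S.PS A \<pi> = ?I"
    using S.PS.quotient_surjective_ring_hom[OF I] unfolding A_def \<pi>_def S_def by auto
  interpret \<pi>: surjective_ring_hom S.PS A \<pi> by (rule \<pi>)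
  have Ap: "cring_char_p A p"
    by (rule cring_char_p_image[OF S.PS.cring_char_p_axioms \<pi>.S.is_cring \<pi>.homh])
  have ker0: "\<forall>g\<in>?I. g {#} = \<zero>\<^bsub>K\<^esub>"
  proof
    fix g assume g: "g \<in> ?I"
    obtain t where t: "t \<in> carrier S.PS" "g = t \<otimes>\<^bsub>S.PS\<^esub> f" using g unfolding cgenideal_def S_def by blast
    have "g {#} = t {#} \<otimes>\<^bsub>K\<^esub> f {#}"
      unfolding t(2) using ring_hom_mult[OF S.coeff0_hom t(1), of f] f(1) unfolding S_def by simp
    then show "g {#} = \<zero>\<^bsub>K\<^esub>" using f0 t(1) by auto
  qed
  obtain \<epsilon> where \<epsilon>: "\<epsilon> \<in> ring_hom A K" "\<epsilon> ` carrier A = carrier K"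
    "\<And>g. g \<in> carrier S.PS \<Longrightarrow> \<epsilon> (\<pi> g) = g {#}" "\<And>a. a \<in> carrier A \<Longrightarrow> \<epsilon> a \<noteq> \<zero>\<^bsub>K\<^esub> \<Longrightarrow> a \<in> Units A"
    using S.augmentation_exists[OF K \<pi>, unfolded ker\<pi>, OF ker0] by blast
  have dimA: "krull_dim A = enat (card U - 1)"
    by (rule K.krull_dim_power_series_hypersurface[OF U \<pi> ker\<pi>[unfolded S_def] f(1,2)[unfolded S_def] f0])
  have resA: "residue_log_degree p A = log p (real (ring.dim K (pth_powers p K) (carrier K)))"
    by (rule residue_log_degree_eq[OF K \<pi>.S.is_cring \<epsilon>(1,2,4)])

  interpret A: power_series_char_p A J p
    using Ap by (intro power_series_char_p.intro power_series.intro \<pi>.S.is_cring)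
  define c :: "'v multiset \<Rightarrow> 'u multiset \<Rightarrow> 'a" where "c = const_series S f"
  interpret SJ: power_series S.PS J by unfold_locales
  have c: "c \<in> carrier SJ.PS" unfolding c_def S_def const_series_eq_monom using f(1) by (auto simp: S_def)
  let ?Ic = "PIdl\<^bsub>SJ.PS\<^esub> c"
  define B where "B = SJ.PS Quot ?Ic"
  have Ic: "ideal ?Ic SJ.PS" by (rule SJ.PS.cgenideal_ideal[OF c])
  let ?H = "\<lambda>g m. \<pi> (g m)"
  have H: "surjective_ring_hom SJ.PS A.PS ?H" by (rule coefficientwise_hom[OF \<pi>])
  then interpret H: surjective_ring_hom SJ.PS A.PS ?H .
  have kerH: "a_kernel SJ.PS A.PS ?H = ?Ic"
    unfolding c_def S_def by (rule coefficientwise_kernel[OF \<pi> f(1)[unfolded S_def] ker\<pi>[unfolded S_def]])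
  \<comment> \<open>The isomorphism of B with A[[J]], through which the rank formula for power
    series over A becomes one for B.\<close>
  have isoB: "(\<lambda>Y. the_elem (?H ` Y)) \<in> ring_iso B A.PS"
    using H.ring.FactRing_iso_set[OF H.surj] unfolding kerH B_def .
  have B_hom: "surjective_ring_hom SJ.PS B ((+>\<^bsub>SJ.PS\<^esub>) ?Ic)"
    and kerB: "a_kernel SJ.PS B ((+>\<^bsub>SJ.PS\<^esub>) ?Ic) = ?Ic"
    using SJ.PS.quotient_surjective_ring_hom[OF Ic] unfolding B_def by auto
  interpret qB: surjective_ring_hom SJ.PS B "(+>\<^bsub>SJ.PS\<^esub>) ?Ic" by (rule B_hom)
  have "inv_into (carrier B) (\<lambda>Y. the_elem (?H ` Y)) \<in> ring_iso A.PS B"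
    by (rule ring_iso_set_sym[OF qB.S.ring_axioms isoB])
  then have homB: "inv_into (carrier B) (\<lambda>Y. the_elem (?H ` Y)) \<in> ring_hom A.PS B"
    unfolding ring_iso_def by blast
  have Bp: "cring_char_p B p"
    by (rule cring_char_p_image[OF A.PS.cring_char_p_axioms qB.S.is_cring homB])

  have rank: "frobenius_free_rank p B e = (p ^ e) ^ card J * frobenius_free_rank p A e" for e
  proof -
    \<comment> \<open>Generators of K over its p^e-th powers bound the ranks of A at stage e, so
      that its maximal rank is attained.\<close>
    obtain T :: "nat list set" and w where T: "finite T" "w \<in> T \<rightarrow> carrier K"
      and gen: "\<forall>c\<in>carrier K. \<exists>\<beta>\<in>T \<rightarrow> carrier K. c = (\<Oplus>\<^bsub>K\<^esub>t\<in>T. \<beta> t [^]\<^bsub>K\<^esub> (p ^ e) \<otimes>\<^bsub>K\<^esub> w t)"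
      using K.frobenius_generators[OF fin_dim, of e] by blast
    have "frobenius_free_rank p A.PS e = (p ^ e) ^ card J * frobenius_free_rank p A e"
    proof (rule A.frobenius_free_rank_power_series[OF J K \<epsilon>(1)])
      show "a \<in> Units A" if "a \<in> carrier A" "\<epsilon> a \<noteq> \<zero>\<^bsub>K\<^esub>" for a using that by (rule \<epsilon>(4))
      show "r \<le> (p ^ e) ^ card U * card T" if "frobenius_dual_system p e A r x \<phi>" for r x \<phi>
        by (rule S.dual_system_quotient_bound[OF K U Ap \<pi>.homh \<pi>.surj \<epsilon>(1,3) T gen[rule_format] that])
    qed
    then show ?thesis
      using frobenius_free_rank_ring_iso[OF Bp A.PS.cring_char_p_axioms isoB, of e] by simp
  qed

  interpret T: power_series K "U <+> J" by unfold_locales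
  have curry: "curry_series \<in> ring_iso T.PS SJ.PS" by (rule K.curry_series_iso)
  have curry_hom: "curry_series \<in> ring_hom T.PS SJ.PS" and curry_bij: "bij_betw curry_series (carrier T.PS) (carrier SJ.PS)"
    using curry by (auto simp: ring_iso_def)
  \<comment> \<open>The presentation of B as a hypersurface over K in the variables
    \<open>U <+> J\<close>, with equation the series f' corresponding to the constant series of
    f.\<close>
  define \<theta> where "\<theta> F = ?Ic +>\<^bsub>SJ.PS\<^esub> curry_series F" for F
  have \<theta>hom: "\<theta> \<in> ring_hom T.PS B"
    using ring_hom_trans[OF curry_hom qB.homh] by (simp add: \<theta>_def[abs_def] comp_def)
  have "\<theta> ` carrier T.PS = (+>\<^bsub>SJ.PS\<^esub>) ?Ic ` carrier SJ.PS"
    unfolding \<theta>_def bij_betw_imp_surj_on[OF curry_bij, symmetric] image_image ..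
  then have "\<theta> ` carrier T.PS = carrier B" by (simp only: qB.surj)
  then have \<theta>: "surjective_ring_hom T.PS B \<theta>"
    using \<theta>hom T.ps_cring qB.S.is_cring
    by (intro surjective_ring_hom.intro ring_hom_cring.intro ring_hom_cring_axioms.intro
        surjective_ring_hom_axioms.intro)
  obtain f' where f': "f' \<in> carrier T.PS" "curry_series f' = c"
    using c curry_bij unfolding bij_betw_def by (metis imageE)
  have "f' (join_mset x y) = c y x" for x y using f'(2) by (auto simp: curry_series_def)
  from this[of "{#}" "{#}"] have f'0: "f' {#} = \<zero>\<^bsub>K\<^esub>"
    using f0 by (simp add: join_mset_def c_def const_series_def)
  have f'n: "f' \<noteq> \<zero>\<^bsub>T.PS\<^esub>"
  proof
    assume "f' = \<zero>\<^bsub>T.PS\<^esub>"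
    then have "c {#} x = \<zero>\<^bsub>K\<^esub>" for x unfolding f'(2)[symmetric] curry_series_def by (simp only: T.ps_zero)
    then have "f = \<zero>\<^bsub>S\<^esub>" unfolding S_def by (intro ext) (simp add: c_def const_series_def S.ps_zero)
    then show False using f(2) by simp
  qed
  have \<theta>ker: "a_kernel T.PS B \<theta> = PIdl\<^bsub>T.PS\<^esub> f'"
  proof -
    have "F \<in> a_kernel T.PS B \<theta> \<longleftrightarrow> F \<in> PIdl\<^bsub>T.PS\<^esub> f'" if F: "F \<in> carrier T.PS" for F
    proof -
      have cF: "curry_series F \<in> carrier SJ.PS" using F curry_hom by (rule ring_hom_closed[rotated])
      have "F \<in> a_kernel T.PS B \<theta> \<longleftrightarrow> curry_series F \<in> a_kernel SJ.PS B ((+>\<^bsub>SJ.PS\<^esub>) ?Ic)"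
        using F cF unfolding a_kernel_def' \<theta>_def by blast
      also have "\<dots> \<longleftrightarrow> (\<exists>t\<in>carrier SJ.PS. curry_series F = t \<otimes>\<^bsub>SJ.PS\<^esub> c)"
        unfolding kerB unfolding cgenideal_def by blast
      also have "\<dots> \<longleftrightarrow> (\<exists>G\<in>carrier T.PS. curry_series F = curry_series G \<otimes>\<^bsub>SJ.PS\<^esub> c)"
        unfolding bij_betw_imp_surj_on[OF curry_bij, symmetric] by blast
      also have "\<dots> \<longleftrightarrow> (\<exists>G\<in>carrier T.PS. curry_series F = curry_series (G \<otimes>\<^bsub>T.PS\<^esub> f'))"
        using f' ring_hom_mult[OF curry_hom _ f'(1)] by auto
      also have "\<dots> \<longleftrightarrow> (\<exists>G\<in>carrier T.PS. F = G \<otimes>\<^bsub>T.PS\<^esub> f')"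
        using F f'(1) T.PS.m_closed inj_on_eq_iff[OF bij_betw_imp_inj_on[OF curry_bij]] by auto
      also have "\<dots> \<longleftrightarrow> F \<in> PIdl\<^bsub>T.PS\<^esub> f'" unfolding cgenideal_def by blast
      finally show ?thesis .
    qed
    moreover have "a_kernel T.PS B \<theta> \<subseteq> carrier T.PS" unfolding a_kernel_def' by blast
    moreover have "PIdl\<^bsub>T.PS\<^esub> f' \<subseteq> carrier T.PS" using f'(1) unfolding cgenideal_def by auto
    ultimately show ?thesis by blast
  qed
  have "krull_dim B = enat (card (U <+> J) - 1)"
    by (rule K.krull_dim_power_series_hypersurface[OF _ \<theta> \<theta>ker f'(1) f'n f'0]) (use U J in auto)
  \<comment> \<open>The dimension of B is a truncated difference |U| + |J| - 1; it equals (|U| - 1)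
    + |J| because U is nonempty. Without variables f would be its constant term, which is
    zero.\<close>
  moreover have "U \<noteq> {}"
  proof
    assume "U = {}"
    have "f m = \<zero>\<^bsub>S\<^esub> m" for m
    proof (cases "m = {#}")
      case True
      then show ?thesis using f0 by (simp add: S_def S.ps_zero)
    next
      case False
      then have "\<not> set_mset m \<subseteq> U" using \<open>U = {}\<close> by auto
      then have "f m = \<zero>\<^bsub>K\<^esub>" using S.ps_coeff_outside f(1) unfolding S_def by blast
      then show ?thesis by (simp add: S_def S.ps_zero)
    qed
    then show False using f(2) by blast
  qed
  then have "card U > 0" using U by (simp add: card_gt_0_iff)
  ultimately have dimB: "krull_dim B = enat (card U - 1 + card J)"
    using U J by (simp add: card_Plus)
  have ker0': "\<forall>g\<in>PIdl\<^bsub>T.PS\<^esub> f'. g {#} = \<zero>\<^bsub>K\<^esub>"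
  proof
    fix g assume g: "g \<in> PIdl\<^bsub>T.PS\<^esub> f'"
    obtain t where t: "t \<in> carrier T.PS" "g = t \<otimes>\<^bsub>T.PS\<^esub> f'" using g unfolding cgenideal_def by blast
    have "g {#} = t {#} \<otimes>\<^bsub>K\<^esub> f' {#}"
      unfolding t(2) using ring_hom_mult[OF T.coeff0_hom t(1) f'(1)] by simp
    then show "g {#} = \<zero>\<^bsub>K\<^esub>" using f'0 t(1) by auto
  qed
  obtain \<epsilon>' where \<epsilon>': "\<epsilon>' \<in> ring_hom B K" "\<epsilon>' ` carrier B = carrier K"
    "\<And>a. a \<in> carrier B \<Longrightarrow> \<epsilon>' a \<noteq> \<zero>\<^bsub>K\<^esub> \<Longrightarrow> a \<in> Units B"
    using T.augmentation_exists[OF K \<theta>, unfolded \<theta>ker, OF ker0'] by blast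
  have resB: "residue_log_degree p B = log p (real (ring.dim K (pth_powers p K) (carrier K)))"
    by (rule residue_log_degree_eq[OF K qB.S.is_cring \<epsilon>'])

  have p0: "real p > 0" using p by (simp add: prime_gt_0_nat)
  have "real (frobenius_free_rank p A e) /
      real p powr (real e * (real (the_enat (krull_dim A)) + residue_log_degree p A))
    = real (frobenius_free_rank p B e) /
      real p powr (real e * (real (the_enat (krull_dim B)) + residue_log_degree p B))" for e
  proof -
    define \<alpha> where "\<alpha> = log p (real (ring.dim K (pth_powers p K) (carrier K)))"
    \<comment> \<open>The growth of the dimension by |J| contributes the factor p^(e|J|) to the
      denominator, the same factor that \<open>rank\<close> contributes to the numerator.\<close>
    have "real e * (real (card U - 1 + card J) + \<alpha>)
        = real (e * card J) + real e * (real (card U - 1) + \<alpha>)" by (simp add: algebra_simps)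
    then have "real p powr (real e * (real (card U - 1 + card J) + \<alpha>))
        = real ((p ^ e) ^ card J) * real p powr (real e * (real (card U - 1) + \<alpha>))"
      using p0 by (simp only: powr_add powr_realpow power_mult of_nat_power)
    then show ?thesis
      using p0 by (simp add: dimA dimB resA resB rank \<alpha>_def)
  qed
  then have "F_signature p A = F_signature p B" unfolding F_signature_def by simp
  then show ?thesis unfolding A_def B_def c_def S_def by simp
qed

theorem proposition6p10:
  fixes K :: "('a, 'k) ring_scheme" and p n :: nat and y :: 'v
    and f :: "nat multiset \<Rightarrow> 'a"
  defines "S \<equiv> power_series_ring K {1..n}"
  assumes "field K"
    and "Factorial_Ring.prime p" and "ring_characteristic K = p"
    and "ring.finite_dimension K (pth_powers p K) (carrier K)"
    and "f \<in> carrier S" and "f \<noteq> \<zero>\<^bsub>S\<^esub>" and "f \<notin> Units S"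
  shows "F_signature p (S Quot (PIdl\<^bsub>S\<^esub> f)) =
      F_signature p (power_series_ring S {y} Quot
        (PIdl\<^bsub>power_series_ring S {y}\<^esub> (const_series S f)))
    \<and> (\<forall>m::nat. 1 \<le> m \<longrightarrow>
        F_signature p (S Quot (PIdl\<^bsub>S\<^esub> f)) =
        F_signature p (power_series_ring S {1..m} Quot
          (PIdl\<^bsub>power_series_ring S {1..m}\<^esub> (const_series S f))))"
proof -
  note ext = F_signature_power_series_extension[OF assms(2-5) assms(6-8)[unfolded S_def]]
  show ?thesis unfolding S_def by (intro conjI allI impI ext) auto
qed

end
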